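(* Let $P_{X,Y}$ be a primitive and let $P_{X',Y'}$ be a primitive with $X'=(X'_0,X'_1)$ and $Y'=(Y'_0,Y'_1)$. Assume $$\sum_{(x,y):\,P_{X'_0,Y'_0|X'_1=x,Y'_1=y}\simeq P_{X,Y}}P_{X'_1,Y'_1}(x,y)\ \ge\ 1-\delta,$$ where $\simeq$ means that the two distributions are equal up to relabeling of the alphabets. Then $\Delta_{P_{X',Y'}}\ge(1-\delta)\,\Delta_{P_{X,Y}}$.
   Context: A primitive is a joint distribution $P_{X,Y}$ on finite sets $\mathcal X\times\mathcal Y$. $\mathcal H_A,\mathcal H_B$ have computational bases indexed by $\mathcal X,\mathcal Y$; $\mathcal H_{A'},\mathcal H_{B'}$ are finite-dimensional (possibly trivial) work spaces. For a pure state on $AA'BB'$, $X$ (resp. $Y$) is the outcome of measuring $A$ (resp. $B$) in the computational basis; entropic quantities are evaluated on the state obtained by measuring exactly the registers named by $X$ or $Y$ and tracing out unmentioned registers; $S(P;Q)=S(P)+S(Q)-S(PQ)$ (von Neumann); $I$ is Shannon mutual information. An embedding of $P_{X,Y}$ is a pure state with $(X,Y)\sim P_{X,Y}$ and $S(X;YB')=S(XA';Y)=I(X;Y)$; its leakage is $\Delta_\psi(P_{X,Y})=\max\{S(X;BB')-I(X;Y),S(AA';Y)-I(X;Y)\}$. The leakage of a primitive is $\Delta_{P_{X,Y}}:=\min_\psi\Delta_\psi(P_{X,Y})$ over all embeddings of $P_{X,Y}$. *)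

theory Defs
  imports "HOL-Probability.Probability_Mass_Function" "Jordan_Normal_Form.Char_Poly"
begin

text \<open>An operator on the finite set I (with arbitrary index type) is given by its
  matrix entries M i j.  We turn it into a JNF matrix by choosing some enumeration of I
  (the spectrum does not depend on that choice) and take the von Neumann entropy
  (base-2 logarithm) as the sum of -lambda log lambda over the eigenvalues counted with
  multiplicity, i.e. over the roots of the characteristic polynomial.  For density
  operators the eigenvalues are real and nonnegative; note log 2 0 = 0 in Isabelle, so
  0 log 0 = 0 as usual.\<close>

definition op_mat :: "'i set \<Rightarrow> ('i \<Rightarrow> 'i \<Rightarrow> complex) \<Rightarrow> complex mat" where
  "op_mat I M = (let e = (SOME e. bij_betw e {..<card I} I)
                 in mat (card I) (card I) (\<lambda>(i, j). M (e i) (e j)))"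

definition vN_entropy :: "'i set \<Rightarrow> ('i \<Rightarrow> 'i \<Rightarrow> complex) \<Rightarrow> real" where
  "vN_entropy I M =
     sum_mset (image_mset (\<lambda>ev. - Re ev * log 2 (Re ev)) (proots (char_poly (op_mat I M))))"

text \<open>A pure state on AA'BB' is a vector psi indexed by (x, a', y, b') where x ranges over
  the alphabet 'x (computational basis of A), y over 'y (basis of B), and a' < dA,
  b' < dB index orthonormal bases of the finite-dimensional work spaces A', B'
  (dimension 1 = trivial work space).\<close>

type_synonym ('x, 'y) qstate = "'x \<times> nat \<times> 'y \<times> nat \<Rightarrow> complex"

definition full_idx :: "nat \<Rightarrow> nat \<Rightarrow> ('x \<times> nat \<times> 'y \<times> nat) set" where
  "full_idx dA dB = UNIV \<times> {..<dA} \<times> UNIV \<times> {..<dB}"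

definition is_pure_state :: "nat \<Rightarrow> nat \<Rightarrow> ('x::finite, 'y::finite) qstate \<Rightarrow> bool" where
  "is_pure_state dA dB \<psi> \<longleftrightarrow> 1 \<le> dA \<and> 1 \<le> dB \<and>
     (\<Sum>k\<in>full_idx dA dB. (cmod (\<psi> k))\<^sup>2) = 1"

text \<open>What happens to each of the four registers A, A', B, B':
  it is measured in the computational basis, kept as a quantum system, or traced out.\<close>

datatype reg_status = Meas | Keep | Trace

type_synonym status = "reg_status \<times> reg_status \<times> reg_status \<times> reg_status"

text \<open>Projection onto the coordinates that survive (traced coordinates are collapsed to a
  fixed dummy value).\<close>

definition keep_idx :: "status \<Rightarrow> 'x \<times> nat \<times> 'y \<times> nat \<Rightarrow> 'x \<times> nat \<times> 'y \<times> nat" where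
  "keep_idx s k = (case s of (sA, sA', sB, sB') \<Rightarrow> case k of (x, a, y, b) \<Rightarrow>
     (if sA = Trace then undefined else x, if sA' = Trace then 0 else a,
      if sB = Trace then undefined else y, if sB' = Trace then 0 else b))"

definition agree :: "status \<Rightarrow> 'x \<times> nat \<times> 'y \<times> nat \<Rightarrow> 'x \<times> nat \<times> 'y \<times> nat \<Rightarrow> bool" where
  "agree s k l = (case s of (sA, sA', sB, sB') \<Rightarrow> case k of (x, a, y, b) \<Rightarrow> case l of (x', a', y', b') \<Rightarrow>
     (sA \<noteq> Keep \<longrightarrow> x = x') \<and> (sA' \<noteq> Keep \<longrightarrow> a = a') \<and>
     (sB \<noteq> Keep \<longrightarrow> y = y') \<and> (sB' \<noteq> Keep \<longrightarrow> b = b'))"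

text \<open>The state obtained from |psi><psi| by measuring the registers with status Meas in the
  computational basis, and tracing out the registers with status Trace.  It is an operator
  on the index set red_idx.\<close>

definition red_idx :: "nat \<Rightarrow> nat \<Rightarrow> status \<Rightarrow> ('x \<times> nat \<times> 'y \<times> nat) set" where
  "red_idx dA dB s = keep_idx s ` full_idx dA dB"

definition red_state :: "nat \<Rightarrow> nat \<Rightarrow> ('x::finite, 'y::finite) qstate \<Rightarrow> status
    \<Rightarrow> 'x \<times> nat \<times> 'y \<times> nat \<Rightarrow> 'x \<times> nat \<times> 'y \<times> nat \<Rightarrow> complex" where
  "red_state dA dB \<psi> s i j =
     (\<Sum>k\<in>full_idx dA dB. \<Sum>l\<in>full_idx dA dB.
        if keep_idx s k = i \<and> keep_idx s l = j \<and> agree s k l then \<psi> k * cnj (\<psi> l) else 0)"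

definition qS :: "nat \<Rightarrow> nat \<Rightarrow> ('x::finite, 'y::finite) qstate \<Rightarrow> status \<Rightarrow> real" where
  "qS dA dB \<psi> s = vN_entropy (red_idx dA dB s) (red_state dA dB \<psi> s)"

definition qMI :: "nat \<Rightarrow> nat \<Rightarrow> ('x::finite, 'y::finite) qstate \<Rightarrow> status \<Rightarrow> status \<Rightarrow> status \<Rightarrow> real" where
  "qMI dA dB \<psi> sP sQ sPQ = qS dA dB \<psi> sP + qS dA dB \<psi> sQ - qS dA dB \<psi> sPQ"

text \<open>Register order: (A, A', B, B').  X = measure A, Y = measure B.\<close>

definition S_X_YB' :: "nat \<Rightarrow> nat \<Rightarrow> ('x::finite, 'y::finite) qstate \<Rightarrow> real" where
  "S_X_YB' dA dB \<psi> = qMI dA dB \<psi> (Meas, Trace, Trace, Trace) (Trace, Trace, Meas, Keep) (Meas, Trace, Meas, Keep)"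

definition S_XA'_Y :: "nat \<Rightarrow> nat \<Rightarrow> ('x::finite, 'y::finite) qstate \<Rightarrow> real" where
  "S_XA'_Y dA dB \<psi> = qMI dA dB \<psi> (Meas, Keep, Trace, Trace) (Trace, Trace, Meas, Trace) (Meas, Keep, Meas, Trace)"

definition S_X_BB' :: "nat \<Rightarrow> nat \<Rightarrow> ('x::finite, 'y::finite) qstate \<Rightarrow> real" where
  "S_X_BB' dA dB \<psi> = qMI dA dB \<psi> (Meas, Trace, Trace, Trace) (Trace, Trace, Keep, Keep) (Meas, Trace, Keep, Keep)"

definition S_AA'_Y :: "nat \<Rightarrow> nat \<Rightarrow> ('x::finite, 'y::finite) qstate \<Rightarrow> real" where
  "S_AA'_Y dA dB \<psi> = qMI dA dB \<psi> (Keep, Keep, Trace, Trace) (Trace, Trace, Meas, Trace) (Keep, Keep, Meas, Trace)"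

definition shannon_H :: "'a::finite pmf \<Rightarrow> real" where
  "shannon_H p = - (\<Sum>a\<in>UNIV. pmf p a * log 2 (pmf p a))"

definition shannon_MI :: "('x::finite \<times> 'y::finite) pmf \<Rightarrow> real" where
  "shannon_MI P = shannon_H (map_pmf fst P) + shannon_H (map_pmf snd P) - shannon_H P"

definition outcome_prob :: "nat \<Rightarrow> nat \<Rightarrow> ('x, 'y) qstate \<Rightarrow> 'x \<Rightarrow> 'y \<Rightarrow> real" where
  "outcome_prob dA dB \<psi> x y = (\<Sum>a<dA. \<Sum>b<dB. (cmod (\<psi> (x, a, y, b)))\<^sup>2)"

definition is_embedding :: "('x::finite \<times> 'y::finite) pmf \<Rightarrow> nat \<Rightarrow> nat \<Rightarrow> ('x, 'y) qstate \<Rightarrow> bool" where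
  "is_embedding P dA dB \<psi> \<longleftrightarrow> is_pure_state dA dB \<psi> \<and>
     (\<forall>x y. outcome_prob dA dB \<psi> x y = pmf P (x, y)) \<and>
     S_X_YB' dA dB \<psi> = shannon_MI P \<and> S_XA'_Y dA dB \<psi> = shannon_MI P"

definition leakage_state :: "('x::finite \<times> 'y::finite) pmf \<Rightarrow> nat \<Rightarrow> nat \<Rightarrow> ('x, 'y) qstate \<Rightarrow> real" where
  "leakage_state P dA dB \<psi> =
     max (S_X_BB' dA dB \<psi> - shannon_MI P) (S_AA'_Y dA dB \<psi> - shannon_MI P)"

definition leakage :: "('x::finite \<times> 'y::finite) pmf \<Rightarrow> real" where
  "leakage P = Inf {leakage_state P dA dB \<psi> | dA dB \<psi>. is_embedding P dA dB \<psi>}"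

definition marg1 :: "(('x0 \<times> 'x1) \<times> ('y0 \<times> 'y1)) pmf \<Rightarrow> ('x1 \<times> 'y1) pmf" where
  "marg1 Q = map_pmf (\<lambda>((a, x), (b, y)). (x, y)) Q"

text \<open>Conditional distribution of (X'_0, Y'_0) given X'_1 = x, Y'_1 = y
  (meaningful when that event has positive probability).\<close>

definition cond0 :: "(('x0 \<times> 'x1) \<times> ('y0 \<times> 'y1)) pmf \<Rightarrow> 'x1 \<Rightarrow> 'y1 \<Rightarrow> ('x0 \<times> 'y0) pmf" where
  "cond0 Q x y = map_pmf (\<lambda>((a, _), (b, _)). (a, b))
                   (cond_pmf Q {((a, x'), (b, y')). x' = x \<and> y' = y})"

definition relabel_eq :: "('a \<times> 'b) pmf \<Rightarrow> ('c \<times> 'd) pmf \<Rightarrow> bool" where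
  "relabel_eq Q P \<longleftrightarrow> (\<exists>f g. inj_on f (fst ` set_pmf Q) \<and> inj_on g (snd ` set_pmf Q) \<and>
                         map_pmf (map_prod f g) Q = P)"

end

theory Submission
  imports Defs
begin

text \<open>
  For an embedding, purity (the duality of the spectra of \<open>K K\<^sup>*\<close> and \<open>K\<^sup>* K\<close>) together with the
  two embedding conditions makes both terms of the maximum in the leakage equal to
  \<open>D = S(XYB') - S(XBB') - S(YB') + S(BB')\<close>.  Writing \<open>C(\<rho>) = S(N \<rho>) - S(\<rho>)\<close> for the entropy gain of
  the measurement \<open>N\<close> of \<open>B\<close>, this is \<open>\<Sum>\<^sub>x C(\<rho>\<^sub>x) - C(\<Sum>\<^sub>x \<rho>\<^sub>x)\<close> with unnormalised states \<open>\<rho>\<^sub>x\<close> of \<open>BB'\<close>.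
  Since \<open>C(\<rho>)\<close> is the relative entropy of \<open>\<rho>\<close> and \<open>N \<rho>\<close>, joint convexity makes \<open>C\<close> subadditive.
  Measuring first the \<open>Y'\<^sub>1\<close> part and then the \<open>Y'\<^sub>0\<close> part of \<open>B\<close>, two applications of
  subadditivity bound \<open>D\<close> from below by the sum over \<open>(x, y)\<close> of the same quantity for the
  unnormalised states obtained from \<open>X'\<^sub>1 = x\<close>, \<open>Y'\<^sub>1 = y\<close>.  After normalisation these are embeddings of
  the conditional distributions: the embedding condition says that a sum of nonnegative conditional
  Holevo quantities vanishes, and this is inherited by every summand.
\<close>

section \<open>Unitary diagonalisation\<close>

text \<open>Joint convexity is reached without matrix functions. An operator enters only through a
  diagonalisation, eigenvalues \<open>p\<close> and the rows of \<open>U\<close>, and divergences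
  are finite sums over pairs of eigenvectors weighted by squared overlaps. For each t > 0 a rational
  analogue of the relative entropy is a maximum of functionals linear in both operators, hence
  subadditive; a scalar primitive in t then carries the inequality over to the logarithm. The
  default \<open>ln 0 = 0\<close> stands where infinity should, so support conditions accompany the
  logarithmic statements. States stay unnormalised: convexity becomes subadditivity, a measured
  register becomes a plain sum over outcomes, and a slice is divided by its probability only when it
  has to be an embedding. The price is a correction of \<open>ent t\<close> times the trace under
  scaling by t; it cancels in \<open>leak\<close>, whose four entropies have equal traces and signs
  +, -, -, +. Subadditivity is applied twice because both alphabets must be split: measuring the
  second part of B is compared over all pairs (x0, x1), measuring the first part only over x1, after
  summation over x0.\<close>

definition unitary_on :: "'i set \<Rightarrow> ('i \<Rightarrow> 'i \<Rightarrow> complex) \<Rightarrow> bool" where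
  "unitary_on I U \<longleftrightarrow>
     (\<forall>k\<in>I. \<forall>l\<in>I. (\<Sum>i\<in>I. U k i * cnj (U l i)) = (if k = l then 1 else 0)) \<and>
     (\<forall>i\<in>I. \<forall>j\<in>I. (\<Sum>k\<in>I. cnj (U k i) * U k j) = (if i = j then 1 else 0))"

definition hermitian_on :: "'i set \<Rightarrow> ('i \<Rightarrow> 'i \<Rightarrow> complex) \<Rightarrow> bool" where
  "hermitian_on I M \<longleftrightarrow> (\<forall>i\<in>I. \<forall>j\<in>I. M j i = cnj (M i j))"

text \<open>The eigenvectors are the rows of \<open>U\<close>, indexed by the same set as the
  coordinates, so \<open>p\<close> lists the spectrum with multiplicity and no order on
  \<open>I\<close> is needed.\<close>

definition eigen_decomp ::
    "'i set \<Rightarrow> ('i \<Rightarrow> 'i \<Rightarrow> complex) \<Rightarrow> ('i \<Rightarrow> real) \<Rightarrow> ('i \<Rightarrow> 'i \<Rightarrow> complex) \<Rightarrow> bool" where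
  "eigen_decomp I M p U \<longleftrightarrow> unitary_on I U \<and>
     (\<forall>i\<in>I. \<forall>j\<in>I. M i j = (\<Sum>k\<in>I. of_real (p k) * U k i * cnj (U k j)))"

definition ent :: "real \<Rightarrow> real" where
  "ent x = - x * log 2 x"

lemma unitary_on_rows:
  "unitary_on I U \<Longrightarrow> k \<in> I \<Longrightarrow> l \<in> I \<Longrightarrow> (\<Sum>i\<in>I. U k i * cnj (U l i)) = (if k = l then 1 else 0)"
  and unitary_on_cols:
  "unitary_on I U \<Longrightarrow> i \<in> I \<Longrightarrow> j \<in> I \<Longrightarrow> (\<Sum>k\<in>I. cnj (U k i) * U k j) = (if i = j then 1 else 0)"
  by (auto simp: unitary_on_def)

lemma unitary_on_cnj:
  assumes "unitary_on I U" shows "unitary_on I (\<lambda>k i. cnj (U k i))"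
proof -
  have "(\<Sum>i\<in>I. cnj (U k i) * U l i) = (if k = l then 1 else 0)" if "k \<in> I" "l \<in> I" for k l
    using arg_cong[OF unitary_on_rows[OF assms that], of cnj] by (auto simp: cnj_sum)
  moreover have "(\<Sum>k\<in>I. U k i * cnj (U k j)) = (if i = j then 1 else 0)" if "i \<in> I" "j \<in> I" for i j
    using arg_cong[OF unitary_on_cols[OF assms that], of cnj] by (auto simp: cnj_sum)
  ultimately show ?thesis by (auto simp: unitary_on_def)
qed

lemma sum_delta_mult:
  fixes f :: "'i \<Rightarrow> complex"
  assumes "finite I" "j \<in> I"
  shows "(\<Sum>i\<in>I. (if i = j then 1 else 0) * f i) = f j" "(\<Sum>i\<in>I. (if j = i then 1 else 0) * f i) = f j"
    "(\<Sum>i\<in>I. f i * (if i = j then 1 else 0)) = f j" "(\<Sum>i\<in>I. f i * (if j = i then 1 else 0)) = f j"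
  using assms by (simp_all add: if_distrib if_distribR cong: if_cong)

lemma sum_swap_pairs:
  fixes f :: "'a \<Rightarrow> 'b \<Rightarrow> 'c \<Rightarrow> 'd \<Rightarrow> 'e::comm_monoid_add"
  shows "(\<Sum>a\<in>A. \<Sum>b\<in>B. \<Sum>c\<in>C. \<Sum>d\<in>D. f a b c d) = (\<Sum>c\<in>C. \<Sum>d\<in>D. \<Sum>a\<in>A. \<Sum>b\<in>B. f a b c d)"
proof -
  have "(\<Sum>a\<in>A. \<Sum>b\<in>B. \<Sum>c\<in>C. \<Sum>d\<in>D. f a b c d) = (\<Sum>a\<in>A. \<Sum>c\<in>C. \<Sum>d\<in>D. \<Sum>b\<in>B. f a b c d)"
    by (intro sum.cong refl) (subst sum.swap, intro sum.cong refl, rule sum.swap)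
  also have "\<dots> = (\<Sum>c\<in>C. \<Sum>d\<in>D. \<Sum>a\<in>A. \<Sum>b\<in>B. f a b c d)"
    by (subst sum.swap, intro sum.cong refl, rule sum.swap)
  finally show ?thesis .
qed

lemma unitary_on_mult:
  assumes "finite I" "unitary_on I U" "unitary_on I V"
  shows "unitary_on I (\<lambda>k i. \<Sum>j\<in>I. U k j * V j i)"
proof -
  have "(\<Sum>i\<in>I. (\<Sum>j\<in>I. U k j * V j i) * cnj (\<Sum>j\<in>I. U l j * V j i)) = (if k = l then 1 else 0)"
    if k: "k \<in> I" and l: "l \<in> I" for k l
  proof -
    have "(\<Sum>i\<in>I. (\<Sum>j\<in>I. U k j * V j i) * cnj (\<Sum>j\<in>I. U l j * V j i)) =
       (\<Sum>i\<in>I. \<Sum>j\<in>I. \<Sum>j'\<in>I. U k j * cnj (U l j') * (V j i * cnj (V j' i)))"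
      unfolding cnj_sum sum_product by (intro sum.cong refl) (simp add: mult_ac)
    also have "\<dots> = (\<Sum>j\<in>I. \<Sum>j'\<in>I. \<Sum>i\<in>I. U k j * cnj (U l j') * (V j i * cnj (V j' i)))"
      by (subst sum.swap, rule sum.cong[OF refl], subst sum.swap, rule refl)
    also have "\<dots> = (\<Sum>j\<in>I. \<Sum>j'\<in>I. U k j * cnj (U l j') * (if j = j' then 1 else 0))"
      by (intro sum.cong refl) (simp add: sum_distrib_left[symmetric] unitary_on_rows[OF assms(3)])
    also have "\<dots> = (\<Sum>j\<in>I. U k j * cnj (U l j))"
      by (intro sum.cong refl) (rule sum_delta_mult(4)[OF assms(1)])
    finally show ?thesis using unitary_on_rows[OF assms(2) k l] by simp
  qed
  moreover have "(\<Sum>k\<in>I. cnj (\<Sum>m\<in>I. U k m * V m i) * (\<Sum>m\<in>I. U k m * V m j)) = (if i = j then 1 else 0)"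
    if i: "i \<in> I" and j: "j \<in> I" for i j
  proof -
    have "(\<Sum>k\<in>I. cnj (\<Sum>m\<in>I. U k m * V m i) * (\<Sum>m\<in>I. U k m * V m j)) =
       (\<Sum>k\<in>I. \<Sum>m\<in>I. \<Sum>m'\<in>I. cnj (V m i) * V m' j * (cnj (U k m) * U k m'))"
      unfolding cnj_sum sum_product by (intro sum.cong refl) (simp add: mult_ac)
    also have "\<dots> = (\<Sum>m\<in>I. \<Sum>m'\<in>I. \<Sum>k\<in>I. cnj (V m i) * V m' j * (cnj (U k m) * U k m'))"
      by (subst sum.swap, rule sum.cong[OF refl], subst sum.swap, rule refl)
    also have "\<dots> = (\<Sum>m\<in>I. \<Sum>m'\<in>I. cnj (V m i) * V m' j * (if m = m' then 1 else 0))"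
      by (intro sum.cong refl) (simp add: sum_distrib_left[symmetric] unitary_on_cols[OF assms(2)])
    also have "\<dots> = (\<Sum>m\<in>I. cnj (V m i) * V m j)"
      by (intro sum.cong refl) (rule sum_delta_mult(4)[OF assms(1)])
    finally show ?thesis using unitary_on_cols[OF assms(3) i j] by simp
  qed
  ultimately show ?thesis by (auto simp: unitary_on_def)
qed

text \<open>Eigenvectors of the conjugated operator are pulled back by the adjoint of
  \<open>H\<close>. This lets the diagonalisation work in a convenient basis.\<close>

lemma eigen_decomp_conj:
  assumes fin: "finite I" and H: "unitary_on I H"
    and D: "eigen_decomp I (\<lambda>k l. \<Sum>i\<in>I. \<Sum>j\<in>I. H k i * M i j * cnj (H l j)) p U"
  shows "eigen_decomp I M p (\<lambda>m i. \<Sum>k\<in>I. U m k * cnj (H k i))"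
proof -
  have "M i j = (\<Sum>m\<in>I. of_real (p m) * (\<Sum>k\<in>I. U m k * cnj (H k i)) * cnj (\<Sum>k\<in>I. U m k * cnj (H k j)))"
    if i: "i \<in> I" and j: "j \<in> I" for i j
  proof -
    \<comment> \<open>The two Kronecker deltas are inserted so that each can be replaced by the
      product of the adjoint of \<open>H\<close> with \<open>H\<close>.\<close>
    have "M i j = (\<Sum>a\<in>I. (\<Sum>b\<in>I. M a b * (if b = j then 1 else 0)) * (if i = a then 1 else 0))"
      by (simp only: sum_delta_mult[OF fin j] sum_delta_mult[OF fin i])
    also have "\<dots> = (\<Sum>a\<in>I. \<Sum>b\<in>I. M a b * (\<Sum>k\<in>I. cnj (H k i) * H k a) * (\<Sum>l\<in>I. cnj (H l b) * H l j))"
      using i j by (simp add: unitary_on_cols[OF H] sum_distrib_right) (intro sum.cong refl, simp)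
    also have "\<dots> = (\<Sum>a\<in>I. \<Sum>b\<in>I. \<Sum>k\<in>I. \<Sum>l\<in>I. cnj (H k i) * H l j * (H k a * M a b * cnj (H l b)))"
      unfolding mult.assoc sum_product unfolding sum_distrib_left
      by (intro sum.cong refl) (simp add: mult_ac)
    also have "\<dots> = (\<Sum>k\<in>I. \<Sum>l\<in>I. \<Sum>a\<in>I. \<Sum>b\<in>I. cnj (H k i) * H l j * (H k a * M a b * cnj (H l b)))"
      by (rule sum_swap_pairs)
    also have "\<dots> = (\<Sum>k\<in>I. \<Sum>l\<in>I. cnj (H k i) * H l j * (\<Sum>m\<in>I. of_real (p m) * U m k * cnj (U m l)))"
      using D by (intro sum.cong refl) (simp add: eigen_decomp_def sum_distrib_left[symmetric])
    also have "\<dots> = (\<Sum>k\<in>I. \<Sum>l\<in>I. \<Sum>m\<in>I. of_real (p m) * (U m k * cnj (H k i)) * cnj (U m l * cnj (H l j)))"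
      by (simp add: sum_distrib_left algebra_simps)
    also have "\<dots> = (\<Sum>m\<in>I. \<Sum>k\<in>I. \<Sum>l\<in>I. of_real (p m) * (U m k * cnj (H k i)) * cnj (U m l * cnj (H l j)))"
      by (rule trans[OF sum.cong[OF refl sum.swap] sum.swap])
    also have "\<dots> = (\<Sum>m\<in>I. of_real (p m) * (\<Sum>k\<in>I. U m k * cnj (H k i)) * cnj (\<Sum>k\<in>I. U m k * cnj (H k j)))"
      unfolding cnj_sum sum_product mult.assoc unfolding sum_distrib_left
      by (simp add: mult_ac)
    finally show ?thesis .
  qed
  then show ?thesis
    using unitary_on_mult[OF fin _ unitary_on_cnj[OF H]] D by (auto simp: eigen_decomp_def)
qed

section \<open>Matrices of operators on an arbitrary finite index set\<close>

definition enum_of :: "'i set \<Rightarrow> nat \<Rightarrow> 'i" where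
  "enum_of I = (SOME e. bij_betw e {..<card I} I)"

lemma enum_of: "finite I \<Longrightarrow> bij_betw (enum_of I) {..<card I} I"
  using someI_ex[OF ex_bij_betw_nat_finite[of I, unfolded atLeast0LessThan]] by (simp add: enum_of_def)

lemma op_mat_enum: "op_mat I M = mat (card I) (card I) (\<lambda>(i, j). M (enum_of I i) (enum_of I j))"
  by (simp add: op_mat_def enum_of_def Let_def)

lemma op_mat_carrier: "op_mat I M \<in> carrier_mat (card I) (card I)"
  by (simp add: op_mat_enum)

lemma sum_enum_of: "finite I \<Longrightarrow> (\<Sum>k<card I. f (enum_of I k)) = (\<Sum>i\<in>I. f i)"
  using sum.reindex_bij_betw[OF enum_of] .

text \<open>The characteristic polynomial splits over the complex numbers, so it has a root as soon
  as \<open>I\<close> is nonempty; the eigenvector of the enumerated matrix is carried back to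
  coordinates in \<open>I\<close>.\<close>

lemma exists_eigenvector:
  fixes M :: "'i \<Rightarrow> 'i \<Rightarrow> complex"
  assumes fin: "finite I" and ne: "I \<noteq> {}"
  shows "\<exists>v e. (\<exists>i\<in>I. v i \<noteq> 0) \<and> (\<forall>i\<in>I. (\<Sum>j\<in>I. M i j * v j) = e * v i)"
proof -
  let ?A = "op_mat I M" let ?n = "card I" let ?e = "enum_of I"
  have A: "?A \<in> carrier_mat ?n ?n" by (rule op_mat_carrier)
  have n: "?n \<noteq> 0" using fin ne by simp
  obtain as where as: "char_poly ?A = (\<Prod>a\<leftarrow>as. [:- a, 1:])" "length as = ?n"
    using char_poly_factorized[OF A] by blast
  then obtain a as' where "as = a # as'" using n by (cases as) auto
  with as have "poly (char_poly ?A) a = 0" by simp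
  then have "eigenvalue ?A a" using eigenvalue_root_char_poly[OF A] by simp
  then obtain w where w: "w \<in> carrier_vec ?n" "w \<noteq> 0\<^sub>v ?n" "?A *\<^sub>v w = a \<cdot>\<^sub>v w"
    unfolding eigenvalue_def eigenvector_def using A by auto
  define v where "v i = w $ (the_inv_into {..<?n} ?e i)" for i
  have inj: "inj_on ?e {..<?n}" using enum_of[OF fin] by (simp add: bij_betw_def)
  have ve: "v (?e k) = w $ k" if "k < ?n" for k
    unfolding v_def using the_inv_into_f_f[OF inj] that by simp
  obtain k where k: "k < ?n" "w $ k \<noteq> 0" using w(1,2) by (metis eq_vecI index_zero_vec carrier_vecD)
  have "(\<Sum>j\<in>I. M (?e k) j * v j) = a * v (?e k)" if k: "k < ?n" for k
  proof -
    have "(\<Sum>j\<in>I. M (?e k) j * v j) = (\<Sum>j<?n. M (?e k) (?e j) * v (?e j))"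
      by (rule sum_enum_of[OF fin, symmetric])
    also have "\<dots> = (\<Sum>j<?n. M (?e k) (?e j) * w $ j)" by (simp add: ve)
    also have "\<dots> = (?A *\<^sub>v w) $ k"
      using k w(1) by (simp add: op_mat_enum scalar_prod_def atLeast0LessThan)
    also have "\<dots> = a * v (?e k)" using k w by (simp add: ve)
    finally show ?thesis .
  qed
  note ev = this
  have "?e k \<in> I" using enum_of[OF fin] k by (auto simp: bij_betw_def)
  moreover have "(\<Sum>j\<in>I. M i j * v j) = a * v i" if "i \<in> I" for i
  proof -
    from that have "i \<in> ?e ` {..<?n}" using enum_of[OF fin] by (simp add: bij_betw_def)
    then show ?thesis using ev by blast
  qed
  ultimately show ?thesis using ve[OF k(1)] k(2) by metis
qed

text \<open>Eigenvectors of the blocks, the fibres of \<open>f\<close>, are extended by zero.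
  Besides the existence of a diagonalisation, the explicit form matters later: every eigenvector
  lives in a single block.\<close>

lemma eigen_decomp_blocks:
  assumes fin: "finite I"
    and D: "\<And>c. c \<in> f ` I \<Longrightarrow> eigen_decomp {i\<in>I. f i = c} M (p c) (U c)"
    and off: "\<And>i j. i \<in> I \<Longrightarrow> j \<in> I \<Longrightarrow> f i \<noteq> f j \<Longrightarrow> M i j = 0"
  shows "eigen_decomp I M (\<lambda>k. p (f k) k) (\<lambda>k i. if f k = f i then U (f k) k i else 0)"
proof -
  let ?U = "\<lambda>k i. if f k = f i then U (f k) k i else 0"
  have filt: "(\<Sum>i\<in>I. if f i = c then g i else 0) = (\<Sum>i | i \<in> I \<and> f i = c. g i)" for c and g :: "'a \<Rightarrow> complex"
    using sum.inter_filter[OF fin, of g "\<lambda>i. f i = c"] by simp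
  have "(\<Sum>i\<in>I. ?U k i * cnj (?U l i)) = (if k = l then 1 else 0)" if k: "k \<in> I" and l: "l \<in> I" for k l
  proof (cases "f k = f l")
    case True
    have "(\<Sum>i\<in>I. ?U k i * cnj (?U l i)) = (\<Sum>i\<in>I. if f i = f l then U (f l) k i * cnj (U (f l) l i) else 0)"
      by (rule sum.cong) (auto simp: True)
    then show ?thesis
      using D[of "f l"] k l True unitary_on_rows[of "{i\<in>I. f i = f l}" "U (f l)" k l]
      by (simp add: filt eigen_decomp_def)
  next
    case False
    then have "(\<Sum>i\<in>I. ?U k i * cnj (?U l i)) = 0" by (intro sum.neutral) auto
    with False show ?thesis by auto
  qed
  moreover have "(\<Sum>k\<in>I. cnj (?U k i) * ?U k j) = (if i = j then 1 else 0)" if k: "i \<in> I" and l: "j \<in> I" for i j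
  proof (cases "f i = f j")
    case True
    have "(\<Sum>k\<in>I. cnj (?U k i) * ?U k j) = (\<Sum>k\<in>I. if f k = f j then cnj (U (f j) k i) * U (f j) k j else 0)"
      by (rule sum.cong) (auto simp: True)
    then show ?thesis
      using D[of "f j"] k l True unitary_on_cols[of "{i\<in>I. f i = f j}" "U (f j)" i j]
      by (simp add: filt eigen_decomp_def)
  next
    case False
    then have "(\<Sum>k\<in>I. cnj (?U k i) * ?U k j) = 0" by (intro sum.neutral) auto
    with False show ?thesis by auto
  qed
  moreover have "M i j = (\<Sum>k\<in>I. of_real (p (f k) k) * ?U k i * cnj (?U k j))" if k: "i \<in> I" and l: "j \<in> I" for i j
  proof (cases "f i = f j")
    case True
    have "(\<Sum>k\<in>I. of_real (p (f k) k) * ?U k i * cnj (?U k j)) =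
        (\<Sum>k\<in>I. if f k = f j then of_real (p (f j) k) * U (f j) k i * cnj (U (f j) k j) else 0)"
      by (rule sum.cong) (auto simp: True)
    then show ?thesis
      using D[of "f j"] k l True by (simp add: filt eigen_decomp_def)
  next
    case False
    then have "(\<Sum>k\<in>I. of_real (p (f k) k) * ?U k i * cnj (?U k j)) = 0" by (intro sum.neutral) auto
    with False off k l show ?thesis by auto
  qed
  ultimately show ?thesis by (auto simp: eigen_decomp_def unitary_on_def)
qed


text \<open>The Householder reflection exchanging the unit vectors \<open>e\<^sub>a\<close> and \<open>v\<close>.\<close>

lemma exists_unitary_row:
  assumes fin: "finite I" and a: "a \<in> I" and norm: "(\<Sum>i\<in>I. v i * cnj (v i)) = 1"
    and va: "v a = of_real r" "r \<ge> 0"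
  shows "\<exists>H. unitary_on I H \<and> (\<forall>i\<in>I. H a i = cnj (v i))"
proof -
  define w where "w i = (if i = a then 1 else 0) - v i" for i
  \<comment> \<open>The reflection coefficient is 2 / |w|^2, and |w|^2 = 2 (1 - r) because
    \<open>v\<close> is a unit vector with real entry r at \<open>a\<close>. For r = 1 the vectors
    coincide and \<open>H\<close> is the identity.\<close>
  define c :: real where "c = (if r = 1 then 0 else 1 / (1 - r))"
  define H where "H i j = (if i = j then 1 else 0) - of_real c * w i * cnj (w j)" for i j
  have N: "(\<Sum>i\<in>I. w i * cnj (w i)) = of_real (2 * (1 - r))"
  proof -
    have "(\<Sum>i\<in>I. w i * cnj (w i)) =
        (\<Sum>i\<in>I. (if i = a then 1 else 0) * (1 - v i - cnj (v i))) + (\<Sum>i\<in>I. v i * cnj (v i))"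
      unfolding sum.distrib[symmetric] by (rule sum.cong) (auto simp: w_def algebra_simps)
    then show ?thesis by (simp add: sum_delta_mult[OF fin a] norm va)
  qed
  have cN: "of_real c * of_real c * (\<Sum>i\<in>I. w i * cnj (w i)) = complex_of_real (2 * c)"
  proof -
    have "r = 1 \<or> c * (1 - r) = 1" by (simp add: c_def)
    then have "c * c * (2 * (1 - r)) = 2 * c"
    proof
      assume "c * (1 - r) = 1"
      moreover have "c * c * (2 * (1 - r)) = 2 * c * (c * (1 - r))" by (simp add: mult_ac)
      ultimately show ?thesis by simp
    qed (simp add: c_def)
    then show ?thesis unfolding N of_real_mult[symmetric] by (simp only:)
  qed
  have HH: "(\<Sum>m\<in>I. H i m * H m j) = (if i = j then 1 else 0)" if i: "i \<in> I" and j: "j \<in> I" for i j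
  proof -
    have "(\<Sum>m\<in>I. H i m * H m j) = (\<Sum>m\<in>I. (if i = m then 1 else 0) * (if m = j then 1 else 0)
       - (if i = m then 1 else 0) * (of_real c * w m * cnj (w j))
       - of_real c * w i * cnj (w m) * (if m = j then 1 else 0)
       + (of_real c * of_real c * w i * cnj (w j)) * (w m * cnj (w m)))"
      by (intro sum.cong refl) (simp add: H_def algebra_simps)
    also have "\<dots> = (if i = j then 1 else 0) - of_real c * w i * cnj (w j) - of_real c * w i * cnj (w j)
        + (of_real c * of_real c * w i * cnj (w j)) * (\<Sum>m\<in>I. w m * cnj (w m))"
      unfolding sum.distrib sum_subtractf sum_delta_mult[OF fin i] sum_delta_mult[OF fin j]
        sum_distrib_left[symmetric] by simp
    also have "\<dots> = (if i = j then 1 else 0) - 2 * of_real c * w i * cnj (w j)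
        + (of_real c * of_real c * (\<Sum>m\<in>I. w m * cnj (w m))) * w i * cnj (w j)"
      by (simp add: algebra_simps)
    finally show ?thesis unfolding cN by simp
  qed
  have herm: "cnj (H i j) = H j i" for i j by (simp add: H_def)
  have "H a i = cnj (v i)" if i: "i \<in> I" for i
  proof (cases "r = 1")
    case True
    have "w i * cnj (w i) = 0"
    proof -
      have "(\<Sum>i\<in>I. (cmod (w i))\<^sup>2) = 0"
        by (simp only: of_real_eq_iff[where 'a=complex, symmetric] of_real_sum complex_norm_square N True) simp
      then show ?thesis using i fin by (simp add: sum_nonneg_eq_0_iff)
    qed
    then have "v i = (if i = a then 1 else 0)" by (simp add: w_def)
    then show ?thesis using True by (simp add: H_def c_def)
  next
    case False
    have "of_real c * w a = 1"
    proof -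
      have "of_real c * w a = of_real (c * (1 - r))" by (simp add: w_def va)
      then show ?thesis using False by (simp add: c_def)
    qed
    then show ?thesis by (simp add: H_def w_def)
  qed
  then show ?thesis using HH herm by (intro exI[of _ H]) (simp add: unitary_on_def)
qed

text \<open>Induction on the index set: a reflection moves a unit eigenvector to the coordinate
  \<open>a\<close>; since the conjugated operator is Hermitian, it splits into the block
  \<open>{a}\<close> and a Hermitian operator on the smaller set.\<close>

theorem hermitian_eigen_decomp:
  assumes "finite I" "hermitian_on I M"
  shows "\<exists>p U. eigen_decomp I M p U"
  using assms
proof (induction I arbitrary: M rule: finite_induct)
  case empty
  then show ?case by (simp add: eigen_decomp_def unitary_on_def)
next
  case (insert a I)
  let ?J = "insert a I"
  have fin: "finite ?J" and aJ: "a \<in> ?J" using insert by auto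
  obtain v0 e where v0: "\<exists>i\<in>?J. v0 i \<noteq> 0" "\<And>i. i \<in> ?J \<Longrightarrow> (\<Sum>j\<in>?J. M i j * v0 j) = e * v0 i"
    using exists_eigenvector[OF fin, of M] by auto
  define s where "s = (\<Sum>i\<in>?J. (cmod (v0 i))\<^sup>2)"
  \<comment> \<open>This phase makes the entry of the eigenvector at \<open>a\<close> real and
    nonnegative, as \<open>exists_unitary_row\<close> demands.\<close>
  define u where "u = (if v0 a = 0 then 1 else cnj (v0 a) / of_real (cmod (v0 a)))"
  define v where "v i = u * v0 i / of_real (sqrt s)" for i
  have s: "s > 0" unfolding s_def using v0(1) fin by (auto intro: sum_pos2 simp del: sum.insert)
  have u: "u * cnj u = 1"
  proof -
    have "cmod u = 1" by (simp add: u_def norm_divide)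
    then show ?thesis by (simp add: complex_norm_square[symmetric])
  qed
  have norm: "(\<Sum>i\<in>?J. v i * cnj (v i)) = 1"
  proof -
    have "v i * cnj (v i) = of_real ((cmod (v0 i))\<^sup>2 / s)" for i
    proof -
      have "v i * cnj (v i) = (u * cnj u) * (v0 i * cnj (v0 i)) / (of_real (sqrt s) * of_real (sqrt s))"
        by (simp add: v_def)
      also have "\<dots> = of_real ((cmod (v0 i))\<^sup>2) / of_real (sqrt s * sqrt s)"
        by (simp only: u complex_norm_square mult_1 of_real_mult)
      also have "\<dots> = of_real ((cmod (v0 i))\<^sup>2 / s)" using s by (simp only: real_sqrt_mult_self abs_of_pos of_real_divide)
      finally show ?thesis .
    qed
    then have "(\<Sum>i\<in>?J. v i * cnj (v i)) = of_real (s / s)"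
      unfolding s_def sum_divide_distrib by (simp only: of_real_sum)
    then show ?thesis using s by simp
  qed
  have ev: "(\<Sum>j\<in>?J. M i j * v j) = e * v i" if "i \<in> ?J" for i
  proof -
    have "(\<Sum>j\<in>?J. M i j * v j) = u / of_real (sqrt s) * (\<Sum>j\<in>?J. M i j * v0 j)"
      unfolding sum_distrib_left by (rule sum.cong) (auto simp: v_def)
    then show ?thesis using v0(2)[OF that] by (simp add: v_def)
  qed
  have va: "v a = of_real (cmod (v0 a) / sqrt s)"
  proof -
    have "u * v0 a = of_real (cmod (v0 a))"
      by (simp add: u_def field_simps complex_norm_square[symmetric] power2_eq_square)
    then show ?thesis by (simp add: v_def)
  qed
  obtain H where H: "unitary_on ?J H" "\<And>i. i \<in> ?J \<Longrightarrow> H a i = cnj (v i)"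
    using exists_unitary_row[OF fin aJ norm va] s by auto
  define M' where "M' k l = (\<Sum>i\<in>?J. \<Sum>j\<in>?J. H k i * M i j * cnj (H l j))" for k l
  have hM: "cnj (M i j) = M j i" if "i \<in> ?J" "j \<in> ?J" for i j
    using insert.prems that unfolding hermitian_on_def by metis
  have herm: "M' l k = cnj (M' k l)" for k l
  proof -
    have "cnj (M' k l) = (\<Sum>i\<in>?J. \<Sum>j\<in>?J. H l j * M j i * cnj (H k i))"
      unfolding M'_def cnj_sum by (intro sum.cong refl) (simp add: hM mult_ac)
    also have "\<dots> = M' l k" unfolding M'_def by (rule sum.swap)
    finally show ?thesis by simp
  qed
  \<comment> \<open>Row \<open>a\<close> of \<open>H\<close> is the conjugate of \<open>v\<close>,
    so the eigenvalue equation turns column \<open>a\<close> into e times the inner products of the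
    rows of \<open>H\<close> with row \<open>a\<close>.\<close>
  have col: "M' k a = (if k = a then e else 0)" if k: "k \<in> ?J" for k
  proof -
    have "M' k a = (\<Sum>i\<in>?J. H k i * (\<Sum>j\<in>?J. M i j * v j))"
      unfolding M'_def sum_distrib_left by (intro sum.cong refl) (simp add: H(2))
    also have "\<dots> = (\<Sum>i\<in>?J. H k i * (e * v i))"
      by (intro sum.cong refl) (simp only: ev)
    also have "\<dots> = e * (\<Sum>i\<in>?J. H k i * cnj (H a i))"
      unfolding sum_distrib_left by (intro sum.cong refl) (simp add: H(2))
    finally show ?thesis using unitary_on_rows[OF H(1) k aJ] by simp
  qed
  \<comment> \<open>The eigenvalue is a diagonal entry of the Hermitian \<open>M'\<close>, hence
    real.\<close>
  have e: "of_real (Re e) = e"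
  proof -
    have "e = cnj e" using herm[of a a] col[OF aJ] by simp
    then show ?thesis by (metis Re_complex_of_real complex_cnj_cancel_iff Reals_cnj_iff of_real_Re)
  qed
  have row: "M' a k = (if k = a then e else 0)" if k: "k \<in> ?J" for k
    using arg_cong[OF col[OF k], of cnj] herm[where k=k and l=a] col[OF aJ] by (cases "k = a") simp_all
  obtain p U where pU: "eigen_decomp I M' p U"
    using insert.IH[of M'] herm unfolding hermitian_on_def by blast
  have blk: "{i \<in> ?J. (i = a) = False} = I" "{i \<in> ?J. (i = a) = True} = {a}"
    using insert.hyps by auto
  have "eigen_decomp ?J M' (\<lambda>k. (if k = a then (\<lambda>_. Re e) else p) k)
     (\<lambda>k i. if (k = a) = (i = a) then (if k = a then (\<lambda>_ _. 1) else U) k i else 0)"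
  proof (rule eigen_decomp_blocks[OF fin, where p="\<lambda>c. if c then (\<lambda>_. Re e) else p" and U = "\<lambda>c. if c then (\<lambda>_ _. 1) else U"])
    fix c assume "c \<in> (\<lambda>i. i = a) ` ?J"
    show "eigen_decomp {i \<in> ?J. (i = a) = c} M' (if c then (\<lambda>_. Re e) else p) (if c then (\<lambda>_ _. 1) else U)"
    proof (cases c)
      case True
      then show ?thesis using col[OF aJ] e blk(2) by (simp add: eigen_decomp_def unitary_on_def)
    next
      case False
      then show ?thesis using pU blk by simp
    qed
  qed (use row col in auto)
  then show ?case
    using eigen_decomp_conj[OF fin H(1)] unfolding M'_def by blast
qed

section \<open>Entropy and eigenvalues\<close>

lemma proots_prod_linear:
  assumes "finite A"
  shows "proots (\<Prod>k\<in>A. [:- c k, 1:]) = image_mset c (mset_set A)"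
  using assms
proof (induction A rule: finite_induct)
  case (insert a A)
  have "(\<Prod>k\<in>A. [:- c k, 1:]) \<noteq> 0" using insert.hyps by simp
  then show ?case using insert by (simp add: proots_mult del: mult_pCons_left)
qed simp

text \<open>The enumerated matrix is similar to a diagonal one, which determines its characteristic
  polynomial. Hence every diagonalisation computes the entropy, whichever enumeration
  \<open>op_mat\<close> has chosen.\<close>

lemma vN_entropy_eigen:
  assumes fin: "finite I" and D: "eigen_decomp I M p U"
  shows "vN_entropy I M = (\<Sum>k\<in>I. ent (p k))"
proof -
  let ?n = "card I" let ?e = "enum_of I"
  define V where "V = mat ?n ?n (\<lambda>(i, k). U (?e k) (?e i))"
  define W where "W = mat ?n ?n (\<lambda>(k, i). cnj (U (?e k) (?e i)))"
  define E where "E = mat ?n ?n (\<lambda>(k, l). if k = l then complex_of_real (p (?e k)) else 0)"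
  have eI: "?e k \<in> I" if "k < ?n" for k
    using enum_of[OF fin] that by (auto simp: bij_betw_def)
  have inj: "?e k = ?e l \<longleftrightarrow> k = l" if "k < ?n" "l < ?n" for k l
    using enum_of[OF fin] that by (auto simp: bij_betw_def inj_on_def)
  have uni: "unitary_on I U" using D by (simp add: eigen_decomp_def)
  have VW: "V * W = 1\<^sub>m ?n"
  proof (rule eq_matI)
    fix i j assume ij: "i < dim_row (1\<^sub>m ?n :: complex mat)" "j < dim_col (1\<^sub>m ?n :: complex mat)"
    then have ij': "i < ?n" "j < ?n" by simp_all
    have "(V * W) $$ (i, j) = (\<Sum>k<?n. U (?e k) (?e i) * cnj (U (?e k) (?e j)))"
      using ij' by (simp add: V_def W_def scalar_prod_def atLeast0LessThan)
    also have "\<dots> = (\<Sum>k\<in>I. U k (?e i) * cnj (U k (?e j)))"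
      using sum_enum_of[OF fin, of "\<lambda>k. U k (?e i) * cnj (U k (?e j))"] .
    also have "\<dots> = (if i = j then 1 else 0)"
      using unitary_on_cols[OF unitary_on_cnj[OF uni], of "?e i" "?e j"] ij' by (simp add: eI inj)
    finally show "(V * W) $$ (i, j) = 1\<^sub>m ?n $$ (i, j)" using ij' by simp
  qed (simp_all add: V_def W_def)
  have WV: "W * V = 1\<^sub>m ?n"
  proof (rule eq_matI)
    fix i j assume ij: "i < dim_row (1\<^sub>m ?n :: complex mat)" "j < dim_col (1\<^sub>m ?n :: complex mat)"
    then have ij': "i < ?n" "j < ?n" by simp_all
    have "(W * V) $$ (i, j) = (\<Sum>k<?n. cnj (U (?e i) (?e k)) * U (?e j) (?e k))"
      using ij' by (simp add: V_def W_def scalar_prod_def atLeast0LessThan)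
    also have "\<dots> = (\<Sum>k\<in>I. cnj (U (?e i) k) * U (?e j) k)"
      using sum_enum_of[OF fin, of "\<lambda>k. cnj (U (?e i) k) * U (?e j) k"] .
    also have "\<dots> = (if i = j then 1 else 0)"
      using unitary_on_rows[OF unitary_on_cnj[OF uni], of "?e i" "?e j"] ij' by (simp add: eI inj)
    finally show "(W * V) $$ (i, j) = 1\<^sub>m ?n $$ (i, j)" using ij' by simp
  qed (simp_all add: V_def W_def)
  have VE: "V * E = mat ?n ?n (\<lambda>(i, k). of_real (p (?e k)) * U (?e k) (?e i))"
  proof (rule eq_matI)
    fix i j assume "i < dim_row (mat ?n ?n (\<lambda>(i, k). of_real (p (?e k)) * U (?e k) (?e i)))"
      "j < dim_col (mat ?n ?n (\<lambda>(i, k). of_real (p (?e k)) * U (?e k) (?e i)))"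
    then have ij': "i < ?n" "j < ?n" by simp_all
    have "(V * E) $$ (i, j) = (\<Sum>k<?n. U (?e k) (?e i) * (if k = j then complex_of_real (p (?e k)) else 0))"
      using ij' by (simp add: V_def E_def scalar_prod_def atLeast0LessThan)
    also have "\<dots> = of_real (p (?e j)) * U (?e j) (?e i)"
      using ij' by (simp add: if_distrib cong: if_cong)
    finally show "(V * E) $$ (i, j) = mat ?n ?n (\<lambda>(i, k). of_real (p (?e k)) * U (?e k) (?e i)) $$ (i, j)"
      using ij' by simp
  qed (simp_all add: V_def E_def)
  have A: "op_mat I M = V * E * W"
  proof (rule eq_matI)
    fix i j assume "i < dim_row (V * E * W)" "j < dim_col (V * E * W)"
    then have ij': "i < ?n" "j < ?n" by (simp_all add: V_def W_def)
    have "(V * E * W) $$ (i, j) = (\<Sum>k<?n. of_real (p (?e k)) * U (?e k) (?e i) * cnj (U (?e k) (?e j)))"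
      unfolding VE using ij' by (simp add: W_def scalar_prod_def atLeast0LessThan)
    also have "\<dots> = (\<Sum>k\<in>I. of_real (p k) * U k (?e i) * cnj (U k (?e j)))"
      using sum_enum_of[OF fin, of "\<lambda>k. of_real (p k) * U k (?e i) * cnj (U k (?e j))"] .
    also have "\<dots> = M (?e i) (?e j)" using D eI ij' by (simp add: eigen_decomp_def)
    finally show "op_mat I M $$ (i, j) = (V * E * W) $$ (i, j)" using ij' by (simp add: op_mat_enum)
  qed (simp_all add: op_mat_enum V_def W_def)
  have E: "E \<in> carrier_mat ?n ?n" by (simp add: E_def)
  have "similar_mat_wit (op_mat I M) E V W"
    unfolding similar_mat_wit_def Let_def using VW WV A op_mat_carrier[of I M] E
    by (auto simp: V_def W_def)
  then have "char_poly (op_mat I M) = char_poly E"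
    by (intro char_poly_similar) (auto simp: similar_mat_def)
  also have "\<dots> = (\<Prod>a\<leftarrow>diag_mat E. [:- a, 1:])"
    by (rule char_poly_upper_triangular[OF E]) (auto simp: E_def)
  also have "\<dots> = (\<Prod>k\<in>{..<?n}. [:- complex_of_real (p (?e k)), 1:])"
    by (simp add: diag_mat_def E_def prod.list_conv_set_nth atLeast0LessThan)
  finally have "proots (char_poly (op_mat I M)) =
      image_mset (\<lambda>k. complex_of_real (p (?e k))) (mset_set {..<?n})"
    by (simp only: proots_prod_linear[OF finite_lessThan])
  then have "vN_entropy I M = (\<Sum>k<?n. ent (p (?e k)))"
    by (simp add: vN_entropy_def ent_def image_mset.compositionality o_def sum_unfold_sum_mset)
  then show ?thesis using sum_enum_of[OF fin, of "\<lambda>k. ent (p k)"] by simp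
qed

lemma vN_entropy_cong:
  assumes "finite I" "\<And>i j. i \<in> I \<Longrightarrow> j \<in> I \<Longrightarrow> M i j = N i j"
  shows "vN_entropy I M = vN_entropy I N"
proof -
  have "enum_of I k \<in> I" if "k < card I" for k
    using enum_of[OF assms(1)] that by (auto simp: bij_betw_def)
  then have "op_mat I M = op_mat I N"
    using assms(2) by (intro eq_matI) (simp_all add: op_mat_enum)
  then show ?thesis by (simp add: vN_entropy_def)
qed

section \<open>The common nonzero spectrum of the two products of a pair of matrices\<close>

lemma const_poly_sum: "(\<Sum>k\<in>A. [:f k:]) = [:\<Sum>k\<in>A. f k:]"
  by (induction A rule: infinite_finite_induct) simp_all

text \<open>Both sides are the determinant of the block matrix \<open>(X I, A; B, I)\<close> times \<open>X^m\<close>.\<close>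

lemma char_poly_mult_commute:
  fixes A B :: "'a::idom mat"
  assumes A: "A \<in> carrier_mat n m" and B: "B \<in> carrier_mat m n"
  shows "[:0, 1:] ^ m * char_poly (A * B) = [:0, 1:] ^ n * char_poly (B * A)"
proof -
  let ?X = "[:0, 1:] :: 'a poly"
  let ?c = "\<lambda>a::'a. [:a:]"
  define a where "a = map_mat ?c A"
  define b where "b = map_mat ?c B"
  have a: "a \<in> carrier_mat n m" and b: "b \<in> carrier_mat m n" using A B by (auto simp: a_def b_def)
  have hom: "map_mat ?c (P * Q) = map_mat ?c P * map_mat ?c Q"
    if "P \<in> carrier_mat r s" "Q \<in> carrier_mat s r" for P Q r s
    using that by (intro eq_matI) (auto simp: scalar_prod_def const_poly_sum[symmetric] mult.commute)
  have neg: "map_mat (\<lambda>a. [:- a:]) P = - map_mat ?c P" for P :: "'a mat"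
    by (intro eq_matI) auto
  define P where "P = four_block_mat (?X \<cdot>\<^sub>m 1\<^sub>m n) a b (1\<^sub>m m)"
  \<comment> \<open>Right multiplication by \<open>Q1\<close> clears the lower left block of
    \<open>P\<close>, by \<open>Q2\<close> the upper right one; their determinants are 1 and
    X^m.\<close>
  define Q1 where "Q1 = four_block_mat (1\<^sub>m n) (0\<^sub>m n m) (- b) (1\<^sub>m m)"
  define Q2 where "Q2 = four_block_mat (1\<^sub>m n) (- a) (0\<^sub>m m n) (?X \<cdot>\<^sub>m 1\<^sub>m m)"
  have P: "P \<in> carrier_mat (n + m) (n + m)" and Q1: "Q1 \<in> carrier_mat (n + m) (n + m)"
    and Q2: "Q2 \<in> carrier_mat (n + m) (n + m)"
    using a b by (auto simp: P_def Q1_def Q2_def)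
  have AB: "char_poly_matrix (A * B) = ?X \<cdot>\<^sub>m 1\<^sub>m n - a * b"
    using A B a b unfolding char_poly_matrix_def neg hom[OF A B]
    by (intro eq_matI) (auto simp: a_def b_def)
  have BA: "char_poly_matrix (B * A) = ?X \<cdot>\<^sub>m 1\<^sub>m m - b * a"
    using A B a b unfolding char_poly_matrix_def neg hom[OF B A]
    by (intro eq_matI) (auto simp: a_def b_def)
  have PQ1: "P * Q1 = four_block_mat ((?X \<cdot>\<^sub>m 1\<^sub>m n) * 1\<^sub>m n + a * (- b)) ((?X \<cdot>\<^sub>m 1\<^sub>m n) * 0\<^sub>m n m + a * 1\<^sub>m m)
      (b * 1\<^sub>m n + 1\<^sub>m m * (- b)) (b * 0\<^sub>m n m + 1\<^sub>m m * 1\<^sub>m m)"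
    unfolding P_def Q1_def by (rule mult_four_block_mat) (use a b in auto)
  have "det (P * Q1) = det (four_block_mat (char_poly_matrix (A * B)) a (0\<^sub>m m n) (1\<^sub>m m))"
    unfolding PQ1 AB by (rule arg_cong[where f=det], rule cong_four_block_mat) (use a b in \<open>auto intro!: eq_matI\<close>)
  also have "\<dots> = char_poly (A * B) * det (1\<^sub>m m)"
    unfolding char_poly_def
    by (rule det_four_block_mat_lower_left_zero) (use a A B in \<open>auto simp: char_poly_matrix_def\<close>)
  finally have "det (P * Q1) = char_poly (A * B)" by simp
  moreover have "det Q1 = det (1\<^sub>m n) * det (1\<^sub>m m)"
    unfolding Q1_def by (rule det_four_block_mat_upper_right_zero) (use b in auto)
  ultimately have 1: "det P = char_poly (A * B)" using det_mult[OF P Q1] by simp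
  have PQ2: "P * Q2 = four_block_mat ((?X \<cdot>\<^sub>m 1\<^sub>m n) * 1\<^sub>m n + a * 0\<^sub>m m n) ((?X \<cdot>\<^sub>m 1\<^sub>m n) * (- a) + a * (?X \<cdot>\<^sub>m 1\<^sub>m m))
      (b * 1\<^sub>m n + 1\<^sub>m m * 0\<^sub>m m n) (b * (- a) + 1\<^sub>m m * (?X \<cdot>\<^sub>m 1\<^sub>m m))"
    unfolding P_def Q2_def by (rule mult_four_block_mat) (use a b in auto)
  have "det (P * Q2) = det (four_block_mat (?X \<cdot>\<^sub>m 1\<^sub>m n) (0\<^sub>m n m) b (char_poly_matrix (B * A)))"
    unfolding PQ2 BA by (rule arg_cong[where f=det], rule cong_four_block_mat) (use a b in \<open>auto intro!: eq_matI\<close>)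
  also have "\<dots> = det (?X \<cdot>\<^sub>m 1\<^sub>m n) * char_poly (B * A)"
    unfolding char_poly_def
    by (rule det_four_block_mat_upper_right_zero) (use b A B in \<open>auto simp: char_poly_matrix_def\<close>)
  finally have "det (P * Q2) = ?X ^ n * char_poly (B * A)" by (simp add: det_smult)
  moreover have "det Q2 = det (1\<^sub>m n) * det (?X \<cdot>\<^sub>m 1\<^sub>m m)"
    unfolding Q2_def by (rule det_four_block_mat_lower_left_zero) (use a in auto)
  ultimately show ?thesis using det_mult[OF P Q2] 1
    by (simp add: det_smult mult.commute del: mult_pCons_left mult_pCons_right)
qed

text \<open>The two reduced states of a bipartite pure state have the same nonzero spectrum, and the
  eigenvalue 0 contributes nothing. This is the only form in which purity of the global state is
  exploited.\<close>

lemma vN_entropy_gram_dual: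
  assumes I: "finite I" and J: "finite J"
  shows "vN_entropy I (\<lambda>i j. \<Sum>e\<in>J. K i e * cnj (K j e)) = vN_entropy J (\<lambda>e f. \<Sum>i\<in>I. K i e * cnj (K i f))"
proof -
  let ?h = "\<lambda>z. - Re z * log 2 (Re z)"
  let ?n = "card I" let ?m = "card J"
  define A where "A = mat ?n ?m (\<lambda>(i, e). K (enum_of I i) (enum_of J e))"
  define B where "B = mat ?m ?n (\<lambda>(e, i). cnj (K (enum_of I i) (enum_of J e)))"
  have A: "A \<in> carrier_mat ?n ?m" and B: "B \<in> carrier_mat ?m ?n" by (auto simp: A_def B_def)
  have AB: "op_mat I (\<lambda>i j. \<Sum>e\<in>J. K i e * cnj (K j e)) = A * B"
    by (intro eq_matI)
      (simp_all add: op_mat_enum A_def B_def scalar_prod_def atLeast0LessThan sum_enum_of[OF J, symmetric])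
  \<comment> \<open>The index order of the second Gram operator is that of the transpose, which
    leaves the characteristic polynomial unchanged.\<close>
  have BA: "op_mat J (\<lambda>e f. \<Sum>i\<in>I. K i e * cnj (K i f)) = transpose_mat (B * A)"
    by (intro eq_matI)
      (simp_all add: op_mat_enum A_def B_def scalar_prod_def atLeast0LessThan sum_enum_of[OF I, symmetric] mult.commute)
  \<comment> \<open>A factor X adds only the root 0, and \<open>?h\<close> vanishes there.\<close>
  have monom: "sum_mset (image_mset ?h (proots ([:0, 1:] ^ k * p))) = sum_mset (image_mset ?h (proots p))"
    if "p \<noteq> 0" for k and p :: "complex poly"
  proof (induction k)
    case (Suc k)
    have "[:0, 1:] ^ k * p \<noteq> 0" using that by simp
    moreover have "proots [:0, 1 :: complex:] = {#0#}" using proots_linear_factor[of "0::complex"] by simp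
    ultimately show ?case using Suc by (simp add: proots_mult mult.assoc del: mult_pCons_left)
  qed simp
  have nz: "char_poly (A * B) \<noteq> 0" "char_poly (B * A) \<noteq> 0"
    using degree_monic_char_poly[of "A * B" ?n] degree_monic_char_poly[of "B * A" ?m] A B by auto
  have "vN_entropy I (\<lambda>i j. \<Sum>e\<in>J. K i e * cnj (K j e)) =
      sum_mset (image_mset ?h (proots ([:0, 1:] ^ ?m * char_poly (A * B))))"
    using monom[OF nz(1)] by (simp add: vN_entropy_def AB)
  also have "\<dots> = sum_mset (image_mset ?h (proots (char_poly (B * A))))"
    unfolding char_poly_mult_commute[OF A B] by (rule monom[OF nz(2)])
  also have "\<dots> = vN_entropy J (\<lambda>e f. \<Sum>i\<in>I. K i e * cnj (K i f))"
    using A B by (simp add: vN_entropy_def BA char_poly_transpose_mat[of _ ?m])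
  finally show ?thesis .
qed

lemma hermitian_on_subset: "hermitian_on I M \<Longrightarrow> J \<subseteq> I \<Longrightarrow> hermitian_on J M"
  by (auto simp: hermitian_on_def)

lemma unitary_on_id:
  assumes "finite I" shows "unitary_on I (\<lambda>k i. if k = i then 1 else 0)"
proof -
  have "(\<Sum>i\<in>I. (if k = i then 1 else 0) * cnj (if l = i then 1 else 0)) = (if k = l then 1 else 0)" if "k \<in> I" for k l
    using sum_delta_mult(2)[OF assms that, of "\<lambda>i. cnj (if l = i then 1 else 0)"] by auto
  moreover have "(\<Sum>k\<in>I. cnj (if k = i then 1 else 0) * (if k = j then 1 else 0)) = (if i = j then 1 else 0)" if "j \<in> I" for i j
    using sum_delta_mult(3)[OF assms that, of "\<lambda>k. cnj (if k = i then 1 else 0)"] by auto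
  ultimately show ?thesis by (simp add: unitary_on_def)
qed

lemma vN_entropy_zero: "finite I \<Longrightarrow> vN_entropy I (\<lambda>_ _. 0) = 0"
  using vN_entropy_eigen[of I "\<lambda>_ _. 0" "\<lambda>_. 0"] unitary_on_id[of I]
  by (auto simp: eigen_decomp_def ent_def)

section \<open>Joint convexity of the relative entropy\<close>

definition overlap :: "'i set \<Rightarrow> ('i \<Rightarrow> 'i \<Rightarrow> complex) \<Rightarrow> ('i \<Rightarrow> 'i \<Rightarrow> complex) \<Rightarrow> 'i \<Rightarrow> 'i \<Rightarrow> complex" where
  "overlap I U V j k = (\<Sum>i\<in>I. cnj (U j i) * V k i)"

text \<open>For \<open>t > 0\<close>, \<open>\<Sum>\<^sub>j\<^sub>k |\<langle>u\<^sub>j|v\<^sub>k\<rangle>|\<^sup>2 (p\<^sub>j - q\<^sub>k)\<^sup>2 / (q\<^sub>k + t p\<^sub>j)\<close>, where \<open>p, u\<close> and \<open>q, v\<close> diagonalise \<open>\<rho>\<close> and \<open>\<sigma>\<close>,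
  is the maximum over \<open>X\<close> of \<open>2 Re Tr X\<^sup>*(\<rho> - \<sigma>) - Tr X \<sigma> X\<^sup>* - t Tr X\<^sup>* \<rho> X\<close>.  The latter is linear
  in \<open>(\<rho>, \<sigma>)\<close>, so the maximum is jointly subadditive.\<close>

definition variational :: "'i set \<Rightarrow> real \<Rightarrow> ('i \<Rightarrow> 'i \<Rightarrow> complex) \<Rightarrow> ('i \<Rightarrow> 'i \<Rightarrow> complex) \<Rightarrow> ('i \<Rightarrow> 'i \<Rightarrow> complex) \<Rightarrow> complex" where
  "variational I t \<rho> \<sigma> X =
     (\<Sum>a\<in>I. \<Sum>b\<in>I. (\<rho> a b - \<sigma> a b) * cnj (X a b))
     + cnj (\<Sum>a\<in>I. \<Sum>b\<in>I. (\<rho> a b - \<sigma> a b) * cnj (X a b))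
     - (\<Sum>a\<in>I. \<Sum>b\<in>I. \<Sum>c\<in>I. \<sigma> b c * X a b * cnj (X a c))
     - of_real t * (\<Sum>a\<in>I. \<Sum>b\<in>I. \<Sum>c\<in>I. \<rho> b c * X c a * cnj (X b a))"

lemma variational_sum:
  assumes "finite N"
  shows "variational I t (\<lambda>a b. \<Sum>n\<in>N. \<rho> n a b) (\<lambda>a b. \<Sum>n\<in>N. \<sigma> n a b) X = (\<Sum>n\<in>N. variational I t (\<rho> n) (\<sigma> n) X)"
  using assms
proof (induction N rule: finite_induct)
  case empty
  show ?case by (simp add: variational_def)
next
  case (insert n N)
  have "variational I t (\<lambda>a b. \<rho> n a b + R a b) (\<lambda>a b. \<sigma> n a b + S a b) X
      = variational I t (\<rho> n) (\<sigma> n) X + variational I t R S X" for R S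
    unfolding variational_def add_diff_add distrib_left distrib_right sum.distrib complex_cnj_add by simp
  then show ?case using insert by simp
qed

lemma parseval:
  assumes fin: "finite I" and U: "unitary_on I U"
  shows "(\<Sum>j\<in>I. (\<Sum>i\<in>I. cnj (U j i) * y i) * cnj (\<Sum>i\<in>I. cnj (U j i) * z i)) = (\<Sum>i\<in>I. y i * cnj (z i))"
proof -
  have "(\<Sum>j\<in>I. (\<Sum>i\<in>I. cnj (U j i) * y i) * cnj (\<Sum>i\<in>I. cnj (U j i) * z i)) =
      (\<Sum>j\<in>I. \<Sum>i\<in>I. \<Sum>l\<in>I. y i * cnj (z l) * (cnj (U j i) * U j l))"
    unfolding cnj_sum sum_product by (intro sum.cong refl) simp
  also have "\<dots> = (\<Sum>i\<in>I. \<Sum>l\<in>I. \<Sum>j\<in>I. y i * cnj (z l) * (cnj (U j i) * U j l))"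
    by (subst sum.swap, rule sum.cong[OF refl], rule sum.swap)
  also have "\<dots> = (\<Sum>i\<in>I. \<Sum>l\<in>I. y i * cnj (z l) * (if i = l then 1 else 0))"
    by (intro sum.cong refl) (simp add: sum_distrib_left[symmetric] unitary_on_cols[OF U])
  also have "\<dots> = (\<Sum>i\<in>I. y i * cnj (z i))"
    by (intro sum.cong refl) (rule sum_delta_mult(4)[OF fin])
  finally show ?thesis .
qed

text \<open>The matrix element of \<open>X\<close> between the eigenvectors u_j and v_k; in these
  coordinates both quadratic terms of \<open>variational\<close> are diagonal.\<close>

definition coord :: "'i set \<Rightarrow> ('i \<Rightarrow> 'i \<Rightarrow> complex) \<Rightarrow> ('i \<Rightarrow> 'i \<Rightarrow> complex) \<Rightarrow> ('i \<Rightarrow> 'i \<Rightarrow> complex) \<Rightarrow> 'i \<Rightarrow> 'i \<Rightarrow> complex" where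
  "coord I U V X j k = (\<Sum>a\<in>I. cnj (U j a) * (\<Sum>b\<in>I. X a b * V k b))"

lemma coord_alt: "coord I U V X j k = (\<Sum>b\<in>I. V k b * (\<Sum>a\<in>I. cnj (U j a) * X a b))"
  unfolding coord_def sum_distrib_left by (subst sum.swap, intro sum.cong refl) simp

lemma variational_term:
  "z + cnj z - of_real q * (x * cnj x) - of_real t * (of_real p * (x * cnj x)) =
     of_real (2 * Re z - (q + t * p) * (cmod x)\<^sup>2)"
  unfolding complex_add_cnj complex_norm_square[symmetric] by (simp add: algebra_simps)

text \<open>Each operator is expanded in its own eigenbasis and the other index is completed by
  Parseval. The functional decouples into one scalar quadratic 2 Re (z cnj x) - m |x|^2 per pair (j,
  k), with m = q_k + t p_j.\<close>

lemma variational_eigen: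
  assumes fin: "finite I" and R: "eigen_decomp I \<rho> p U" and S: "eigen_decomp I \<sigma> q V"
  shows "variational I t \<rho> \<sigma> X = of_real (\<Sum>j\<in>I. \<Sum>k\<in>I.
     2 * Re ((of_real (p j) - of_real (q k)) * overlap I U V j k * cnj (coord I U V X j k))
     - (q k + t * p j) * (cmod (coord I U V X j k))\<^sup>2)"
proof -
  have U: "unitary_on I U" and V: "unitary_on I V"
    and \<rho>: "\<And>a b. a \<in> I \<Longrightarrow> b \<in> I \<Longrightarrow> \<rho> a b = (\<Sum>j\<in>I. of_real (p j) * U j a * cnj (U j b))"
    and \<sigma>: "\<And>a b. a \<in> I \<Longrightarrow> b \<in> I \<Longrightarrow> \<sigma> a b = (\<Sum>k\<in>I. of_real (q k) * V k a * cnj (V k b))"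
    using R S by (auto simp: eigen_decomp_def)
  let ?x = "coord I U V X" and ?o = "overlap I U V"
  have lin\<rho>: "(\<Sum>a\<in>I. \<Sum>b\<in>I. \<rho> a b * cnj (X a b)) = (\<Sum>j\<in>I. \<Sum>k\<in>I. of_real (p j) * ?o j k * cnj (?x j k))"
  proof -
    have inner: "(\<Sum>k\<in>I. ?o j k * cnj (?x j k)) = (\<Sum>b\<in>I. cnj (U j b) * cnj (\<Sum>a\<in>I. cnj (U j a) * X a b))" for j
      using parseval[OF fin unitary_on_cnj[OF V], of "\<lambda>b. cnj (U j b)" "\<lambda>b. \<Sum>a\<in>I. cnj (U j a) * X a b"]
      unfolding coord_alt overlap_def by (simp add: mult.commute)
    have "(\<Sum>a\<in>I. \<Sum>b\<in>I. \<rho> a b * cnj (X a b)) =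
        (\<Sum>a\<in>I. \<Sum>b\<in>I. \<Sum>j\<in>I. of_real (p j) * cnj (U j b) * (U j a * cnj (X a b)))"
      by (intro sum.cong refl) (subst \<rho>, assumption+, unfold sum_distrib_right, intro sum.cong refl, simp)
    also have "\<dots> = (\<Sum>j\<in>I. \<Sum>a\<in>I. \<Sum>b\<in>I. of_real (p j) * cnj (U j b) * (U j a * cnj (X a b)))"
      by (rule trans[OF sum.cong[OF refl sum.swap] sum.swap])
    also have "\<dots> = (\<Sum>j\<in>I. \<Sum>b\<in>I. \<Sum>a\<in>I. of_real (p j) * cnj (U j b) * (U j a * cnj (X a b)))"
      by (rule sum.cong[OF refl sum.swap])
    also have "\<dots> = (\<Sum>j\<in>I. of_real (p j) * (\<Sum>k\<in>I. ?o j k * cnj (?x j k)))"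
      unfolding inner by (simp add: sum_distrib_left mult.assoc cnj_sum)
    finally show ?thesis by (simp add: sum_distrib_left mult.assoc)
  qed
  have lin\<sigma>: "(\<Sum>a\<in>I. \<Sum>b\<in>I. \<sigma> a b * cnj (X a b)) = (\<Sum>j\<in>I. \<Sum>k\<in>I. of_real (q k) * ?o j k * cnj (?x j k))"
  proof -
    have inner: "(\<Sum>j\<in>I. ?o j k * cnj (?x j k)) = (\<Sum>a\<in>I. V k a * cnj (\<Sum>b\<in>I. X a b * V k b))" for k
      using parseval[OF fin U, of "V k" "\<lambda>a. \<Sum>b\<in>I. X a b * V k b"]
      unfolding coord_def overlap_def .
    have "(\<Sum>a\<in>I. \<Sum>b\<in>I. \<sigma> a b * cnj (X a b)) =
        (\<Sum>a\<in>I. \<Sum>b\<in>I. \<Sum>k\<in>I. of_real (q k) * V k a * (cnj (V k b) * cnj (X a b)))"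
      by (intro sum.cong refl) (subst \<sigma>, assumption+, unfold sum_distrib_right, intro sum.cong refl, simp)
    also have "\<dots> = (\<Sum>k\<in>I. \<Sum>a\<in>I. \<Sum>b\<in>I. of_real (q k) * V k a * (cnj (V k b) * cnj (X a b)))"
      by (rule trans[OF sum.cong[OF refl sum.swap] sum.swap])
    also have "\<dots> = (\<Sum>k\<in>I. of_real (q k) * (\<Sum>j\<in>I. ?o j k * cnj (?x j k)))"
      unfolding inner by (simp add: sum_distrib_left mult_ac cnj_sum)
    also have "\<dots> = (\<Sum>k\<in>I. \<Sum>j\<in>I. of_real (q k) * ?o j k * cnj (?x j k))"
      by (simp add: sum_distrib_left mult.assoc)
    also have "\<dots> = (\<Sum>j\<in>I. \<Sum>k\<in>I. of_real (q k) * ?o j k * cnj (?x j k))" by (rule sum.swap)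
    finally show ?thesis .
  qed
  have lin: "(\<Sum>a\<in>I. \<Sum>b\<in>I. (\<rho> a b - \<sigma> a b) * cnj (X a b)) =
      (\<Sum>j\<in>I. \<Sum>k\<in>I. (of_real (p j) - of_real (q k)) * ?o j k * cnj (?x j k))"
    using lin\<rho> lin\<sigma> by (simp add: sum_subtractf left_diff_distrib)
  have quad\<sigma>: "(\<Sum>a\<in>I. \<Sum>b\<in>I. \<Sum>c\<in>I. \<sigma> b c * X a b * cnj (X a c)) = (\<Sum>j\<in>I. \<Sum>k\<in>I. of_real (q k) * (?x j k * cnj (?x j k)))"
  proof -
    have inner: "(\<Sum>j\<in>I. ?x j k * cnj (?x j k)) = (\<Sum>a\<in>I. (\<Sum>b\<in>I. X a b * V k b) * cnj (\<Sum>b\<in>I. X a b * V k b))" for k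
      using parseval[OF fin U, of "\<lambda>a. \<Sum>b\<in>I. X a b * V k b" "\<lambda>a. \<Sum>b\<in>I. X a b * V k b"]
      unfolding coord_def .
    have "(\<Sum>a\<in>I. \<Sum>b\<in>I. \<Sum>c\<in>I. \<sigma> b c * X a b * cnj (X a c)) =
        (\<Sum>a\<in>I. \<Sum>b\<in>I. \<Sum>c\<in>I. \<Sum>k\<in>I. of_real (q k) * ((X a b * V k b) * cnj (X a c * V k c)))"
      by (intro sum.cong refl) (subst \<sigma>, assumption+, unfold sum_distrib_right, intro sum.cong refl, simp)
    also have "\<dots> = (\<Sum>k\<in>I. \<Sum>a\<in>I. \<Sum>b\<in>I. \<Sum>c\<in>I. of_real (q k) * ((X a b * V k b) * cnj (X a c * V k c)))"
      by (rule trans[OF sum.cong[OF refl trans[OF sum.cong[OF refl sum.swap] sum.swap]] sum.swap])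
    also have "\<dots> = (\<Sum>k\<in>I. of_real (q k) * (\<Sum>j\<in>I. ?x j k * cnj (?x j k)))"
      unfolding inner cnj_sum sum_product unfolding sum_distrib_left by (rule refl)
    also have "\<dots> = (\<Sum>j\<in>I. \<Sum>k\<in>I. of_real (q k) * (?x j k * cnj (?x j k)))"
      unfolding sum_distrib_left by (rule sum.swap)
    finally show ?thesis .
  qed
  have quad\<rho>: "(\<Sum>a\<in>I. \<Sum>b\<in>I. \<Sum>c\<in>I. \<rho> b c * X c a * cnj (X b a)) = (\<Sum>j\<in>I. \<Sum>k\<in>I. of_real (p j) * (?x j k * cnj (?x j k)))"
  proof -
    have inner: "(\<Sum>k\<in>I. ?x j k * cnj (?x j k)) = (\<Sum>b\<in>I. (\<Sum>a\<in>I. cnj (U j a) * X a b) * cnj (\<Sum>a\<in>I. cnj (U j a) * X a b))" for j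
      using parseval[OF fin unitary_on_cnj[OF V], of "\<lambda>b. \<Sum>a\<in>I. cnj (U j a) * X a b" "\<lambda>b. \<Sum>a\<in>I. cnj (U j a) * X a b"]
      unfolding coord_alt complex_cnj_cnj .
    have "(\<Sum>a\<in>I. \<Sum>b\<in>I. \<Sum>c\<in>I. \<rho> b c * X c a * cnj (X b a)) =
        (\<Sum>a\<in>I. \<Sum>b\<in>I. \<Sum>c\<in>I. \<Sum>j\<in>I. of_real (p j) * ((cnj (U j c) * X c a) * cnj (cnj (U j b) * X b a)))"
      by (intro sum.cong refl) (subst \<rho>, assumption+, unfold sum_distrib_right, intro sum.cong refl, simp)
    also have "\<dots> = (\<Sum>j\<in>I. \<Sum>a\<in>I. \<Sum>b\<in>I. \<Sum>c\<in>I. of_real (p j) * ((cnj (U j c) * X c a) * cnj (cnj (U j b) * X b a)))"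
      by (rule trans[OF sum.cong[OF refl trans[OF sum.cong[OF refl sum.swap] sum.swap]] sum.swap])
    also have "\<dots> = (\<Sum>j\<in>I. \<Sum>a\<in>I. \<Sum>c\<in>I. \<Sum>b\<in>I. of_real (p j) * ((cnj (U j c) * X c a) * cnj (cnj (U j b) * X b a)))"
      by (rule sum.cong[OF refl], rule sum.cong[OF refl], rule sum.swap)
    also have "\<dots> = (\<Sum>j\<in>I. of_real (p j) * (\<Sum>k\<in>I. ?x j k * cnj (?x j k)))"
      unfolding inner cnj_sum sum_product unfolding sum_distrib_left by (rule refl)
    finally show ?thesis unfolding sum_distrib_left .
  qed
  have "variational I t \<rho> \<sigma> X = (\<Sum>j\<in>I. \<Sum>k\<in>I.
      (of_real (p j) - of_real (q k)) * ?o j k * cnj (?x j k)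
      + cnj ((of_real (p j) - of_real (q k)) * ?o j k * cnj (?x j k))
      - of_real (q k) * (?x j k * cnj (?x j k)) - of_real t * (of_real (p j) * (?x j k * cnj (?x j k))))"
    unfolding variational_def lin quad\<sigma> quad\<rho> cnj_sum sum_distrib_left sum.distrib sum_subtractf by (rule refl)
  also have "\<dots> = (\<Sum>j\<in>I. \<Sum>k\<in>I. of_real (
      2 * Re ((of_real (p j) - of_real (q k)) * ?o j k * cnj (?x j k)) - (q k + t * p j) * (cmod (?x j k))\<^sup>2))"
    by (intro sum.cong refl variational_term)
  finally show ?thesis by (simp only: of_real_sum)
qed

text \<open>Division by zero yields 0. For t > 0 and nonnegative eigenvalues a denominator vanishes
  only if p_j = q_k = 0, and then the scalar quadratic is zero too, so the default value is the
  right one.\<close>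

definition rat_div :: "'i set \<Rightarrow> real \<Rightarrow> ('i \<Rightarrow> real) \<Rightarrow> ('i \<Rightarrow> 'i \<Rightarrow> complex) \<Rightarrow> ('i \<Rightarrow> real) \<Rightarrow> ('i \<Rightarrow> 'i \<Rightarrow> complex) \<Rightarrow> real" where
  "rat_div I t p U q V = (\<Sum>j\<in>I. \<Sum>k\<in>I. (cmod (overlap I U V j k))\<^sup>2 * ((p j - q k)\<^sup>2 / (q k + t * p j)))"

lemma complete_square_le:
  fixes z x :: complex and m :: real
  assumes "m > 0"
  shows "2 * Re (z * cnj x) - m * (cmod x)\<^sup>2 \<le> (cmod z)\<^sup>2 / m"
proof -
  have "Re (z * cnj x) \<le> cmod z * cmod x"
    using complex_Re_le_cmod[of "z * cnj x"] by (simp add: norm_mult)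
  moreover have "2 * (cmod z * cmod x) \<le> (cmod z)\<^sup>2 / m + m * (cmod x)\<^sup>2"
  proof -
    have "0 \<le> (cmod z - m * cmod x)\<^sup>2 / m" using assms by simp
    also have "\<dots> = (cmod z)\<^sup>2 / m + m * (cmod x)\<^sup>2 - 2 * (cmod z * cmod x)"
      using assms by (simp add: field_simps power2_eq_square)
    finally show ?thesis by simp
  qed
  ultimately show ?thesis by simp
qed

lemma variational_le:
  assumes fin: "finite I" and R: "eigen_decomp I \<rho> p U" and S: "eigen_decomp I \<sigma> q V"
    and p: "\<And>j. j \<in> I \<Longrightarrow> p j \<ge> 0" and q: "\<And>k. k \<in> I \<Longrightarrow> q k \<ge> 0" and t: "t > 0"
  shows "Re (variational I t \<rho> \<sigma> X) \<le> rat_div I t p U q V"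
  unfolding variational_eigen[OF fin R S] rat_div_def Re_complex_of_real
proof (intro sum_mono)
  fix j k assume jk: "j \<in> I" "k \<in> I"
  let ?x = "coord I U V X j k" and ?o = "overlap I U V j k"
  show "2 * Re ((of_real (p j) - of_real (q k)) * ?o * cnj ?x) - (q k + t * p j) * (cmod ?x)\<^sup>2
      \<le> (cmod ?o)\<^sup>2 * ((p j - q k)\<^sup>2 / (q k + t * p j))"
  proof (cases "q k + t * p j > 0")
    case True
    have "cmod ((of_real (p j) - of_real (q k)) * ?o) = \<bar>p j - q k\<bar> * cmod ?o"
      by (simp only: norm_mult of_real_diff[symmetric] norm_of_real)
    then show ?thesis
      using complete_square_le[OF True, of "(of_real (p j) - of_real (q k)) * ?o" ?x]
      by (simp add: power_mult_distrib mult.commute)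
  next
    case False
    moreover have "t * p j \<ge> 0" using p[OF jk(1)] t by simp
    ultimately have "t * p j = 0" "q k = 0" using q[OF jk(2)] by linarith+
    then have "p j = 0" "q k = 0" using t by simp_all
    then show ?thesis by simp
  qed
qed

text \<open>The coordinates of \<open>X\<close> can be prescribed freely, so the scalar quadratics
  can be maximised independently of each other.\<close>

lemma coord_basis:
  assumes fin: "finite I" and U: "unitary_on I U" and V: "unitary_on I V" and j: "j \<in> I" and k: "k \<in> I"
  shows "coord I U V (\<lambda>a b. \<Sum>j\<in>I. \<Sum>k\<in>I. \<xi> j k * U j a * cnj (V k b)) j k = \<xi> j k"
proof -
  have "(\<Sum>b\<in>I. (\<Sum>j\<in>I. \<Sum>l\<in>I. \<xi> j l * U j a * cnj (V l b)) * V k b) = (\<Sum>j\<in>I. \<xi> j k * U j a)" for a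
  proof -
    have "(\<Sum>b\<in>I. (\<Sum>j\<in>I. \<Sum>l\<in>I. \<xi> j l * U j a * cnj (V l b)) * V k b) =
        (\<Sum>b\<in>I. \<Sum>j\<in>I. \<Sum>l\<in>I. \<xi> j l * U j a * (V k b * cnj (V l b)))"
      unfolding sum_distrib_right by (intro sum.cong refl) simp
    also have "\<dots> = (\<Sum>j\<in>I. \<Sum>l\<in>I. \<Sum>b\<in>I. \<xi> j l * U j a * (V k b * cnj (V l b)))"
      by (rule trans[OF sum.swap sum.cong[OF refl sum.swap]])
    also have "\<dots> = (\<Sum>j\<in>I. \<Sum>l\<in>I. \<xi> j l * U j a * (if k = l then 1 else 0))"
      by (intro sum.cong refl) (simp add: sum_distrib_left[symmetric] unitary_on_rows[OF V k])
    also have "\<dots> = (\<Sum>j\<in>I. \<xi> j k * U j a)"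
      by (intro sum.cong refl) (rule sum_delta_mult(4)[OF fin k])
    finally show ?thesis .
  qed
  then have "coord I U V (\<lambda>a b. \<Sum>j\<in>I. \<Sum>k\<in>I. \<xi> j k * U j a * cnj (V k b)) j k =
      (\<Sum>a\<in>I. \<Sum>l\<in>I. \<xi> l k * (U l a * cnj (U j a)))"
    unfolding coord_def by (simp add: sum_distrib_left mult_ac)
  also have "\<dots> = (\<Sum>l\<in>I. \<Sum>a\<in>I. \<xi> l k * (U l a * cnj (U j a)))" by (rule sum.swap)
  also have "\<dots> = (\<Sum>l\<in>I. \<xi> l k * (if l = j then 1 else 0))"
    using j by (intro sum.cong refl) (simp add: sum_distrib_left[symmetric] unitary_on_rows[OF U])
  also have "\<dots> = \<xi> j k" by (rule sum_delta_mult(3)[OF fin j])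
  finally show ?thesis .
qed

lemma variational_attained:
  assumes fin: "finite I" and R: "eigen_decomp I \<rho> p U" and S: "eigen_decomp I \<sigma> q V"
  shows "\<exists>X. Re (variational I t \<rho> \<sigma> X) = rat_div I t p U q V"
proof -
  have U: "unitary_on I U" and V: "unitary_on I V" using R S by (auto simp: eigen_decomp_def)
  \<comment> \<open>The maximiser of 2 Re (z cnj x) - m |x|^2 is x = z / m, taken for every pair (j,
    k).\<close>
  define \<xi> where "\<xi> j k = of_real ((p j - q k) / (q k + t * p j)) * overlap I U V j k" for j k
  let ?X = "\<lambda>a b. \<Sum>j\<in>I. \<Sum>k\<in>I. \<xi> j k * U j a * cnj (V k b)"
  have "Re (variational I t \<rho> \<sigma> ?X) = rat_div I t p U q V"
    unfolding variational_eigen[OF fin R S] rat_div_def Re_complex_of_real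
  proof (intro sum.cong refl)
    fix j k assume jk: "j \<in> I" "k \<in> I"
    let ?o = "overlap I U V j k" let ?m = "q k + t * p j"
    have "(of_real (p j) - of_real (q k)) * ?o * cnj (\<xi> j k) = of_real ((p j - q k)\<^sup>2 / ?m) * (?o * cnj ?o)"
      by (simp add: \<xi>_def power2_eq_square)
    also have "\<dots> = of_real ((p j - q k)\<^sup>2 / ?m * (cmod ?o)\<^sup>2)"
      by (simp only: complex_norm_square[symmetric] of_real_mult)
    finally have 1: "Re ((of_real (p j) - of_real (q k)) * ?o * cnj (\<xi> j k)) = (p j - q k)\<^sup>2 / ?m * (cmod ?o)\<^sup>2"
      by simp
    have "cmod (\<xi> j k) = \<bar>(p j - q k) / ?m\<bar> * cmod ?o"
      unfolding \<xi>_def norm_mult norm_of_real ..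
    then have 2: "?m * (cmod (\<xi> j k))\<^sup>2 = (p j - q k)\<^sup>2 / ?m * (cmod ?o)\<^sup>2"
      by (simp add: power_mult_distrib power_divide power2_eq_square)
    show "2 * Re ((of_real (p j) - of_real (q k)) * ?o * cnj (coord I U V ?X j k)) - ?m * (cmod (coord I U V ?X j k))\<^sup>2
        = (cmod ?o)\<^sup>2 * ((p j - q k)\<^sup>2 / ?m)"
      unfolding coord_basis[OF fin U V jk] 1 2 by simp
  qed
  then show ?thesis by (rule exI[of _ ?X])
qed

text \<open>The optimal \<open>X\<close> for the summed operators is a competitor for each single
  pair, and the functional is additive in the pair for fixed \<open>X\<close>.\<close>

lemma rat_div_subadditive:
  assumes fin: "finite I" and N: "finite N" and t: "t > 0"
    and R: "\<And>n. n \<in> N \<Longrightarrow> eigen_decomp I (\<rho> n) (p n) (U n)" and S: "\<And>n. n \<in> N \<Longrightarrow> eigen_decomp I (\<sigma> n) (q n) (V n)"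
    and p: "\<And>n j. n \<in> N \<Longrightarrow> j \<in> I \<Longrightarrow> p n j \<ge> 0" and q: "\<And>n k. n \<in> N \<Longrightarrow> k \<in> I \<Longrightarrow> q n k \<ge> 0"
    and R0: "eigen_decomp I (\<lambda>a b. \<Sum>n\<in>N. \<rho> n a b) p0 U0" and S0: "eigen_decomp I (\<lambda>a b. \<Sum>n\<in>N. \<sigma> n a b) q0 V0"
  shows "rat_div I t p0 U0 q0 V0 \<le> (\<Sum>n\<in>N. rat_div I t (p n) (U n) (q n) (V n))"
proof -
  obtain X where "Re (variational I t (\<lambda>a b. \<Sum>n\<in>N. \<rho> n a b) (\<lambda>a b. \<Sum>n\<in>N. \<sigma> n a b) X) = rat_div I t p0 U0 q0 V0"
    using variational_attained[OF fin R0 S0] by blast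
  then have "rat_div I t p0 U0 q0 V0 = (\<Sum>n\<in>N. Re (variational I t (\<rho> n) (\<sigma> n) X))"
    by (simp add: variational_sum[OF N])
  also have "\<dots> \<le> (\<Sum>n\<in>N. rat_div I t (p n) (U n) (q n) (V n))"
    by (intro sum_mono variational_le[OF fin R S p q t])
  finally show ?thesis .
qed

text \<open>Parseval for u_j in the basis v. Together with the column version, the squared overlaps
  form a doubly stochastic matrix.\<close>

lemma overlap_row_sum:
  assumes fin: "finite I" and U: "unitary_on I U" and V: "unitary_on I V" and j: "j \<in> I"
  shows "(\<Sum>k\<in>I. (cmod (overlap I U V j k))\<^sup>2) = 1"
proof -
  have "of_real (\<Sum>k\<in>I. (cmod (overlap I U V j k))\<^sup>2) = (\<Sum>k\<in>I. overlap I U V j k * cnj (overlap I U V j k))"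
    by (simp only: of_real_sum complex_norm_square)
  also have "\<dots> = (\<Sum>i\<in>I. cnj (U j i) * cnj (cnj (U j i)))"
    using parseval[OF fin unitary_on_cnj[OF V], of "\<lambda>i. cnj (U j i)" "\<lambda>i. cnj (U j i)"]
    by (simp add: overlap_def mult.commute)
  also have "\<dots> = 1" using unitary_on_rows[OF unitary_on_cnj[OF U] j j] by simp
  finally show ?thesis by (simp only: of_real_eq_1_iff)
qed

lemma overlap_col_sum:
  assumes fin: "finite I" and U: "unitary_on I U" and V: "unitary_on I V" and k: "k \<in> I"
  shows "(\<Sum>j\<in>I. (cmod (overlap I U V j k))\<^sup>2) = 1"
proof -
  have "overlap I U V j k = cnj (overlap I V U k j)" for j
    by (simp add: overlap_def mult.commute)
  then show ?thesis using overlap_row_sum[OF fin V U k] by simp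
qed

text \<open>This expresses the expectation of \<open>M\<close> in a foreign basis vector as an
  average of eigenvalues. It yields positivity of eigenvalues (for V = U) and the spectrum of a
  pinched operator.\<close>

lemma eigen_decomp_diag:
  assumes fin: "finite I" and D: "eigen_decomp I M p U" and V: "unitary_on I V" and k: "k \<in> I"
  shows "(\<Sum>a\<in>I. \<Sum>b\<in>I. cnj (V k a) * M a b * V k b) = of_real (\<Sum>j\<in>I. (cmod (overlap I U V j k))\<^sup>2 * p j)"
proof -
  have "(\<Sum>a\<in>I. \<Sum>b\<in>I. cnj (V k a) * M a b * V k b) =
      (\<Sum>a\<in>I. \<Sum>b\<in>I. cnj (V k a) * (\<Sum>j\<in>I. of_real (p j) * U j a * cnj (U j b)) * V k b)"
    using D by (intro sum.cong refl) (simp add: eigen_decomp_def)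
  also have "\<dots> = (\<Sum>a\<in>I. \<Sum>b\<in>I. \<Sum>j\<in>I. of_real (p j) * ((cnj (U j b) * V k b) * cnj (cnj (U j a) * V k a)))"
    unfolding sum_distrib_left sum_distrib_right by (intro sum.cong refl) simp
  also have "\<dots> = (\<Sum>j\<in>I. \<Sum>a\<in>I. \<Sum>b\<in>I. of_real (p j) * ((cnj (U j b) * V k b) * cnj (cnj (U j a) * V k a)))"
    by (rule trans[OF sum.cong[OF refl sum.swap] sum.swap])
  also have "\<dots> = (\<Sum>j\<in>I. \<Sum>b\<in>I. \<Sum>a\<in>I. of_real (p j) * ((cnj (U j b) * V k b) * cnj (cnj (U j a) * V k a)))"
    by (rule sum.cong[OF refl], rule sum.swap)
  also have "\<dots> = (\<Sum>j\<in>I. of_real (p j) * (overlap I U V j k * cnj (overlap I U V j k)))"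
    unfolding overlap_def cnj_sum sum_product unfolding sum_distrib_left by (rule refl)
  also have "\<dots> = of_real (\<Sum>j\<in>I. (cmod (overlap I U V j k))\<^sup>2 * p j)"
    by (simp only: of_real_sum of_real_mult complex_norm_square mult.commute)
  finally show ?thesis .
qed

lemma eigen_decomp_trace:
  assumes fin: "finite I" and D: "eigen_decomp I M p U"
  shows "(\<Sum>i\<in>I. M i i) = of_real (\<Sum>k\<in>I. p k)"
proof -
  have "(\<Sum>i\<in>I. M i i) = (\<Sum>i\<in>I. \<Sum>k\<in>I. of_real (p k) * (U k i * cnj (U k i)))"
    using D by (intro sum.cong refl) (simp add: eigen_decomp_def mult.assoc)
  also have "\<dots> = (\<Sum>k\<in>I. of_real (p k) * (\<Sum>i\<in>I. U k i * cnj (U k i)))"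
    unfolding sum_distrib_left by (rule sum.swap)
  also have "\<dots> = of_real (\<Sum>k\<in>I. p k)"
    using D by (simp add: eigen_decomp_def unitary_on_def)
  finally show ?thesis .
qed

text \<open>As \<open>ln 0 = 0\<close> in HOL, this is the relative entropy (in nats) only if the support of the first
  operator is contained in that of the second; the lemmas below assume this explicitly.\<close>

definition rel_ent :: "'i set \<Rightarrow> ('i \<Rightarrow> real) \<Rightarrow> ('i \<Rightarrow> 'i \<Rightarrow> complex) \<Rightarrow> ('i \<Rightarrow> real) \<Rightarrow> ('i \<Rightarrow> 'i \<Rightarrow> complex) \<Rightarrow> real" where
  "rel_ent I p U q V = (\<Sum>j\<in>I. \<Sum>k\<in>I. (cmod (overlap I U V j k))\<^sup>2 * (p j * ln (p j) - p j * ln (q k)))"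

text \<open>In the variable \<open>s = 1 / (1 + t)\<close>, this is a primitive (up to sign) of
  the rational function \<open>(p - q)\<^sup>2 / (q + t p)\<close>; it vanishes at \<open>s = 0\<close> and yields the relative entropy at
  \<open>s = 1\<close>.  Monotonicity in \<open>s\<close> replaces the usual integral representation of the logarithm.\<close>

definition interp :: "real \<Rightarrow> real \<Rightarrow> real \<Rightarrow> real" where
  "interp p q s = p * ln (p + s * (q - p)) - p * ln p - s * (q - p)"

section \<open>From the rational divergences to the logarithm\<close>

lemma mix_pos:
  fixes p q s :: real
  assumes "p > 0" "q > 0" "0 \<le> s" "s \<le> 1"
  shows "p + s * (q - p) > 0"
proof -
  have "p + s * (q - p) = (1 - s) * p + s * q" by (simp add: algebra_simps)
  moreover have "(1 - s) * p + s * q > 0"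
    using assms by (cases "s = 1") (auto intro!: add_pos_nonneg)
  ultimately show ?thesis by simp
qed

text \<open>For t = (1 - s) / s one has p + s (q - p) = s (q + t p), and the derivative p (q - p) /
  (p + s (q - p)) - (q - p) simplifies to -s (q - p)^2 / (p + s (q - p)).\<close>

lemma interp_has_derivative:
  assumes "p \<ge> 0" "q \<ge> 0" "q = 0 \<Longrightarrow> w * p = 0" "0 < s" "s < 1"
  shows "((\<lambda>s. w * interp p q s) has_real_derivative - (w * ((p - q)\<^sup>2 / (q + (1 - s) / s * p)))) (at s)"
proof -
  consider "w = 0" | "p = 0" | "p > 0" "q > 0" using assms by force
  then show ?thesis
  proof cases
    case 1
    then show ?thesis by simp
  next
    case 2
    then have "(\<lambda>s. w * interp p q s) = (\<lambda>s. - (w * q) * s)" by (simp add: interp_def fun_eq_iff)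
    moreover have "((\<lambda>s. - (w * q) * s) has_real_derivative - (w * q)) (at s)"
      by (auto intro!: derivative_eq_intros)
    ultimately show ?thesis using 2 by (simp add: power2_eq_square)
  next
    case 3
    have m: "p + s * (q - p) > 0" using mix_pos 3 assms by simp
    have "((\<lambda>s. w * interp p q s) has_real_derivative w * (p * ((q - p) / (p + s * (q - p))) - (q - p))) (at s)"
      unfolding interp_def using m by (auto intro!: derivative_eq_intros)
    moreover have "w * (p * ((q - p) / (p + s * (q - p))) - (q - p)) = - (w * ((p - q)\<^sup>2 / (q + (1 - s) / s * p)))"
    proof -
      have "q + (1 - s) / s * p = (p + s * (q - p)) / s" using assms by (simp add: field_simps)
      then have "(p - q)\<^sup>2 / (q + (1 - s) / s * p) = s * (q - p)\<^sup>2 / (p + s * (q - p))"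
        by (simp add: power2_commute mult.commute)
      also have "\<dots> = - (p * ((q - p) / (p + s * (q - p))) - (q - p))"
        using m by (simp add: divide_simps) (simp add: algebra_simps power2_eq_square)
      finally show ?thesis by (simp only: mult_minus_right minus_minus)
    qed
    ultimately show ?thesis by (simp only:)
  qed
qed

text \<open>For q = 0 < p the function tends to minus infinity as s approaches 1. The weight
  \<open>w\<close> is kept in the statement so that the support condition can exclude this
  case.\<close>

lemma interp_continuous:
  assumes "p \<ge> 0" "q \<ge> 0" "q = 0 \<Longrightarrow> w * p = 0"
  shows "continuous_on {0..1} (\<lambda>s. w * interp p q s)"
proof -
  consider "w = 0" | "p = 0" | "p > 0" "q > 0" using assms by force
  then show ?thesis
  proof cases
    case 1
    then show ?thesis by simp
  next
    case 2
    then have "(\<lambda>s. w * interp p q s) = (\<lambda>s. - (w * q) * s)" by (simp add: interp_def fun_eq_iff)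
    moreover have "continuous_on {0..1} (\<lambda>s. - (w * q) * s)" by (intro continuous_intros)
    ultimately show ?thesis by (simp only:)
  next
    case 3
    have "p + s * (q - p) \<noteq> 0" if "s \<in> {0..1}" for s using mix_pos[OF 3, of s] that by auto
    then show ?thesis unfolding interp_def by (intro continuous_intros) auto
  qed
qed

definition interp_sum :: "'i set \<Rightarrow> ('i \<Rightarrow> real) \<Rightarrow> ('i \<Rightarrow> 'i \<Rightarrow> complex) \<Rightarrow> ('i \<Rightarrow> real) \<Rightarrow> ('i \<Rightarrow> 'i \<Rightarrow> complex) \<Rightarrow> real \<Rightarrow> real" where
  "interp_sum I p U q V s = (\<Sum>j\<in>I. \<Sum>k\<in>I. (cmod (overlap I U V j k))\<^sup>2 * interp (p j) (q k) s)"

lemma interp_sum_0: "interp_sum I p U q V 0 = 0"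
  by (simp add: interp_sum_def interp_def)

text \<open>Double stochasticity turns the linear terms of \<open>interp\<close> into a difference
  of traces, which is additive in the operators and therefore harmless for subadditivity.\<close>

lemma interp_sum_1:
  assumes fin: "finite I" and U: "unitary_on I U" and V: "unitary_on I V"
  shows "interp_sum I p U q V 1 = - rel_ent I p U q V - ((\<Sum>k\<in>I. q k) - (\<Sum>j\<in>I. p j))"
proof -
  let ?w = "\<lambda>j k. (cmod (overlap I U V j k))\<^sup>2"
  have 1: "(\<Sum>j\<in>I. \<Sum>k\<in>I. ?w j k * p j) = (\<Sum>j\<in>I. p j)"
    by (intro sum.cong refl) (simp add: sum_distrib_right[symmetric] overlap_row_sum[OF fin U V])
  have 2: "(\<Sum>j\<in>I. \<Sum>k\<in>I. ?w j k * q k) = (\<Sum>k\<in>I. q k)"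
    by (subst sum.swap, intro sum.cong refl) (simp add: sum_distrib_right[symmetric] overlap_col_sum[OF fin U V])
  have "interp_sum I p U q V 1 = (\<Sum>j\<in>I. \<Sum>k\<in>I. - (?w j k * (p j * ln (p j) - p j * ln (q k))) - (?w j k * q k - ?w j k * p j))"
    unfolding interp_sum_def interp_def by (intro sum.cong refl) (simp add: algebra_simps)
  also have "\<dots> = - rel_ent I p U q V - ((\<Sum>k\<in>I. q k) - (\<Sum>j\<in>I. p j))"
    unfolding rel_ent_def 1[symmetric] 2[symmetric] by (simp only: sum_subtractf sum_negf)
  finally show ?thesis .
qed

lemma interp_sum_deriv:
  assumes "\<And>j. j \<in> I \<Longrightarrow> p j \<ge> 0" "\<And>k. k \<in> I \<Longrightarrow> q k \<ge> 0"
    "\<And>j k. j \<in> I \<Longrightarrow> k \<in> I \<Longrightarrow> q k = 0 \<Longrightarrow> (cmod (overlap I U V j k))\<^sup>2 * p j = 0"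
  shows "0 < s \<Longrightarrow> s < 1 \<Longrightarrow>
      (interp_sum I p U q V has_real_derivative - rat_div I ((1 - s) / s) p U q V) (at s)"
    and "continuous_on {0..1} (interp_sum I p U q V)"
proof -
  assume "0 < s" "s < 1"
  then have "((\<lambda>s. \<Sum>j\<in>I. \<Sum>k\<in>I. (cmod (overlap I U V j k))\<^sup>2 * interp (p j) (q k) s) has_real_derivative
     (\<Sum>j\<in>I. \<Sum>k\<in>I. - ((cmod (overlap I U V j k))\<^sup>2 * ((p j - q k)\<^sup>2 / (q k + (1 - s) / s * p j))))) (at s)"
    by (intro DERIV_sum interp_has_derivative assms)
  then show "(interp_sum I p U q V has_real_derivative - rat_div I ((1 - s) / s) p U q V) (at s)"
    unfolding interp_sum_def[abs_def] rat_div_def by (simp only: sum_negf)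
next
  show "continuous_on {0..1} (interp_sum I p U q V)"
    unfolding interp_sum_def[abs_def] by (intro continuous_on_sum interp_continuous assms)
qed

text \<open>The homogeneous form of joint convexity. The gap \<open>?G\<close> vanishes at s = 0 and
  decreases by \<open>rat_div_subadditive\<close>; its value at s = 1 is the difference of the
  relative entropies, once the traces have cancelled.\<close>

theorem rel_ent_subadditive:
  assumes fin: "finite I" and N: "finite N"
    and R: "\<And>n. n \<in> N \<Longrightarrow> eigen_decomp I (\<rho> n) (p n) (U n)" and S: "\<And>n. n \<in> N \<Longrightarrow> eigen_decomp I (\<sigma> n) (q n) (V n)"
    and p: "\<And>n j. n \<in> N \<Longrightarrow> j \<in> I \<Longrightarrow> p n j \<ge> 0" and q: "\<And>n k. n \<in> N \<Longrightarrow> k \<in> I \<Longrightarrow> q n k \<ge> 0"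
    and supp: "\<And>n j k. n \<in> N \<Longrightarrow> j \<in> I \<Longrightarrow> k \<in> I \<Longrightarrow> q n k = 0 \<Longrightarrow> (cmod (overlap I (U n) (V n) j k))\<^sup>2 * p n j = 0"
    and R0: "eigen_decomp I (\<lambda>a b. \<Sum>n\<in>N. \<rho> n a b) p0 U0" and S0: "eigen_decomp I (\<lambda>a b. \<Sum>n\<in>N. \<sigma> n a b) q0 V0"
    and p0: "\<And>j. j \<in> I \<Longrightarrow> p0 j \<ge> 0" and q0: "\<And>k. k \<in> I \<Longrightarrow> q0 k \<ge> 0"
    and supp0: "\<And>j k. j \<in> I \<Longrightarrow> k \<in> I \<Longrightarrow> q0 k = 0 \<Longrightarrow> (cmod (overlap I U0 V0 j k))\<^sup>2 * p0 j = 0"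
  shows "rel_ent I p0 U0 q0 V0 \<le> (\<Sum>n\<in>N. rel_ent I (p n) (U n) (q n) (V n))"
proof -
  let ?G = "\<lambda>s. (\<Sum>n\<in>N. interp_sum I (p n) (U n) (q n) (V n) s) - interp_sum I p0 U0 q0 V0 s"
  have "?G 1 \<le> ?G 0"
  \<comment> \<open>On the open interval the parameter t = (1 - s) / s is positive and finite; at
    the two endpoints continuity suffices.\<close>
  proof (rule DERIV_nonpos_imp_decreasing_open[of 0 1 ?G])
    fix s :: real assume s: "0 < s" "s < 1"
    let ?t = "(1 - s) / s"
    have "(?G has_real_derivative (\<Sum>n\<in>N. - rat_div I ?t (p n) (U n) (q n) (V n)) - (- rat_div I ?t p0 U0 q0 V0)) (at s)"
      by (intro DERIV_diff DERIV_sum interp_sum_deriv p q supp p0 q0 supp0 s)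
    moreover have "rat_div I ?t p0 U0 q0 V0 \<le> (\<Sum>n\<in>N. rat_div I ?t (p n) (U n) (q n) (V n))"
      by (rule rat_div_subadditive[OF fin N _ R S p q R0 S0]) (use s in auto)
    ultimately show "\<exists>y. (?G has_real_derivative y) (at s) \<and> y \<le> 0"
      by (intro exI conjI) (auto simp: sum_negf)
  next
    show "continuous_on {0..1} ?G"
      by (intro continuous_on_diff continuous_on_sum interp_sum_deriv p q supp p0 q0 supp0)
  qed simp
  moreover have "interp_sum I (p n) (U n) (q n) (V n) 1 =
      - rel_ent I (p n) (U n) (q n) (V n) - ((\<Sum>k\<in>I. q n k) - (\<Sum>j\<in>I. p n j))" if "n \<in> N" for n
    by (rule interp_sum_1[OF fin]) (use R[OF that] S[OF that] in \<open>auto simp: eigen_decomp_def\<close>)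
  moreover have "interp_sum I p0 U0 q0 V0 1 = - rel_ent I p0 U0 q0 V0 - ((\<Sum>k\<in>I. q0 k) - (\<Sum>j\<in>I. p0 j))"
    by (rule interp_sum_1[OF fin]) (use R0 S0 in \<open>auto simp: eigen_decomp_def\<close>)
  moreover have "(\<Sum>j\<in>I. p0 j) = (\<Sum>n\<in>N. \<Sum>j\<in>I. p n j)" "(\<Sum>k\<in>I. q0 k) = (\<Sum>n\<in>N. \<Sum>k\<in>I. q n k)"
  proof -
    have tr: "(\<Sum>j\<in>I. r0 j) = (\<Sum>n\<in>N. \<Sum>j\<in>I. r n j)"
      if "\<And>n. n \<in> N \<Longrightarrow> eigen_decomp I (M n) (r n) (W n)" "eigen_decomp I (\<lambda>a b. \<Sum>n\<in>N. M n a b) r0 W0"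
      for M r W r0 W0
    proof -
      have "complex_of_real (\<Sum>j\<in>I. r0 j) = (\<Sum>n\<in>N. \<Sum>i\<in>I. M n i i)"
        unfolding eigen_decomp_trace[OF fin that(2), symmetric] by (rule sum.swap)
      also have "\<dots> = of_real (\<Sum>n\<in>N. \<Sum>j\<in>I. r n j)"
        unfolding of_real_sum[of _ N] by (intro sum.cong refl) (simp only: eigen_decomp_trace[OF fin that(1)])
      finally show ?thesis by (simp only: of_real_eq_iff)
    qed
    show "(\<Sum>j\<in>I. p0 j) = (\<Sum>n\<in>N. \<Sum>j\<in>I. p n j)" by (rule tr[OF R R0])
    show "(\<Sum>k\<in>I. q0 k) = (\<Sum>n\<in>N. \<Sum>k\<in>I. q n k)" by (rule tr[OF S S0])
  qed
  ultimately show ?thesis by (simp add: interp_sum_0 sum_subtractf sum_negf)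
qed

section \<open>Entropy of positive operators\<close>

text \<open>The inequality constrains only the real part of the quadratic form, so Hermiticity is a
  separate conjunct.\<close>

definition psd_on :: "'i set \<Rightarrow> ('i \<Rightarrow> 'i \<Rightarrow> complex) \<Rightarrow> bool" where
  "psd_on I M \<longleftrightarrow> hermitian_on I M \<and> (\<forall>v. 0 \<le> Re (\<Sum>a\<in>I. \<Sum>b\<in>I. cnj (v a) * M a b * v b))"

lemma psd_on_hermitian: "psd_on I M \<Longrightarrow> hermitian_on I M"
  by (simp add: psd_on_def)

lemma hermitian_onD: "hermitian_on I M \<Longrightarrow> i \<in> I \<Longrightarrow> j \<in> I \<Longrightarrow> cnj (M i j) = M j i"
  unfolding hermitian_on_def by metis

lemma hermitian_onI: "(\<And>i j. i \<in> I \<Longrightarrow> j \<in> I \<Longrightarrow> cnj (M i j) = M j i) \<Longrightarrow> hermitian_on I M"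
  unfolding hermitian_on_def by metis

lemma psd_on_sum:
  assumes "\<And>n. n \<in> N \<Longrightarrow> psd_on I (M n)"
  shows "psd_on I (\<lambda>a b. \<Sum>n\<in>N. M n a b)"
proof -
  have "hermitian_on I (\<lambda>a b. \<Sum>n\<in>N. M n a b)"
    by (rule hermitian_onI) (simp add: hermitian_onD[OF psd_on_hermitian[OF assms]])
  moreover have "0 \<le> Re (\<Sum>a\<in>I. \<Sum>b\<in>I. cnj (v a) * (\<Sum>n\<in>N. M n a b) * v b)" for v
  proof -
    have "(\<Sum>a\<in>I. \<Sum>b\<in>I. cnj (v a) * (\<Sum>n\<in>N. M n a b) * v b) = (\<Sum>a\<in>I. \<Sum>b\<in>I. \<Sum>n\<in>N. cnj (v a) * M n a b * v b)"
      by (simp only: sum_distrib_left sum_distrib_right)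
    also have "\<dots> = (\<Sum>n\<in>N. \<Sum>a\<in>I. \<Sum>b\<in>I. cnj (v a) * M n a b * v b)"
      by (rule trans[OF sum.cong[OF refl sum.swap] sum.swap])
    also have "Re \<dots> = (\<Sum>n\<in>N. Re (\<Sum>a\<in>I. \<Sum>b\<in>I. cnj (v a) * M n a b * v b))" by (rule Re_sum)
    also have "\<dots> \<ge> 0" using assms by (intro sum_nonneg) (simp add: psd_on_def)
    finally show ?thesis .
  qed
  ultimately show ?thesis unfolding psd_on_def by blast
qed

lemma psd_on_gram: "psd_on I (\<lambda>i j. \<Sum>e\<in>E. K i e * cnj (K j e))"
proof (rule psd_on_sum)
  fix e
  have "(\<Sum>a\<in>I. \<Sum>b\<in>I. cnj (v a) * (K a e * cnj (K b e)) * v b) = of_real ((cmod (\<Sum>a\<in>I. cnj (v a) * K a e))\<^sup>2)" for v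
    unfolding complex_norm_square cnj_sum sum_product by (intro sum.cong refl) simp
  then show "psd_on I (\<lambda>i j. K i e * cnj (K j e))"
    by (simp add: psd_on_def hermitian_onI)
qed

lemma eigen_decomp_nonneg:
  assumes fin: "finite I" and psd: "psd_on I M" and D: "eigen_decomp I M p U" and k: "k \<in> I"
  shows "p k \<ge> 0"
proof -
  have U: "unitary_on I U" using D by (simp add: eigen_decomp_def)
  have "(cmod (overlap I U U j k))\<^sup>2 * p j = (if j = k then p j else 0)" if "j \<in> I" for j
    using unitary_on_rows[OF unitary_on_cnj[OF U] that k] by (simp add: overlap_def)
  then have "(\<Sum>j\<in>I. (cmod (overlap I U U j k))\<^sup>2 * p j) = p k" using fin k by simp
  moreover have "0 \<le> Re (\<Sum>a\<in>I. \<Sum>b\<in>I. cnj (U k a) * M a b * U k b)"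
    using psd by (simp add: psd_on_def)
  ultimately show ?thesis unfolding eigen_decomp_diag[OF fin D U k] by simp
qed

text \<open>The effect of measuring the label \<open>g\<close> and forgetting the outcome:
  coherences between different labels are deleted. It is the N of the overview when \<open>g\<close>
  reads off the register B.\<close>

definition pinch :: "('i \<Rightarrow> 'c) \<Rightarrow> ('i \<Rightarrow> 'i \<Rightarrow> complex) \<Rightarrow> 'i \<Rightarrow> 'i \<Rightarrow> complex" where
  "pinch g M i j = (if g i = g j then M i j else 0)"

lemma eigen_decomp_blocks_exists:
  assumes fin: "finite I" and herm: "hermitian_on I M"
    and off: "\<And>i j. i \<in> I \<Longrightarrow> j \<in> I \<Longrightarrow> f i \<noteq> f j \<Longrightarrow> M i j = 0"
  obtains p U where "\<And>c. eigen_decomp {i\<in>I. f i = c} M (p c) (U c)"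
    "eigen_decomp I M (\<lambda>k. p (f k) k) (\<lambda>k i. if f k = f i then U (f k) k i else 0)"
proof -
  have "\<forall>c. \<exists>p U. eigen_decomp {i\<in>I. f i = c} M p U"
    using fin herm by (intro allI hermitian_eigen_decomp hermitian_on_subset[OF herm]) auto
  then obtain p U where pU: "\<And>c. eigen_decomp {i\<in>I. f i = c} M (p c) (U c)" by metis
  show ?thesis by (rule that[OF pU eigen_decomp_blocks[OF fin pU off]])
qed

lemma vN_entropy_blocks:
  assumes fin: "finite I" and herm: "hermitian_on I M"
    and off: "\<And>i j. i \<in> I \<Longrightarrow> j \<in> I \<Longrightarrow> f i \<noteq> f j \<Longrightarrow> M i j = 0"
  shows "vN_entropy I M = (\<Sum>c\<in>f ` I. vN_entropy {i\<in>I. f i = c} M)"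
proof -
  obtain p U where D: "\<And>c. eigen_decomp {i\<in>I. f i = c} M (p c) (U c)"
    "eigen_decomp I M (\<lambda>k. p (f k) k) (\<lambda>k i. if f k = f i then U (f k) k i else 0)"
    using eigen_decomp_blocks_exists[OF fin herm, of f] off by blast
  have "vN_entropy I M = (\<Sum>k\<in>I. ent (p (f k) k))" by (rule vN_entropy_eigen[OF fin D(2)])
  also have "\<dots> = (\<Sum>c\<in>f ` I. \<Sum>k | k \<in> I \<and> f k = c. ent (p (f k) k))" by (rule sum.image_gen[OF fin])
  also have "\<dots> = (\<Sum>c\<in>f ` I. vN_entropy {i\<in>I. f i = c} M)"
    by (intro sum.cong refl) (simp add: vN_entropy_eigen[OF _ D(1)] fin)
  finally show ?thesis .
qed

text \<open>The enumerations chosen for \<open>I\<close> and \<open>J\<close> are unrelated; instead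
  of comparing the matrices, a diagonalisation is transported along \<open>g\<close>.\<close>

lemma vN_entropy_reindex:
  assumes fin: "finite J" and g: "bij_betw g J I" and herm: "hermitian_on I M"
  shows "vN_entropy I M = vN_entropy J (\<lambda>i j. M (g i) (g j))"
proof -
  have finI: "finite I" using bij_betw_finite[OF g] fin by simp
  obtain p U where D: "eigen_decomp I M p U" using hermitian_eigen_decomp[OF finI herm] by blast
  have inj: "g i = g j \<longleftrightarrow> i = j" if "i \<in> J" "j \<in> J" for i j
    using g that by (auto simp: bij_betw_def inj_on_def)
  have mem: "g i \<in> I" if "i \<in> J" for i using g that by (auto simp: bij_betw_def)
  have reidx: "(\<Sum>i\<in>J. h (g i)) = (\<Sum>i\<in>I. h i)" for h :: "_ \<Rightarrow> complex"
    by (rule sum.reindex_bij_betw[OF g])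
  have "eigen_decomp J (\<lambda>i j. M (g i) (g j)) (\<lambda>k. p (g k)) (\<lambda>k i. U (g k) (g i))"
  proof -
    have "(\<Sum>i\<in>J. U (g k) (g i) * cnj (U (g l) (g i))) = (if k = l then 1 else 0)" if "k \<in> J" "l \<in> J" for k l
      unfolding reidx[of "\<lambda>i. U (g k) i * cnj (U (g l) i)"]
      using D that by (simp add: eigen_decomp_def unitary_on_def mem inj)
    moreover have "(\<Sum>k\<in>J. cnj (U (g k) (g i)) * U (g k) (g j)) = (if i = j then 1 else 0)" if "i \<in> J" "j \<in> J" for i j
      unfolding reidx[of "\<lambda>k. cnj (U k (g i)) * U k (g j)"]
      using D that by (simp add: eigen_decomp_def unitary_on_def mem inj)
    moreover have "M (g i) (g j) = (\<Sum>k\<in>J. of_real (p (g k)) * U (g k) (g i) * cnj (U (g k) (g j)))" if "i \<in> J" "j \<in> J" for i j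
      unfolding reidx[of "\<lambda>k. of_real (p k) * U k (g i) * cnj (U k (g j))"]
      using D that by (simp add: eigen_decomp_def mem)
    ultimately show ?thesis by (simp add: eigen_decomp_def unitary_on_def)
  qed
  then show ?thesis
    using vN_entropy_eigen[OF finI D] vN_entropy_eigen[OF fin] sum.reindex_bij_betw[OF g, of "\<lambda>k. ent (p k)"]
    by simp
qed

lemma vN_entropy_support:
  assumes fin: "finite J" and sub: "I \<subseteq> J" and herm: "hermitian_on J M"
    and zero: "\<And>i j. i \<in> J \<Longrightarrow> j \<in> J \<Longrightarrow> i \<notin> I \<Longrightarrow> M i j = 0"
  shows "vN_entropy J M = vN_entropy I M"
proof -
  have zero': "M i j = 0" if "i \<in> J" "j \<in> J" "j \<notin> I" for i j
    using zero[OF that(2,1,3)] herm that unfolding hermitian_on_def by (metis complex_cnj_zero)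
  have 0: "vN_entropy {i\<in>J. (i \<in> I) = c} M = (if c then vN_entropy I M else 0)" for c
  proof (cases c)
    case True
    moreover have "{i\<in>J. i \<in> I} = I" using sub by auto
    ultimately show ?thesis by simp
  next
    case False
    have "vN_entropy {i\<in>J. i \<notin> I} M = vN_entropy {i\<in>J. i \<notin> I} (\<lambda>_ _. 0)"
      by (rule vN_entropy_cong) (use fin zero in auto)
    then show ?thesis using False fin vN_entropy_zero[of "{i\<in>J. i \<notin> I}"] by simp
  qed
  have "vN_entropy J M = (\<Sum>c\<in>(\<lambda>i. i \<in> I) ` J. vN_entropy {i\<in>J. (i \<in> I) = c} M)"
    by (rule vN_entropy_blocks[OF fin herm]) (use zero zero' in blast)
  also have "\<dots> = (\<Sum>c\<in>UNIV. vN_entropy {i\<in>J. (i \<in> I) = c} M)"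
  proof (rule sum.mono_neutral_left)
    show "\<forall>c\<in>UNIV - (\<lambda>i. i \<in> I) ` J. vN_entropy {i\<in>J. (i \<in> I) = c} M = 0"
    proof
      fix c assume "c \<in> UNIV - (\<lambda>i. i \<in> I) ` J"
      then have *: "{i\<in>J. (i \<in> I) = c} = {}" by auto
      then show "vN_entropy {i\<in>J. (i \<in> I) = c} M = 0"
        unfolding * using vN_entropy_eigen[of "{}" M] by (simp add: eigen_decomp_def unitary_on_def)
    qed
  qed auto
  also have "\<dots> = vN_entropy I M" by (simp add: 0 UNIV_bool)
  finally show ?thesis .
qed

lemma vN_entropy_singleton:
  assumes "hermitian_on {a} M"
  shows "vN_entropy {a} M = ent (Re (M a a))"
proof -
  have "cnj (M a a) = M a a" using assms unfolding hermitian_on_def by (metis insertI1)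
  then have "complex_of_real (Re (M a a)) = M a a" by (metis Reals_cnj_iff of_real_Re)
  then have "eigen_decomp {a} M (\<lambda>_. Re (M a a)) (\<lambda>_ _. 1)" by (simp add: eigen_decomp_def unitary_on_def)
  then show ?thesis using vN_entropy_eigen[of "{a}"] by simp
qed

lemma ent_mult:
  assumes "t > 0" "p \<ge> 0" shows "ent (t * p) = t * ent p + p * ent t"
proof (cases "p = 0")
  case False
  then have "log 2 (t * p) = log 2 t + log 2 p" using assms by (simp add: log_mult)
  then show ?thesis by (simp add: ent_def algebra_simps)
qed (simp add: ent_def)

text \<open>Entropy is not homogeneous on unnormalised operators: since
  \<open>ent (t * p) = t * ent p + p * ent t\<close>, scaling adds \<open>ent t\<close> times the
  trace. \<open>leak\<close> and \<open>norm_entropy\<close> are built so that this correction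
  cancels.\<close>

lemma vN_entropy_scale:
  assumes fin: "finite I" and psd: "psd_on I M" and t: "t > 0"
  shows "vN_entropy I (\<lambda>i j. of_real t * M i j) = t * vN_entropy I M + ent t * Re (\<Sum>i\<in>I. M i i)"
proof -
  obtain p U where D: "eigen_decomp I M p U"
    using hermitian_eigen_decomp[OF fin psd_on_hermitian[OF psd]] by blast
  have "eigen_decomp I (\<lambda>i j. of_real t * M i j) (\<lambda>k. t * p k) U"
    using D by (simp add: eigen_decomp_def sum_distrib_left mult.assoc)
  then have "vN_entropy I (\<lambda>i j. of_real t * M i j) = (\<Sum>k\<in>I. t * ent (p k) + p k * ent t)"
    using vN_entropy_eigen[OF fin] ent_mult[OF t eigen_decomp_nonneg[OF fin psd D]] by simp
  also have "\<dots> = t * vN_entropy I M + ent t * Re (\<Sum>i\<in>I. M i i)"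
    by (simp add: vN_entropy_eigen[OF fin D] eigen_decomp_trace[OF fin D] sum.distrib sum_distrib_left sum_distrib_right mult.commute del: of_real_sum)
  finally show ?thesis .
qed

lemma ent_ln: "ent x * ln 2 = - (x * ln x)"
  by (simp add: ent_def log_def)

lemma rel_ent_eq:
  assumes fin: "finite I" and U: "unitary_on I U" and V: "unitary_on I V"
  shows "rel_ent I p U q V = (\<Sum>j\<in>I. p j * ln (p j)) - (\<Sum>k\<in>I. (\<Sum>j\<in>I. (cmod (overlap I U V j k))\<^sup>2 * p j) * ln (q k))"
proof -
  let ?w = "\<lambda>j k. (cmod (overlap I U V j k))\<^sup>2"
  have 1: "(\<Sum>j\<in>I. \<Sum>k\<in>I. ?w j k * (p j * ln (p j))) = (\<Sum>j\<in>I. p j * ln (p j))"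
    by (intro sum.cong refl) (simp add: sum_distrib_right[symmetric] overlap_row_sum[OF fin U V])
  have 2: "(\<Sum>j\<in>I. \<Sum>k\<in>I. ?w j k * (p j * ln (q k))) = (\<Sum>k\<in>I. (\<Sum>j\<in>I. ?w j k * p j) * ln (q k))"
    by (subst sum.swap) (simp add: sum_distrib_right mult.assoc)
  show ?thesis unfolding rel_ent_def right_diff_distrib sum_subtractf 1 2 ..
qed

text \<open>In a block eigenbasis v of the pinched operator, q_k is also the expectation of
  \<open>M\<close> in v_k. So the cross term of the relative entropy collapses to the entropy of
  \<open>pinch g M\<close>, and q_k = 0 forces the support condition.\<close>

lemma pinch_eigen:
  assumes fin: "finite I" and psd: "psd_on I M"
  obtains p U q V where "eigen_decomp I M p U" "eigen_decomp I (pinch g M) q V"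
    "\<And>j. j \<in> I \<Longrightarrow> p j \<ge> 0" "\<And>k. k \<in> I \<Longrightarrow> q k \<ge> 0"
    "\<And>j k. j \<in> I \<Longrightarrow> k \<in> I \<Longrightarrow> q k = 0 \<Longrightarrow> (cmod (overlap I U V j k))\<^sup>2 * p j = 0"
    "rel_ent I p U q V = (vN_entropy I (pinch g M) - vN_entropy I M) * ln 2"
proof -
  have herm: "hermitian_on I M" by (rule psd_on_hermitian[OF psd])
  obtain p U where D: "eigen_decomp I M p U" using hermitian_eigen_decomp[OF fin herm] by blast
  have "hermitian_on I (pinch g M)" by (rule hermitian_onI) (auto simp: pinch_def hermitian_onD[OF herm])
  moreover have "\<And>i j. i \<in> I \<Longrightarrow> j \<in> I \<Longrightarrow> g i \<noteq> g j \<Longrightarrow> pinch g M i j = 0"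
    by (simp add: pinch_def)
  \<comment> \<open>A block eigenbasis is essential: when blocks share an eigenvalue, an arbitrary
    eigenvector may mix them and would then see the deleted entries of \<open>M\<close>.\<close>
  ultimately obtain q' V' where E0: "eigen_decomp I (pinch g M) (\<lambda>k. q' (g k) k) (\<lambda>k i. if g k = g i then V' (g k) k i else 0)"
    using eigen_decomp_blocks_exists[OF fin, of "pinch g M" g] by blast
  define q where "q k = q' (g k) k" for k
  define V where "V k i = (if g k = g i then V' (g k) k i else 0)" for k i
  have E: "eigen_decomp I (pinch g M) q V" using E0 unfolding q_def[abs_def] V_def[abs_def] .
  have V: "V k i = 0" if "g k \<noteq> g i" for k i using that by (simp add: V_def)
  have uU: "unitary_on I U" and uV: "unitary_on I V" using D E by (auto simp: eigen_decomp_def)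
  have p: "p j \<ge> 0" if "j \<in> I" for j by (rule eigen_decomp_nonneg[OF fin psd D that])
  have q: "q k = (\<Sum>j\<in>I. (cmod (overlap I U V j k))\<^sup>2 * p j)" if k: "k \<in> I" for k
  proof -
    have "(cmod (overlap I V V j k))\<^sup>2 * q j = (if j = k then q j else 0)" if "j \<in> I" for j
      using unitary_on_rows[OF unitary_on_cnj[OF uV] that k] by (simp add: overlap_def)
    then have "(\<Sum>j\<in>I. (cmod (overlap I V V j k))\<^sup>2 * q j) = q k" using fin k by simp
    then have "complex_of_real (q k) = (\<Sum>a\<in>I. \<Sum>b\<in>I. cnj (V k a) * pinch g M a b * V k b)"
      unfolding eigen_decomp_diag[OF fin E uV k] by simp
    also have "\<dots> = (\<Sum>a\<in>I. \<Sum>b\<in>I. cnj (V k a) * M a b * V k b)"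
    proof (intro sum.cong refl)
      fix a b
      show "cnj (V k a) * pinch g M a b * V k b = cnj (V k a) * M a b * V k b"
        using V[of k a] V[of k b] by (cases "g k = g a"; cases "g k = g b") (auto simp: pinch_def)
    qed
    also have "\<dots> = of_real (\<Sum>j\<in>I. (cmod (overlap I U V j k))\<^sup>2 * p j)" by (rule eigen_decomp_diag[OF fin D uV k])
    finally show ?thesis by (simp only: of_real_eq_iff)
  qed
  have q0: "q k \<ge> 0" if "k \<in> I" for k unfolding q[OF that] using p by (intro sum_nonneg) simp
  \<comment> \<open>q_k is a sum of nonnegative terms, so its vanishing annihilates each of
    them.\<close>
  have supp: "(cmod (overlap I U V j k))\<^sup>2 * p j = 0" if "j \<in> I" "k \<in> I" "q k = 0" for j k
    using that q[OF that(2)] p sum_nonneg_eq_0_iff[OF fin, of "\<lambda>j. (cmod (overlap I U V j k))\<^sup>2 * p j"] by auto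
  have "rel_ent I p U q V = (\<Sum>j\<in>I. p j * ln (p j)) - (\<Sum>k\<in>I. q k * ln (q k))"
    unfolding rel_ent_eq[OF fin uU uV] by (simp add: q[symmetric])
  also have "\<dots> = (vN_entropy I (pinch g M) - vN_entropy I M) * ln 2"
    unfolding vN_entropy_eigen[OF fin D] vN_entropy_eigen[OF fin E] left_diff_distrib sum_distrib_right ent_ln
    by (simp add: sum_negf)
  finally show ?thesis using that[OF D E p q0 supp] by blast
qed

text \<open>Up to the factor \<open>ln 2\<close> the gain is the relative entropy of
  \<open>M\<close> and \<open>pinch g M\<close>; as pinching is linear, the pairs add up and
  \<open>rel_ent_subadditive\<close> applies.\<close>

theorem pinch_entropy_gain_subadditive:
  assumes fin: "finite I" and N: "finite N" and psd: "\<And>n. n \<in> N \<Longrightarrow> psd_on I (M n)"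
  shows "vN_entropy I (pinch g (\<lambda>a b. \<Sum>n\<in>N. M n a b)) - vN_entropy I (\<lambda>a b. \<Sum>n\<in>N. M n a b)
     \<le> (\<Sum>n\<in>N. vN_entropy I (pinch g (M n)) - vN_entropy I (M n))"
proof -
  define \<Phi> where "\<Phi> n p U q V \<longleftrightarrow> eigen_decomp I (M n) p U \<and> eigen_decomp I (pinch g (M n)) q V \<and>
      (\<forall>j\<in>I. p j \<ge> 0) \<and> (\<forall>k\<in>I. q k \<ge> 0) \<and>
      (\<forall>j\<in>I. \<forall>k\<in>I. q k = 0 \<longrightarrow> (cmod (overlap I U V j k))\<^sup>2 * p j = 0) \<and>
      rel_ent I p U q V = (vN_entropy I (pinch g (M n)) - vN_entropy I (M n)) * ln 2" for n p U q V
  have "\<exists>p U q V. \<Phi> n p U q V" if "n \<in> N" for n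
    by (rule pinch_eigen[OF fin psd[OF that], where g=g]) (unfold \<Phi>_def, blast)
  then obtain p U q V where "\<And>n. n \<in> N \<Longrightarrow> \<Phi> n (p n) (U n) (q n) (V n)" by metis
  then have n: "\<And>n. n \<in> N \<Longrightarrow> eigen_decomp I (M n) (p n) (U n)"
      "\<And>n. n \<in> N \<Longrightarrow> eigen_decomp I (pinch g (M n)) (q n) (V n)"
      "\<And>n j. n \<in> N \<Longrightarrow> j \<in> I \<Longrightarrow> p n j \<ge> 0" "\<And>n k. n \<in> N \<Longrightarrow> k \<in> I \<Longrightarrow> q n k \<ge> 0"
      "\<And>n j k. n \<in> N \<Longrightarrow> j \<in> I \<Longrightarrow> k \<in> I \<Longrightarrow> q n k = 0 \<Longrightarrow> (cmod (overlap I (U n) (V n) j k))\<^sup>2 * p n j = 0"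
      "\<And>n. n \<in> N \<Longrightarrow> rel_ent I (p n) (U n) (q n) (V n) = (vN_entropy I (pinch g (M n)) - vN_entropy I (M n)) * ln 2"
    unfolding \<Phi>_def by blast+
  obtain p0 U0 q0 V0 where z: "eigen_decomp I (\<lambda>a b. \<Sum>n\<in>N. M n a b) p0 U0"
      "eigen_decomp I (pinch g (\<lambda>a b. \<Sum>n\<in>N. M n a b)) q0 V0"
      "\<And>j. j \<in> I \<Longrightarrow> p0 j \<ge> 0" "\<And>k. k \<in> I \<Longrightarrow> q0 k \<ge> 0"
      "\<And>j k. j \<in> I \<Longrightarrow> k \<in> I \<Longrightarrow> q0 k = 0 \<Longrightarrow> (cmod (overlap I U0 V0 j k))\<^sup>2 * p0 j = 0"
      "rel_ent I p0 U0 q0 V0 = (vN_entropy I (pinch g (\<lambda>a b. \<Sum>n\<in>N. M n a b)) - vN_entropy I (\<lambda>a b. \<Sum>n\<in>N. M n a b)) * ln 2"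
    by (rule pinch_eigen[OF fin psd_on_sum[OF psd, of N], where g=g]) auto
  have "pinch g (\<lambda>a b. \<Sum>n\<in>N. M n a b) = (\<lambda>a b. \<Sum>n\<in>N. pinch g (M n) a b)"
    by (auto simp: pinch_def fun_eq_iff)
  with z(2) have S0: "eigen_decomp I (\<lambda>a b. \<Sum>n\<in>N. pinch g (M n) a b) q0 V0" by simp
  have "rel_ent I p0 U0 q0 V0 \<le> (\<Sum>n\<in>N. rel_ent I (p n) (U n) (q n) (V n))"
    by (rule rel_ent_subadditive[where \<rho>=M and \<sigma>="\<lambda>n. pinch g (M n)", OF fin N]) (fact n z S0)+
  then have "(vN_entropy I (pinch g (\<lambda>a b. \<Sum>n\<in>N. M n a b)) - vN_entropy I (\<lambda>a b. \<Sum>n\<in>N. M n a b)) * ln 2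
      \<le> (\<Sum>n\<in>N. vN_entropy I (pinch g (M n)) - vN_entropy I (M n)) * ln 2"
    unfolding z(6) sum_distrib_right using n(6) by simp
  then show ?thesis by (simp add: mult_le_cancel_right)
qed

text \<open>Up to sign the relative entropy of \<open>M\<close> and \<open>(tr M) I\<close>; unlike the entropy itself it is
  homogeneous, so that no normalisation of states is needed.\<close>

definition norm_entropy :: "'i set \<Rightarrow> ('i \<Rightarrow> 'i \<Rightarrow> complex) \<Rightarrow> real" where
  "norm_entropy I M = vN_entropy I M - ent (Re (\<Sum>i\<in>I. M i i))"

lemma trace_eigen:
  assumes fin: "finite I" and psd: "psd_on I M"
  obtains p U where "eigen_decomp I M p U" "\<And>j. j \<in> I \<Longrightarrow> p j \<ge> 0"
    "(\<Sum>j\<in>I. p j) = Re (\<Sum>i\<in>I. M i i)"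
    "rel_ent I p U (\<lambda>_. Re (\<Sum>i\<in>I. M i i)) (\<lambda>k i. if k = i then 1 else 0) = - norm_entropy I M * ln 2"
proof -
  let ?T = "Re (\<Sum>i\<in>I. M i i)" and ?V = "\<lambda>k i. if k = i then 1 else 0 :: complex"
  obtain p U where D: "eigen_decomp I M p U"
    using hermitian_eigen_decomp[OF fin psd_on_hermitian[OF psd]] by blast
  have U: "unitary_on I U" using D by (simp add: eigen_decomp_def)
  have T: "(\<Sum>j\<in>I. p j) = ?T" unfolding eigen_decomp_trace[OF fin D] by simp
  have "(\<Sum>k\<in>I. \<Sum>j\<in>I. (cmod (overlap I U ?V j k))\<^sup>2 * p j) = (\<Sum>j\<in>I. p j)"
    by (subst sum.swap, intro sum.cong refl)
      (simp add: sum_distrib_right[symmetric] overlap_row_sum[OF fin U unitary_on_id[OF fin]])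
  then have "rel_ent I p U (\<lambda>_. ?T) ?V = (\<Sum>j\<in>I. p j * ln (p j)) - ?T * ln ?T"
    unfolding rel_ent_eq[OF fin U unitary_on_id[OF fin]] by (simp add: sum_distrib_right[symmetric] T)
  also have "\<dots> = - norm_entropy I M * ln 2"
    unfolding norm_entropy_def vN_entropy_eigen[OF fin D] minus_diff_eq left_diff_distrib sum_distrib_right ent_ln
    by (simp add: sum_negf)
  finally show ?thesis using that[OF D eigen_decomp_nonneg[OF fin psd D] T] by blast
qed

text \<open>Concavity of the entropy in homogeneous form, that is, nonnegativity of Holevo
  quantities. The reference operators, trace times identity, add up to the reference operator of the
  sum.\<close>

theorem norm_entropy_superadditive:
  assumes fin: "finite I" and N: "finite N" and psd: "\<And>n. n \<in> N \<Longrightarrow> psd_on I (M n)"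
  shows "(\<Sum>n\<in>N. norm_entropy I (M n)) \<le> norm_entropy I (\<lambda>a b. \<Sum>n\<in>N. M n a b)"
proof -
  define T where "T n = Re (\<Sum>i\<in>I. M n i i)" for n
  \<comment> \<open>All reference operators are multiples of the identity, so the standard basis
    diagonalises every one of them.\<close>
  define W where "W k i = (if k = i then 1 else 0 :: complex)" for k i :: 'a
  have W: "unitary_on I W" unfolding W_def[abs_def] by (rule unitary_on_id[OF fin])
  let ?M = "\<lambda>a b. \<Sum>n\<in>N. M n a b"
  define \<Phi> where "\<Phi> n p U \<longleftrightarrow> eigen_decomp I (M n) p U \<and> (\<forall>j\<in>I. p j \<ge> 0) \<and> (\<Sum>j\<in>I. p j) = T n \<and>
      rel_ent I p U (\<lambda>_. T n) W = - norm_entropy I (M n) * ln 2" for n p U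
  have "\<exists>p U. \<Phi> n p U" if "n \<in> N" for n
    by (rule trace_eigen[OF fin psd[OF that]]) (unfold \<Phi>_def T_def W_def[abs_def], blast)
  then obtain p U where "\<And>n. n \<in> N \<Longrightarrow> \<Phi> n (p n) (U n)" by metis
  then have n: "\<And>n. n \<in> N \<Longrightarrow> eigen_decomp I (M n) (p n) (U n)"
      "\<And>n j. n \<in> N \<Longrightarrow> j \<in> I \<Longrightarrow> p n j \<ge> 0" "\<And>n. n \<in> N \<Longrightarrow> (\<Sum>j\<in>I. p n j) = T n"
      "\<And>n. n \<in> N \<Longrightarrow> rel_ent I (p n) (U n) (\<lambda>_. T n) W = - norm_entropy I (M n) * ln 2"
    unfolding \<Phi>_def by blast+
  let ?T0 = "Re (\<Sum>i\<in>I. ?M i i)"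
  obtain p0 U0 where z: "eigen_decomp I ?M p0 U0" "\<And>j. j \<in> I \<Longrightarrow> p0 j \<ge> 0" "(\<Sum>j\<in>I. p0 j) = ?T0"
      "rel_ent I p0 U0 (\<lambda>_. ?T0) W = - norm_entropy I ?M * ln 2"
    by (rule trace_eigen[OF fin psd_on_sum[OF psd, of N]]) (auto simp: W_def[abs_def])
  have diag: "eigen_decomp I (\<lambda>a b. if a = b then of_real c else 0) (\<lambda>_. c) W" for c
  proof -
    have "(if a = b then of_real c else 0) = (\<Sum>k\<in>I. of_real c * W k a * cnj (W k b))" if "a \<in> I" for a b
    proof -
      have "(\<Sum>k\<in>I. of_real c * W k a * cnj (W k b)) = (\<Sum>k\<in>I. W k a * (of_real c * cnj (W k b)))"
        by (intro sum.cong refl) (simp only: mult_ac)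
      also have "\<dots> = of_real c * cnj (W a b)" unfolding W_def by (rule sum_delta_mult(1)[OF fin that])
      finally show ?thesis by (simp add: W_def)
    qed
    then show ?thesis using W by (simp add: eigen_decomp_def)
  qed
  have T0: "?T0 = (\<Sum>n\<in>N. T n)" unfolding T_def by (subst sum.swap) (simp add: Re_sum)
  have eq: "(\<lambda>a b. if a = b then complex_of_real ?T0 else 0) = (\<lambda>a b. \<Sum>n\<in>N. if a = b then of_real (T n) else 0)"
    unfolding T0 by (auto simp: fun_eq_iff)
  have S0: "eigen_decomp I (\<lambda>a b. \<Sum>n\<in>N. if a = b then of_real (T n) else 0) (\<lambda>_. ?T0) W"
    unfolding eq[symmetric] by (rule diag)
  \<comment> \<open>The reference operator has eigenvalue 0 only if the trace vanishes, and then all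
    eigenvalues of the first operator are 0.\<close>
  have supp: "w * r j = 0" if "\<And>j. j \<in> I \<Longrightarrow> r j \<ge> 0" "(\<Sum>j\<in>I. r j) = T" "T = 0" "j \<in> I" for w j T and r :: "'a \<Rightarrow> real"
    using that sum_nonneg_eq_0_iff[OF fin, of r] by auto
  have "rel_ent I p0 U0 (\<lambda>_. ?T0) W \<le> (\<Sum>n\<in>N. rel_ent I (p n) (U n) (\<lambda>_. T n) W)"
  proof (rule rel_ent_subadditive[where \<rho>=M and \<sigma>="\<lambda>n a b. if a = b then of_real (T n) else 0"
        and q="\<lambda>n _. T n" and V="\<lambda>_. W", OF fin N])
    show "eigen_decomp I (\<lambda>a b. if a = b then of_real (T n) else 0) (\<lambda>_. T n) W" if "n \<in> N" for n
      by (rule diag)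
    show "0 \<le> T n" if "n \<in> N" "k \<in> I" for n k
      unfolding n(3)[OF that(1), symmetric] by (intro sum_nonneg n(2)[OF that(1)])
    show "0 \<le> ?T0" if "k \<in> I" for k unfolding z(3)[symmetric] by (intro sum_nonneg z(2))
    show "(cmod (overlap I (U n) W j k))\<^sup>2 * p n j = 0" if "n \<in> N" "j \<in> I" "k \<in> I" "T n = 0" for n j k
      using supp[OF n(2)[OF that(1)] n(3)[OF that(1)] that(4,2)] .
    show "(cmod (overlap I U0 W j k))\<^sup>2 * p0 j = 0" if "j \<in> I" "k \<in> I" "?T0 = 0" for j k
      using supp[OF z(2) z(3) that(3,1)] .
  qed (fact n(1) n(2) z(1) z(2) S0)+
  then have "(- norm_entropy I ?M) * ln 2 \<le> - (\<Sum>n\<in>N. norm_entropy I (M n)) * ln 2"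
    unfolding z(4) sum_negf[symmetric] sum_distrib_right using n(4) by simp
  then show ?thesis by (simp add: mult_le_cancel_right)
qed

section \<open>Bipartite amplitudes\<close>

lemma vN_entropy_empty: "vN_entropy {} M = 0"
  using vN_entropy_eigen[of "{}" M] by (simp add: eigen_decomp_def unitary_on_def)

lemma vN_entropy_product_blocks:
  assumes Y: "finite Y" and B: "finite B" and herm: "hermitian_on (Y \<times> B) M"
  shows "vN_entropy (Y \<times> B) (pinch fst M) = (\<Sum>y\<in>Y. vN_entropy B (\<lambda>b c. M (y, b) (y, c)))"
\<comment> \<open>For empty \<open>B\<close> the set of labels that occur is empty rather than
  \<open>Y\<close>.\<close>
proof (cases "B = {}")
  case True
  then show ?thesis by (simp add: vN_entropy_empty)
next
  case False
  have fin: "finite (Y \<times> B)" using Y B by simp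
  have hp: "hermitian_on (Y \<times> B) (pinch fst M)"
    by (rule hermitian_onI) (auto simp: pinch_def hermitian_onD[OF herm])
  have "vN_entropy (Y \<times> B) (pinch fst M) = (\<Sum>y\<in>fst ` (Y \<times> B). vN_entropy {p\<in>Y \<times> B. fst p = y} (pinch fst M))"
    by (rule vN_entropy_blocks[OF fin hp]) (simp add: pinch_def)
  also have "fst ` (Y \<times> B) = Y" using False by force
  also have "(\<Sum>y\<in>Y. vN_entropy {p\<in>Y \<times> B. fst p = y} (pinch fst M)) = (\<Sum>y\<in>Y. vN_entropy B (\<lambda>b c. M (y, b) (y, c)))"
  proof (intro sum.cong refl)
    fix y assume y: "y \<in> Y"
    have bij: "bij_betw (Pair y) B {p\<in>Y \<times> B. fst p = y}"
      using y by (auto simp: bij_betw_def inj_on_def)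
    show "vN_entropy {p\<in>Y \<times> B. fst p = y} (pinch fst M) = vN_entropy B (\<lambda>b c. M (y, b) (y, c))"
      by (subst vN_entropy_reindex[OF B bij hermitian_on_subset[OF hp]]) (auto simp: pinch_def)
  qed
  finally show ?thesis .
qed

text \<open>Reordering the factors makes the measured component the first coordinate, which reduces
  the claim to \<open>vN_entropy_product_blocks\<close>.\<close>

lemma vN_entropy_pinch_second:
  assumes Y0: "finite Y0" and Y1: "finite Y1" and B: "finite B" and herm: "hermitian_on ((Y0 \<times> Y1) \<times> B) M"
  shows "vN_entropy ((Y0 \<times> Y1) \<times> B) (pinch (snd \<circ> fst) M) =
    (\<Sum>y1\<in>Y1. vN_entropy (Y0 \<times> B) (\<lambda>p q. M ((fst p, y1), snd p) ((fst q, y1), snd q)))"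
proof -
  let ?g = "\<lambda>(y1, y0, b). ((y0, y1), b)"
  have bij: "bij_betw ?g (Y1 \<times> Y0 \<times> B) ((Y0 \<times> Y1) \<times> B)"
    by (rule bij_betw_byWitness[where f'="\<lambda>((y0, y1), b). (y1, y0, b)"]) auto
  have hp: "hermitian_on ((Y0 \<times> Y1) \<times> B) (pinch (snd \<circ> fst) M)"
    by (rule hermitian_onI) (auto simp: pinch_def hermitian_onD[OF herm])
  have hg: "hermitian_on (Y1 \<times> Y0 \<times> B) (\<lambda>i j. M (?g i) (?g j))"
    by (rule hermitian_onI) (auto intro!: hermitian_onD[OF herm])
  have fin: "finite (Y1 \<times> Y0 \<times> B)" using Y0 Y1 B by simp
  have "vN_entropy ((Y0 \<times> Y1) \<times> B) (pinch (snd \<circ> fst) M) =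
      vN_entropy (Y1 \<times> Y0 \<times> B) (\<lambda>i j. pinch (snd \<circ> fst) M (?g i) (?g j))"
    by (rule vN_entropy_reindex[OF fin bij hp])
  also have "(\<lambda>i j. pinch (snd \<circ> fst) M (?g i) (?g j)) = pinch fst (\<lambda>i j. M (?g i) (?g j))"
    by (auto simp: pinch_def fun_eq_iff)
  also have "vN_entropy (Y1 \<times> Y0 \<times> B) \<dots> = (\<Sum>y1\<in>Y1. vN_entropy (Y0 \<times> B) (\<lambda>p q. M (?g (y1, p)) (?g (y1, q))))"
    using vN_entropy_product_blocks[OF Y1 _ hg] Y0 B by simp
  finally show ?thesis by (simp only: case_prod_unfold fst_conv snd_conv)
qed

text \<open>\<open>k x a y b\<close> is the amplitude of \<open>|x, a, y, b\<rangle>\<close> on \<open>AA'BB'\<close>; it need not be normalised.\<close>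

type_synonym ('x, 'a, 'y, 'b) amplitude = "'x \<Rightarrow> 'a \<Rightarrow> 'y \<Rightarrow> 'b \<Rightarrow> complex"

definition state_BB :: "'a set \<Rightarrow> ('x, 'a, 'y, 'b) amplitude \<Rightarrow> 'x \<Rightarrow> 'y \<times> 'b \<Rightarrow> 'y \<times> 'b \<Rightarrow> complex" where
  "state_BB A k x p q = (\<Sum>a\<in>A. k x a (fst p) (snd p) * cnj (k x a (fst q) (snd q)))"

definition S_BB :: "'x set \<Rightarrow> 'a set \<Rightarrow> 'y set \<Rightarrow> 'b set \<Rightarrow> ('x, 'a, 'y, 'b) amplitude \<Rightarrow> real" where
  "S_BB X A Y B k = vN_entropy (Y \<times> B) (\<lambda>p q. \<Sum>x\<in>X. state_BB A k x p q)"

text \<open>A measured register makes the state block diagonal, so it appears as an outer sum over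
  its outcomes. The blocks are not normalised, and the total therefore already contains the Shannon
  entropy of the outcome.\<close>

definition S_XBB :: "'x set \<Rightarrow> 'a set \<Rightarrow> 'y set \<Rightarrow> 'b set \<Rightarrow> ('x, 'a, 'y, 'b) amplitude \<Rightarrow> real" where
  "S_XBB X A Y B k = (\<Sum>x\<in>X. vN_entropy (Y \<times> B) (state_BB A k x))"

definition S_YB :: "'x set \<Rightarrow> 'a set \<Rightarrow> 'y set \<Rightarrow> 'b set \<Rightarrow> ('x, 'a, 'y, 'b) amplitude \<Rightarrow> real" where
  "S_YB X A Y B k = (\<Sum>y\<in>Y. vN_entropy B (\<lambda>b c. \<Sum>x\<in>X. state_BB A k x (y, b) (y, c)))"

definition S_XYB :: "'x set \<Rightarrow> 'a set \<Rightarrow> 'y set \<Rightarrow> 'b set \<Rightarrow> ('x, 'a, 'y, 'b) amplitude \<Rightarrow> real" where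
  "S_XYB X A Y B k = (\<Sum>x\<in>X. \<Sum>y\<in>Y. vN_entropy B (\<lambda>b c. state_BB A k x (y, b) (y, c)))"

text \<open>The D of the overview. The definition uses the B side only; its symmetry between the
  parties is the content of \<open>leak_swap\<close>.\<close>

definition leak :: "'x set \<Rightarrow> 'a set \<Rightarrow> 'y set \<Rightarrow> 'b set \<Rightarrow> ('x, 'a, 'y, 'b) amplitude \<Rightarrow> real" where
  "leak X A Y B k = S_XYB X A Y B k - S_XBB X A Y B k - S_YB X A Y B k + S_BB X A Y B k"

text \<open>The conditional mutual information \<open>S(X;B'|Y)\<close>, a sum of Holevo quantities of \<open>B'\<close>.\<close>

definition markov_defect :: "'x set \<Rightarrow> 'a set \<Rightarrow> 'y set \<Rightarrow> 'b set \<Rightarrow> ('x, 'a, 'y, 'b) amplitude \<Rightarrow> real" where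
  "markov_defect X A Y B k = (\<Sum>y\<in>Y. norm_entropy B (\<lambda>b c. \<Sum>x\<in>X. state_BB A k x (y, b) (y, c))
      - (\<Sum>x\<in>X. norm_entropy B (\<lambda>b c. state_BB A k x (y, b) (y, c))))"

definition swap_amp :: "('x, 'a, 'y, 'b) amplitude \<Rightarrow> ('y, 'b, 'x, 'a) amplitude" where
  "swap_amp k y b x a = k x a y b"

definition slice :: "'x1 \<Rightarrow> 'y1 \<Rightarrow> ('x0 \<times> 'x1, 'a, 'y0 \<times> 'y1, 'b) amplitude \<Rightarrow> ('x0, 'a, 'y0, 'b) amplitude" where
  "slice x1 y1 k x0 a y0 b = k (x0, x1) a (y0, y1) b"

lemma psd_state_BB: "psd_on I (state_BB A k x)"
  unfolding state_BB_def[abs_def] by (rule psd_on_gram)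

lemma psd_state_B: "psd_on I (\<lambda>b c. state_BB A k x (y, b) (y, c))"
  using psd_on_gram[of I "\<lambda>b a. k x a y b" A] by (simp add: state_BB_def)

lemma herm_sum_BB: "hermitian_on I (\<lambda>p q. \<Sum>x\<in>X. state_BB A k x p q)"
  by (rule psd_on_hermitian, rule psd_on_sum, rule psd_state_BB)

text \<open>Pinching B turns \<open>S_BB\<close> into \<open>S_YB\<close> and \<open>S_XBB\<close>
  into \<open>S_XYB\<close>, so this is subadditivity of the entropy gain over the values of
  x.\<close>

lemma leak_nonneg:
  assumes "finite X" "finite Y" "finite B"
  shows "leak X A Y B k \<ge> 0"
proof -
  have fin: "finite (Y \<times> B)" using assms by simp
  have "vN_entropy (Y \<times> B) (pinch fst (\<lambda>p q. \<Sum>x\<in>X. state_BB A k x p q)) - S_BB X A Y B k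
      \<le> (\<Sum>x\<in>X. vN_entropy (Y \<times> B) (pinch fst (state_BB A k x)) - vN_entropy (Y \<times> B) (state_BB A k x))"
    unfolding S_BB_def by (rule pinch_entropy_gain_subadditive[OF fin assms(1) psd_state_BB])
  also have "\<dots> = S_XYB X A Y B k - S_XBB X A Y B k"
    by (simp add: vN_entropy_product_blocks[OF assms(2,3) psd_on_hermitian[OF psd_state_BB]]
        S_XYB_def S_XBB_def sum_subtractf)
  also have "vN_entropy (Y \<times> B) (pinch fst (\<lambda>p q. \<Sum>x\<in>X. state_BB A k x p q)) = S_YB X A Y B k"
    unfolding S_YB_def by (rule vN_entropy_product_blocks[OF assms(2,3) herm_sum_BB])
  finally show ?thesis by (simp add: leak_def)
qed

lemma markov_defect_nonneg:
  assumes "finite X" "finite B"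
  shows "markov_defect X A Y B k \<ge> 0"
  unfolding markov_defect_def
  by (intro sum_nonneg) (simp add: norm_entropy_superadditive[OF assms(2,1) psd_state_B])

lemma sum_prod_flip: "(\<Sum>x\<in>X0 \<times> X1. f x) = (\<Sum>x1\<in>X1. \<Sum>x0\<in>X0. f (x0, x1))"
  by (subst sum.swap) (simp add: sum.cartesian_product)

text \<open>The total gain of measuring B telescopes through the state after the second part of B
  has been measured. Each half is bounded by subadditivity, and the intermediate entropies of
  \<open>T\<close> cancel.\<close>

theorem leak_slices:
  assumes fin: "finite X0" "finite X1" "finite Y0" "finite Y1" "finite B"
  shows "(\<Sum>x1\<in>X1. \<Sum>y1\<in>Y1. leak X0 A Y0 B (slice x1 y1 k)) \<le> leak (X0 \<times> X1) A (Y0 \<times> Y1) B k"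
proof -
  let ?X = "X0 \<times> X1" and ?Y = "Y0 \<times> Y1"
  let ?J = "?Y \<times> B"
  have finJ: "finite ?J" and finX: "finite ?X" using fin by auto
  define T where "T y1 = (\<lambda>p q. \<Sum>x\<in>?X. state_BB A k x ((fst p, y1), snd p) ((fst q, y1), snd q))" for y1
  have sl: "state_BB A k (x0, x1) ((y, y1), b) ((z, y1), c) = state_BB A (slice x1 y1 k) x0 (y, b) (z, c)" for x0 x1 y y1 b z c
    by (simp add: state_BB_def slice_def)
  have XYB: "S_XYB ?X A ?Y B k = (\<Sum>x1\<in>X1. \<Sum>y1\<in>Y1. S_XYB X0 A Y0 B (slice x1 y1 k))"
  proof -
    have "S_XYB ?X A ?Y B k = (\<Sum>x1\<in>X1. \<Sum>x0\<in>X0. \<Sum>y1\<in>Y1. \<Sum>y0\<in>Y0. vN_entropy B (\<lambda>b c. state_BB A (slice x1 y1 k) x0 (y0, b) (y0, c)))"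
      unfolding S_XYB_def sum_prod_flip sl ..
    also have "\<dots> = (\<Sum>x1\<in>X1. \<Sum>y1\<in>Y1. \<Sum>x0\<in>X0. \<Sum>y0\<in>Y0. vN_entropy B (\<lambda>b c. state_BB A (slice x1 y1 k) x0 (y0, b) (y0, c)))"
      by (rule sum.cong[OF refl], rule sum.swap)
    finally show ?thesis unfolding S_XYB_def .
  qed
  \<comment> \<open>First half: only the second component of B is measured, and the operators
    compared are those of the single pairs (x0, x1).\<close>
  have P1: "(\<Sum>y1\<in>Y1. vN_entropy (Y0 \<times> B) (T y1)) - S_BB ?X A ?Y B k
      \<le> (\<Sum>x1\<in>X1. \<Sum>y1\<in>Y1. S_XBB X0 A Y0 B (slice x1 y1 k)) - S_XBB ?X A ?Y B k"
  proof -
    have "vN_entropy ?J (pinch (snd \<circ> fst) (\<lambda>p q. \<Sum>x\<in>?X. state_BB A k x p q)) - S_BB ?X A ?Y B k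
      \<le> (\<Sum>x\<in>?X. vN_entropy ?J (pinch (snd \<circ> fst) (state_BB A k x)) - vN_entropy ?J (state_BB A k x))"
      unfolding S_BB_def by (rule pinch_entropy_gain_subadditive[OF finJ finX psd_state_BB])
    also have "\<dots> = (\<Sum>x\<in>?X. vN_entropy ?J (pinch (snd \<circ> fst) (state_BB A k x))) - S_XBB ?X A ?Y B k"
      by (simp add: S_XBB_def sum_subtractf)
    also have "(\<Sum>x\<in>?X. vN_entropy ?J (pinch (snd \<circ> fst) (state_BB A k x)))
        = (\<Sum>x1\<in>X1. \<Sum>x0\<in>X0. \<Sum>y1\<in>Y1. vN_entropy (Y0 \<times> B) (state_BB A (slice x1 y1 k) x0))"
      unfolding vN_entropy_pinch_second[OF fin(3,4,5) psd_on_hermitian[OF psd_state_BB]] sum_prod_flip sl by simp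
    also have "\<dots> = (\<Sum>x1\<in>X1. \<Sum>y1\<in>Y1. S_XBB X0 A Y0 B (slice x1 y1 k))"
      unfolding S_XBB_def by (rule sum.cong[OF refl], rule sum.swap)
    also have "vN_entropy ?J (pinch (snd \<circ> fst) (\<lambda>p q. \<Sum>x\<in>?X. state_BB A k x p q)) = (\<Sum>y1\<in>Y1. vN_entropy (Y0 \<times> B) (T y1))"
      unfolding T_def by (rule vN_entropy_pinch_second[OF fin(3,4,5) herm_sum_BB])
    finally show ?thesis .
  qed
  \<comment> \<open>Second half: for fixed y1 the first component is measured; the summands are now
    indexed by x1 alone, with x0 already summed, which produces the \<open>S_YB\<close> and
    \<open>S_BB\<close> of the slices.\<close>
  have P2: "(\<Sum>y0\<in>Y0. vN_entropy B (\<lambda>b c. \<Sum>x\<in>?X. state_BB A k x ((y0, y1), b) ((y0, y1), c))) - vN_entropy (Y0 \<times> B) (T y1)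
      \<le> (\<Sum>x1\<in>X1. S_YB X0 A Y0 B (slice x1 y1 k) - S_BB X0 A Y0 B (slice x1 y1 k))" for y1
  proof -
    let ?Q = "\<lambda>x1 p q. \<Sum>x0\<in>X0. state_BB A (slice x1 y1 k) x0 p q"
    have T: "T y1 = (\<lambda>p q. \<Sum>x1\<in>X1. ?Q x1 p q)"
      unfolding T_def sum_prod_flip sl by simp
    have finYB: "finite (Y0 \<times> B)" using fin by simp
    have "vN_entropy (Y0 \<times> B) (pinch fst (T y1)) - vN_entropy (Y0 \<times> B) (T y1)
      \<le> (\<Sum>x1\<in>X1. vN_entropy (Y0 \<times> B) (pinch fst (?Q x1)) - vN_entropy (Y0 \<times> B) (?Q x1))"
      unfolding T by (rule pinch_entropy_gain_subadditive[OF finYB fin(2) psd_on_sum[OF psd_state_BB]])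
    also have "\<dots> = (\<Sum>x1\<in>X1. S_YB X0 A Y0 B (slice x1 y1 k) - S_BB X0 A Y0 B (slice x1 y1 k))"
      unfolding vN_entropy_product_blocks[OF fin(3,5) herm_sum_BB] S_YB_def S_BB_def ..
    also have "vN_entropy (Y0 \<times> B) (pinch fst (T y1)) = (\<Sum>y0\<in>Y0. vN_entropy B (\<lambda>b c. T y1 (y0, b) (y0, c)))"
      by (rule vN_entropy_product_blocks[OF fin(3,5)]) (unfold T, rule psd_on_hermitian, rule psd_on_sum, rule psd_on_sum, rule psd_state_BB)
    finally show ?thesis by (simp add: T_def)
  qed
  have "S_YB ?X A ?Y B k - (\<Sum>y1\<in>Y1. vN_entropy (Y0 \<times> B) (T y1)) =
      (\<Sum>y1\<in>Y1. (\<Sum>y0\<in>Y0. vN_entropy B (\<lambda>b c. \<Sum>x\<in>?X. state_BB A k x ((y0, y1), b) ((y0, y1), c))) - vN_entropy (Y0 \<times> B) (T y1))"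
    unfolding S_YB_def sum_subtractf sum_prod_flip[of _ Y0 Y1] ..
  also have "\<dots> \<le> (\<Sum>y1\<in>Y1. \<Sum>x1\<in>X1. S_YB X0 A Y0 B (slice x1 y1 k) - S_BB X0 A Y0 B (slice x1 y1 k))"
    by (rule sum_mono[OF P2])
  also have "\<dots> = (\<Sum>x1\<in>X1. \<Sum>y1\<in>Y1. S_YB X0 A Y0 B (slice x1 y1 k) - S_BB X0 A Y0 B (slice x1 y1 k))"
    by (rule sum.swap)
  finally show ?thesis using P1 XYB by (simp add: leak_def sum_subtractf sum.distrib)
qed

text \<open>The total defect is the sum of the defects of all slices plus nonnegative terms
  comparing different x1. If it vanishes, so does each nonnegative summand.\<close>

theorem markov_defect_slice:
  assumes fin: "finite X0" "finite X1" "finite Y0" "finite Y1" "finite B"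
    and 0: "markov_defect (X0 \<times> X1) A (Y0 \<times> Y1) B k = 0" and mem: "x1 \<in> X1" "y1 \<in> Y1"
  shows "markov_defect X0 A Y0 B (slice x1 y1 k) = 0"
proof -
  let ?X = "X0 \<times> X1"
  let ?d = "\<lambda>x1 y1. markov_defect X0 A Y0 B (slice x1 y1 k)"
  let ?M = "\<lambda>x0 x1 y0 y1 b c. state_BB A (slice x1 y1 k) x0 (y0, b) (y0, c)"
  have sl: "state_BB A k (x0, x1) ((y, y1), b) ((z, y1), c) = state_BB A (slice x1 y1 k) x0 (y, b) (z, c)" for x0 x1 y y1 b z c
    by (simp add: state_BB_def slice_def)
  \<comment> \<open>This is the discarded comparison between different x1, at fixed y0 and
    y1.\<close>
  have ge: "(\<Sum>x1\<in>X1. norm_entropy B (\<lambda>b c. \<Sum>x0\<in>X0. ?M x0 x1 y0 y1 b c)) \<le>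
      norm_entropy B (\<lambda>b c. \<Sum>x1\<in>X1. \<Sum>x0\<in>X0. ?M x0 x1 y0 y1 b c)" for y0 y1
    by (rule norm_entropy_superadditive[OF fin(5,2)], rule psd_on_sum, rule psd_state_B)
  have "(\<Sum>y1\<in>Y1. \<Sum>x1\<in>X1. ?d x1 y1) = (\<Sum>y1\<in>Y1. \<Sum>y0\<in>Y0. (\<Sum>x1\<in>X1. norm_entropy B (\<lambda>b c. \<Sum>x0\<in>X0. ?M x0 x1 y0 y1 b c))
      - (\<Sum>x1\<in>X1. \<Sum>x0\<in>X0. norm_entropy B (?M x0 x1 y0 y1)))"
    unfolding markov_defect_def sum_subtractf[symmetric] by (rule sum.cong[OF refl], rule sum.swap)
  also have "\<dots> \<le> (\<Sum>y1\<in>Y1. \<Sum>y0\<in>Y0. norm_entropy B (\<lambda>b c. \<Sum>x1\<in>X1. \<Sum>x0\<in>X0. ?M x0 x1 y0 y1 b c)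
      - (\<Sum>x1\<in>X1. \<Sum>x0\<in>X0. norm_entropy B (?M x0 x1 y0 y1)))"
    by (intro sum_mono diff_right_mono ge)
  also have "\<dots> = markov_defect ?X A (Y0 \<times> Y1) B k"
    unfolding markov_defect_def sum_prod_flip sl ..
  finally have le: "(\<Sum>y1\<in>Y1. \<Sum>x1\<in>X1. ?d x1 y1) \<le> 0" using 0 by simp
  have nn: "?d x1 y1 \<ge> 0" for x1 y1 by (rule markov_defect_nonneg[OF fin(1,5)])
  have "?d x1 y1 \<le> (\<Sum>x1\<in>X1. ?d x1 y1)" using fin mem nn by (intro member_le_sum) auto
  also have "\<dots> \<le> (\<Sum>y1\<in>Y1. \<Sum>x1\<in>X1. ?d x1 y1)" using fin mem nn
    by (intro member_le_sum[of y1 Y1 "\<lambda>y1. \<Sum>x1\<in>X1. ?d x1 y1"]) (auto intro: sum_nonneg)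
  finally show ?thesis using le nn[of x1 y1] by linarith
qed

lemma swap_slice: "swap_amp (slice x1 y1 k) = slice y1 x1 (swap_amp k)"
  by (simp add: fun_eq_iff swap_amp_def slice_def)

text \<open>AA' and BB' are complementary parts of one pure state.\<close>

lemma S_BB_swap:
  assumes "finite X" "finite A" "finite Y" "finite B"
  shows "S_BB Y B X A (swap_amp k) = S_BB X A Y B k"
proof -
  have "S_BB X A Y B k = vN_entropy (Y \<times> B) (\<lambda>p q. \<Sum>e\<in>X \<times> A. k (fst e) (snd e) (fst p) (snd p) * cnj (k (fst e) (snd e) (fst q) (snd q)))"
    by (simp add: S_BB_def state_BB_def sum.cartesian_product case_prod_unfold)
  also have "\<dots> = vN_entropy (X \<times> A) (\<lambda>e f. \<Sum>p\<in>Y \<times> B. k (fst e) (snd e) (fst p) (snd p) * cnj (k (fst f) (snd f) (fst p) (snd p)))"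
    by (rule vN_entropy_gram_dual) (use assms in auto)
  also have "\<dots> = S_BB Y B X A (swap_amp k)"
    by (simp add: S_BB_def state_BB_def swap_amp_def sum.cartesian_product case_prod_unfold)
  finally show ?thesis by simp
qed

text \<open>For fixed x the amplitude is still pure on A'BB', so A' and BB' have equal entropy;
  summed over x this identifies the two sides.\<close>

lemma S_YB_swap:
  assumes "finite X" "finite A" "finite Y" "finite B"
  shows "S_YB Y B X A (swap_amp k) = S_XBB X A Y B k"
proof -
  have "vN_entropy (Y \<times> B) (state_BB A k x) = vN_entropy A (\<lambda>a c. \<Sum>p\<in>Y \<times> B. k x a (fst p) (snd p) * cnj (k x c (fst p) (snd p)))" for x
    unfolding state_BB_def[abs_def] by (rule vN_entropy_gram_dual) (use assms in auto)
  then show ?thesis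
    by (simp add: S_XBB_def S_YB_def state_BB_def swap_amp_def sum.cartesian_product case_prod_unfold)
qed

text \<open>With x and y both fixed, the remaining amplitude is pure on A'B'.\<close>

lemma S_XYB_swap:
  assumes "finite A" "finite B"
  shows "S_XYB Y B X A (swap_amp k) = S_XYB X A Y B k"
proof -
  have "vN_entropy B (\<lambda>b c. state_BB A k x (y, b) (y, c)) = vN_entropy A (\<lambda>a c. state_BB B (swap_amp k) y (x, a) (x, c))" for x y
    using vN_entropy_gram_dual[OF assms(2,1), of "\<lambda>b a. k x a y b"] by (simp add: state_BB_def swap_amp_def)
  then show ?thesis unfolding S_XYB_def by (subst sum.swap) simp
qed

text \<open>Exchanging the parties fixes \<open>S_BB\<close> and \<open>S_XYB\<close> and
  interchanges \<open>S_XBB\<close> with \<open>S_YB\<close>, which carry the same sign. Hence the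
  two entries of the maximum in the leakage coincide.\<close>

lemma leak_swap:
  assumes "finite X" "finite A" "finite Y" "finite B"
  shows "leak Y B X A (swap_amp k) = leak X A Y B k"
proof -
  have ss: "swap_amp (swap_amp k) = k" by (simp add: swap_amp_def fun_eq_iff)
  show ?thesis
    using S_BB_swap[OF assms, of k] S_YB_swap[OF assms, of k] S_XYB_swap[OF assms(2,4), of Y X k]
      S_YB_swap[OF assms(3,4,1,2), of "swap_amp k"] unfolding ss leak_def by simp
qed

section \<open>Homogeneity, and invariance under relabelling of the alphabets\<close>

definition scale_amp :: "complex \<Rightarrow> ('x, 'a, 'y, 'b) amplitude \<Rightarrow> ('x, 'a, 'y, 'b) amplitude" where
  "scale_amp c k x a y b = c * k x a y b"

lemma state_BB_scale: "state_BB A (scale_amp c k) x p q = of_real ((cmod c)\<^sup>2) * state_BB A k x p q"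
  unfolding state_BB_def sum_distrib_left complex_norm_square
  by (intro sum.cong refl) (simp add: scale_amp_def)

lemma norm_entropy_scale:
  assumes "finite I" "psd_on I M" "t > 0"
  shows "norm_entropy I (\<lambda>i j. of_real t * M i j) = t * norm_entropy I M"
proof -
  obtain p U where D: "eigen_decomp I M p U"
    using hermitian_eigen_decomp[OF assms(1) psd_on_hermitian[OF assms(2)]] by blast
  have tr: "Re (\<Sum>i\<in>I. M i i) \<ge> 0"
    unfolding eigen_decomp_trace[OF assms(1) D] Re_complex_of_real
    by (intro sum_nonneg eigen_decomp_nonneg[OF assms(1,2) D])
  have "Re (\<Sum>i\<in>I. of_real t * M i i) = t * Re (\<Sum>i\<in>I. M i i)"
    by (simp add: sum_distrib_left[symmetric] del: Re_sum)
  then show ?thesis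
    using vN_entropy_scale[OF assms] ent_mult[OF assms(3) tr]
    by (simp add: norm_entropy_def algebra_simps del: Re_sum)
qed

lemma markov_defect_scale:
  assumes "finite X" "finite B" "c \<noteq> 0"
  shows "markov_defect X A Y B (scale_amp c k) = (cmod c)\<^sup>2 * markov_defect X A Y B k"
proof -
  have t: "(cmod c)\<^sup>2 > 0" using assms by simp
  show ?thesis
    unfolding markov_defect_def state_BB_scale sum_distrib_left[symmetric]
      norm_entropy_scale[OF assms(2) psd_state_B t]
      norm_entropy_scale[OF assms(2) psd_on_sum[OF psd_state_B] t]
    by (simp add: sum_distrib_left right_diff_distrib)
qed

lemma Re_trace_sum: "Re (\<Sum>p\<in>I. \<Sum>x\<in>X. h x p) = (\<Sum>x\<in>X. Re (\<Sum>p\<in>I. h x p))"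
  by (subst sum.swap) (rule Re_sum)

lemma trace_Sigma: "(\<Sum>p\<in>Y \<times> B. M p p) = (\<Sum>y\<in>Y. \<Sum>b\<in>B. M (y, b) (y, b))"
  by (simp add: sum.cartesian_product)

text \<open>Each of the four entropies acquires the same correction, \<open>ent ?t\<close> times the
  total weight \<open>\<tau>\<close>; the signs in \<open>leak\<close> cancel it.\<close>

lemma leak_scale:
  assumes fin: "finite X" "finite Y" "finite B" and c: "c \<noteq> 0"
  shows "leak X A Y B (scale_amp c k) = (cmod c)\<^sup>2 * leak X A Y B k"
proof -
  let ?t = "(cmod c)\<^sup>2"
  have t: "?t > 0" using c by simp
  have YB: "finite (Y \<times> B)" using fin by simp
  define \<tau> where "\<tau> = (\<Sum>x\<in>X. Re (\<Sum>p\<in>Y \<times> B. state_BB A k x p p))"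
  have \<tau>: "\<tau> = (\<Sum>x\<in>X. \<Sum>y\<in>Y. Re (\<Sum>b\<in>B. state_BB A k x (y, b) (y, b)))"
    unfolding \<tau>_def trace_Sigma by (intro sum.cong refl Re_sum)
  have 1: "S_BB X A Y B (scale_amp c k) = ?t * S_BB X A Y B k + ent ?t * \<tau>"
    unfolding S_BB_def state_BB_scale sum_distrib_left[symmetric]
      vN_entropy_scale[OF YB psd_on_sum[OF psd_state_BB] t] Re_trace_sum \<tau>_def ..
  have 2: "S_XBB X A Y B (scale_amp c k) = ?t * S_XBB X A Y B k + ent ?t * \<tau>"
    unfolding S_XBB_def state_BB_scale[abs_def] vN_entropy_scale[OF YB psd_state_BB t] \<tau>_def
    by (simp add: sum.distrib sum_distrib_left del: Re_sum)
  have 3: "S_XYB X A Y B (scale_amp c k) = ?t * S_XYB X A Y B k + ent ?t * \<tau>"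
    unfolding S_XYB_def state_BB_scale vN_entropy_scale[OF fin(3) psd_state_B t] \<tau>
    by (simp add: sum.distrib sum_distrib_left del: Re_sum)
  have 4: "S_YB X A Y B (scale_amp c k) = ?t * S_YB X A Y B k + ent ?t * \<tau>"
  proof -
    have "\<tau> = (\<Sum>y\<in>Y. \<Sum>x\<in>X. Re (\<Sum>b\<in>B. state_BB A k x (y, b) (y, b)))" unfolding \<tau> by (rule sum.swap)
    then show ?thesis
      unfolding S_YB_def state_BB_scale sum_distrib_left[symmetric]
        vN_entropy_scale[OF fin(3) psd_on_sum[OF psd_state_B] t] Re_trace_sum
      by (simp add: sum.distrib sum_distrib_left del: Re_sum)
  qed
  show ?thesis unfolding leak_def 1 2 3 4 by (simp add: algebra_simps)
qed

text \<open>A relabelling is injective only on the symbols that occur, so the amplitude is pushed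
  along these and set to zero off their images.\<close>

definition relabel_amp :: "('x \<Rightarrow> 'u) \<Rightarrow> ('y \<Rightarrow> 'v) \<Rightarrow> 'x set \<Rightarrow> 'y set \<Rightarrow> ('x, 'a, 'y, 'b) amplitude \<Rightarrow> ('u, 'a, 'v, 'b) amplitude" where
  "relabel_amp f g X Y k u a v b =
     (if u \<in> f ` X \<and> v \<in> g ` Y then k (the_inv_into X f u) a (the_inv_into Y g v) b else 0)"

lemma relabel_amp_image:
  assumes "inj_on f X" "inj_on g Y" "x \<in> X" "y \<in> Y"
  shows "relabel_amp f g X Y k (f x) a (g y) b = k x a y b"
  using assms by (simp add: relabel_amp_def the_inv_into_f_f)

lemma leak_support:
  assumes fin: "finite X'" "finite Y'" "finite B" and sub: "X \<subseteq> X'" "Y \<subseteq> Y'"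
    and 0: "\<And>x a y b. x \<in> X' - X \<Longrightarrow> k x a y b = 0" "\<And>x a y b. y \<in> Y' - Y \<Longrightarrow> k x a y b = 0"
  shows "leak X' A Y' B k = leak X A Y B k"
proof -
  have sX: "(\<Sum>x\<in>X'. f x) = (\<Sum>x\<in>X. f x)" if "\<And>x. x \<in> X' - X \<Longrightarrow> f x = 0" for f :: "_ \<Rightarrow> 'z::comm_monoid_add"
    by (rule sum.mono_neutral_right) (use fin sub that in auto)
  have sY: "(\<Sum>x\<in>Y'. f x) = (\<Sum>x\<in>Y. f x)" if "\<And>x. x \<in> Y' - Y \<Longrightarrow> f x = 0" for f :: "_ \<Rightarrow> 'z::comm_monoid_add"
    by (rule sum.mono_neutral_right) (use fin sub that in auto)
  have zx: "state_BB A k x p q = 0" if "x \<in> X' - X" for x p q using 0(1)[OF that] by (simp add: state_BB_def)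
  have zy: "state_BB A k x p q = 0" if "fst p \<in> Y' - Y" for x p q using 0(2)[OF that] by (simp add: state_BB_def)
  have BBsum: "(\<Sum>x\<in>X'. state_BB A k x p q) = (\<Sum>x\<in>X. state_BB A k x p q)" for p q by (rule sX) (rule zx)
  have vY: "vN_entropy (Y' \<times> B) M = vN_entropy (Y \<times> B) M"
    if "hermitian_on (Y' \<times> B) M" "\<And>p q. fst p \<in> Y' - Y \<Longrightarrow> M p q = 0" for M
  proof (rule vN_entropy_support[OF _ _ that(1)])
    fix p q assume "p \<in> Y' \<times> B" "p \<notin> Y \<times> B"
    then show "M p q = 0" by (intro that(2)) auto
  qed (use fin sub in auto)
  have 1: "S_BB X' A Y' B k = S_BB X A Y B k"
    unfolding S_BB_def BBsum by (rule vY[OF herm_sum_BB]) (simp add: zy)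
  have 2: "S_XBB X' A Y' B k = S_XBB X A Y B k"
  proof -
    have "S_XBB X' A Y' B k = (\<Sum>x\<in>X. vN_entropy (Y' \<times> B) (state_BB A k x))"
      unfolding S_XBB_def
    proof (rule sX)
      fix x assume "x \<in> X' - X"
      then have "state_BB A k x = (\<lambda>_ _. 0)" using zx by blast
      then show "vN_entropy (Y' \<times> B) (state_BB A k x) = 0" using vN_entropy_zero[of "Y' \<times> B"] fin by simp
    qed
    also have "\<dots> = S_XBB X A Y B k"
      unfolding S_XBB_def by (rule sum.cong[OF refl], rule vY[OF psd_on_hermitian[OF psd_state_BB]]) (rule zy)
    finally show ?thesis .
  qed
  have 3: "S_YB X' A Y' B k = S_YB X A Y B k"
    unfolding S_YB_def BBsum by (rule sY) (simp add: zy vN_entropy_zero[OF fin(3)])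
  have 4: "S_XYB X' A Y' B k = S_XYB X A Y B k"
  proof -
    have "S_XYB X' A Y' B k = (\<Sum>x\<in>X. \<Sum>y\<in>Y'. vN_entropy B (\<lambda>b c. state_BB A k x (y, b) (y, c)))"
      unfolding S_XYB_def by (rule sX) (simp add: zx vN_entropy_zero[OF fin(3)])
    also have "\<dots> = S_XYB X A Y B k"
      unfolding S_XYB_def by (rule sum.cong[OF refl], rule sY) (simp add: zy vN_entropy_zero[OF fin(3)])
    finally show ?thesis .
  qed
  show ?thesis unfolding leak_def 1 2 3 4 ..
qed

lemma norm_entropy_zero: "finite I \<Longrightarrow> norm_entropy I (\<lambda>_ _. 0) = 0"
  by (simp add: norm_entropy_def vN_entropy_zero ent_def)

lemma markov_defect_support:
  assumes fin: "finite X'" "finite Y'" "finite B" and sub: "X \<subseteq> X'" "Y \<subseteq> Y'"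
    and 0: "\<And>x a y b. x \<in> X' - X \<Longrightarrow> k x a y b = 0" "\<And>x a y b. y \<in> Y' - Y \<Longrightarrow> k x a y b = 0"
  shows "markov_defect X' A Y' B k = markov_defect X A Y B k"
proof -
  have sX: "(\<Sum>x\<in>X'. f x) = (\<Sum>x\<in>X. f x)" if "\<And>x. x \<in> X' - X \<Longrightarrow> f x = 0" for f :: "_ \<Rightarrow> 'z::comm_monoid_add"
    by (rule sum.mono_neutral_right) (use fin sub that in auto)
  have zx: "state_BB A k x p q = 0" if "x \<in> X' - X" for x p q using 0(1)[OF that] by (simp add: state_BB_def)
  have zy: "state_BB A k x p q = 0" if "fst p \<in> Y' - Y" for x p q using 0(2)[OF that] by (simp add: state_BB_def)
  have 1: "(\<Sum>x\<in>X'. state_BB A k x p q) = (\<Sum>x\<in>X. state_BB A k x p q)" for p q by (rule sX) (rule zx)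
  have 2: "(\<Sum>x\<in>X'. norm_entropy B (\<lambda>b c. state_BB A k x (y, b) (y, c))) = (\<Sum>x\<in>X. norm_entropy B (\<lambda>b c. state_BB A k x (y, b) (y, c)))" for y
    by (rule sX) (simp add: zx norm_entropy_zero[OF fin(3)])
  show ?thesis unfolding markov_defect_def 1 2
    by (rule sum.mono_neutral_right) (use fin sub in \<open>auto simp: zy norm_entropy_zero\<close>)
qed

lemma leak_image:
  assumes fin: "finite Y" "finite B" and f: "inj_on f X" and g: "inj_on g Y"
    and k': "\<And>x a y b. x \<in> X \<Longrightarrow> a \<in> A \<Longrightarrow> y \<in> Y \<Longrightarrow> b \<in> B \<Longrightarrow> k' (f x) a (g y) b = k x a y b"
  shows "leak (f ` X) A (g ` Y) B k' = leak X A Y B k"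
proof -
  let ?g = "map_prod g id"
  have bij: "bij_betw ?g (Y \<times> B) (g ` Y \<times> B)"
    using g by (intro bij_betw_imageI) (auto simp: inj_on_def map_prod_image)
  have st: "state_BB A k' (f x) (?g p) (?g q) = state_BB A k x p q" if "x \<in> X" "p \<in> Y \<times> B" "q \<in> Y \<times> B" for x p q
    using that by (auto simp: state_BB_def k' mem_Times_iff)
  have st': "state_BB A k' (f x) (g y, b) (g y, c) = state_BB A k x (y, b) (y, c)" if "x \<in> X" "y \<in> Y" "b \<in> B" "c \<in> B" for x y b c
    using that by (simp add: state_BB_def k')
  have YB: "finite (Y \<times> B)" using fin by simp
  have sX: "(\<Sum>u\<in>f ` X. h u) = (\<Sum>x\<in>X. h (f x))" for h :: "_ \<Rightarrow> 'z::comm_monoid_add"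
    using sum.reindex[OF f, of h] by simp
  have sY: "(\<Sum>u\<in>g ` Y. h u) = (\<Sum>x\<in>Y. h (g x))" for h :: "_ \<Rightarrow> 'z::comm_monoid_add"
    using sum.reindex[OF g, of h] by simp
  have 1: "S_BB (f ` X) A (g ` Y) B k' = S_BB X A Y B k"
    unfolding S_BB_def sX vN_entropy_reindex[OF YB bij herm_sum_BB[of _ _ _ "f ` X", unfolded sX]]
    by (rule vN_entropy_cong[OF YB]) (intro sum.cong refl st)
  have 2: "S_XBB (f ` X) A (g ` Y) B k' = S_XBB X A Y B k"
    unfolding S_XBB_def sX vN_entropy_reindex[OF YB bij psd_on_hermitian[OF psd_state_BB]]
    by (rule sum.cong[OF refl], rule vN_entropy_cong[OF YB]) (rule st)
  have 3: "S_YB (f ` X) A (g ` Y) B k' = S_YB X A Y B k"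
    unfolding S_YB_def sX sY by (intro sum.cong refl vN_entropy_cong[OF fin(2)] st')
  have 4: "S_XYB (f ` X) A (g ` Y) B k' = S_XYB X A Y B k"
    unfolding S_XYB_def sX sY by (intro sum.cong refl vN_entropy_cong[OF fin(2)] st')
  show ?thesis unfolding leak_def 1 2 3 4 ..
qed

lemma norm_entropy_cong:
  assumes "finite I" "\<And>i j. i \<in> I \<Longrightarrow> j \<in> I \<Longrightarrow> M i j = N i j"
  shows "norm_entropy I M = norm_entropy I N"
  using vN_entropy_cong[OF assms] assms(2) by (simp add: norm_entropy_def)

lemma markov_defect_image:
  assumes B: "finite B" and f: "inj_on f X" and g: "inj_on g Y"
    and k': "\<And>x a y b. x \<in> X \<Longrightarrow> a \<in> A \<Longrightarrow> y \<in> Y \<Longrightarrow> b \<in> B \<Longrightarrow> k' (f x) a (g y) b = k x a y b"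
  shows "markov_defect (f ` X) A (g ` Y) B k' = markov_defect X A Y B k"
proof -
  have st': "state_BB A k' (f x) (g y, b) (g y, c) = state_BB A k x (y, b) (y, c)" if "x \<in> X" "y \<in> Y" "b \<in> B" "c \<in> B" for x y b c
    using that by (simp add: state_BB_def k')
  have sX: "(\<Sum>u\<in>f ` X. h u) = (\<Sum>x\<in>X. h (f x))" for h :: "_ \<Rightarrow> 'z::comm_monoid_add"
    using sum.reindex[OF f, of h] by simp
  have sY: "(\<Sum>u\<in>g ` Y. h u) = (\<Sum>x\<in>Y. h (g x))" for h :: "_ \<Rightarrow> 'z::comm_monoid_add"
    using sum.reindex[OF g, of h] by simp
  show ?thesis
    unfolding markov_defect_def sX sY 
    by (intro sum.cong refl arg_cong2[where f="(-)"] norm_entropy_cong[OF B] st')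
qed

lemma relabel_amp_invariant:
  fixes k :: "('x::finite, 'a, 'y::finite, 'b) amplitude" and f :: "'x \<Rightarrow> 'u::finite" and g :: "'y \<Rightarrow> 'v::finite"
  assumes B: "finite B" and f: "inj_on f X" and g: "inj_on g Y"
    and 0: "\<And>x a y b. a \<in> A \<Longrightarrow> b \<in> B \<Longrightarrow> x \<notin> X \<or> y \<notin> Y \<Longrightarrow> k x a y b = 0"
  shows "leak UNIV A UNIV B (relabel_amp f g X Y k) = leak UNIV A UNIV B k"
    and "markov_defect UNIV A UNIV B (relabel_amp f g X Y k) = markov_defect UNIV A UNIV B k"
proof -
  let ?k = "relabel_amp f g X Y k"
  \<comment> \<open>The hypothesis gives zeros only inside the work spaces \<open>A\<close> and
    \<open>B\<close>, whereas the support lemmas ask for zeros everywhere; truncation bridges this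
    without changing any entropy.\<close>
  define k0 where "k0 x a y b = (if a \<in> A \<and> b \<in> B then k x a y b else 0)" for x a y b
  have z: "\<And>u a v b. u \<in> UNIV - f ` X \<Longrightarrow> ?k u a v b = 0" "\<And>u a v b. v \<in> UNIV - g ` Y \<Longrightarrow> ?k u a v b = 0"
    by (auto simp: relabel_amp_def)
  have z0: "\<And>x a y b. x \<in> UNIV - X \<Longrightarrow> k0 x a y b = 0" "\<And>x a y b. y \<in> UNIV - Y \<Longrightarrow> k0 x a y b = 0"
    using 0 by (auto simp: k0_def)
  have k0: "leak UNIV A UNIV B k0 = leak UNIV A UNIV B k" "markov_defect UNIV A UNIV B k0 = markov_defect UNIV A UNIV B k"
    using leak_image[OF finite B inj_on_id inj_on_id, of UNIV A UNIV k0 k]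
      markov_defect_image[OF B inj_on_id inj_on_id, of UNIV A UNIV k0 k] by (simp_all add: k0_def)
  have "leak (f ` X) A (g ` Y) B ?k = leak X A Y B k0"
    by (rule leak_image[OF finite B f g]) (simp add: relabel_amp_image[OF f g] k0_def)
  moreover have "leak UNIV A UNIV B ?k = leak (f ` X) A (g ` Y) B ?k"
    by (rule leak_support[OF finite finite B subset_UNIV subset_UNIV z])
  moreover have "leak UNIV A UNIV B k0 = leak X A Y B k0"
    by (rule leak_support[OF finite finite B subset_UNIV subset_UNIV z0])
  ultimately show "leak UNIV A UNIV B ?k = leak UNIV A UNIV B k" using k0 by simp
  have "markov_defect (f ` X) A (g ` Y) B ?k = markov_defect X A Y B k0"
    by (rule markov_defect_image[OF B f g]) (simp add: relabel_amp_image[OF f g] k0_def)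
  moreover have "markov_defect UNIV A UNIV B ?k = markov_defect (f ` X) A (g ` Y) B ?k"
    by (rule markov_defect_support[OF finite finite B subset_UNIV subset_UNIV z])
  moreover have "markov_defect UNIV A UNIV B k0 = markov_defect X A Y B k0"
    by (rule markov_defect_support[OF finite finite B subset_UNIV subset_UNIV z0])
  ultimately show "markov_defect UNIV A UNIV B ?k = markov_defect UNIV A UNIV B k" using k0 by simp
qed

lemma swap_relabel: "swap_amp (relabel_amp f g X Y k) = relabel_amp g f Y X (swap_amp k)"
  by (auto simp: fun_eq_iff swap_amp_def relabel_amp_def)

lemma swap_scale: "swap_amp (scale_amp c k) = scale_amp c (swap_amp k)"
  by (auto simp: fun_eq_iff swap_amp_def scale_amp_def)

section \<open>Entropies of the registers\<close>

definition amp :: "('x, 'y) qstate \<Rightarrow> ('x, nat, 'y, nat) amplitude" where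
  "amp \<psi> x a y b = \<psi> (x, a, y, b)"

definition swap_idx :: "'x \<times> nat \<times> 'y \<times> nat \<Rightarrow> 'y \<times> nat \<times> 'x \<times> nat" where
  "swap_idx k = (case k of (x, a, y, b) \<Rightarrow> (y, b, x, a))"

lemma swap_idx_simps [simp]: "swap_idx (x, a, y, b) = (y, b, x, a)" "swap_idx (swap_idx k) = k"
  by (auto simp: swap_idx_def split: prod.splits)

lemma inj_swap_idx: "inj_on swap_idx S"
  by (auto simp: inj_on_def swap_idx_def)

lemma finite_full_idx: "finite (full_idx dA dB :: ('x::finite \<times> nat \<times> 'y::finite \<times> nat) set)"
  by (simp add: full_idx_def)

lemma hermitian_red_state: "hermitian_on I (red_state dA dB \<psi> s)"
proof (rule hermitian_onI)
  fix i j
  have agree: "agree s k l \<longleftrightarrow> agree s l k" for k l :: "'a \<times> nat \<times> 'b \<times> nat"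
    by (auto simp: agree_def split: prod.splits)
  have "cnj (red_state dA dB \<psi> s i j) = (\<Sum>k\<in>full_idx dA dB. \<Sum>l\<in>full_idx dA dB.
      if keep_idx s l = j \<and> keep_idx s k = i \<and> agree s l k then \<psi> l * cnj (\<psi> k) else 0)"
    unfolding red_state_def cnj_sum by (intro sum.cong refl) (auto simp: agree)
  also have "\<dots> = red_state dA dB \<psi> s j i"
    unfolding red_state_def by (rule sum.swap)
  finally show "cnj (red_state dA dB \<psi> s i j) = red_state dA dB \<psi> s j i" .
qed

text \<open>\<open>E\<close> runs through the values of the traced registers.
  \<open>\<kappa> e\<close> completes the row index \<open>i\<close> by \<open>e\<close>,
  \<open>\<mu> e\<close> is its only partner over the column index \<open>j\<close>, and
  \<open>c\<close> says that the measured registers of \<open>i\<close> and \<open>j\<close>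
  agree.\<close>

lemma red_state_collapse:
  fixes \<psi> :: "('x::finite, 'y::finite) qstate"
  assumes inj: "inj_on \<kappa> E" and img: "\<kappa> ` E = {m \<in> full_idx dA dB. keep_idx s m = i}"
    and partner: "\<And>e. e \<in> E \<Longrightarrow> {l \<in> full_idx dA dB. keep_idx s l = j \<and> agree s (\<kappa> e) l} = (if c then {\<mu> e} else {})"
  shows "red_state dA dB \<psi> s i j = (if c then \<Sum>e\<in>E. \<psi> (\<kappa> e) * cnj (\<psi> (\<mu> e)) else 0)"
proof -
  let ?F = "full_idx dA dB :: ('x \<times> nat \<times> 'y \<times> nat) set"
  have "red_state dA dB \<psi> s i j = (\<Sum>k\<in>?F. if keep_idx s k = i then
      (\<Sum>l\<in>?F. if keep_idx s l = j \<and> agree s k l then \<psi> k * cnj (\<psi> l) else 0) else 0)"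
    unfolding red_state_def by (intro sum.cong refl) auto
  also have "\<dots> = (\<Sum>k\<in>{m \<in> ?F. keep_idx s m = i}. \<Sum>l\<in>{l \<in> ?F. keep_idx s l = j \<and> agree s k l}. \<psi> k * cnj (\<psi> l))"
    by (simp only: sum.inter_filter[OF finite_full_idx])
  also have "\<dots> = (\<Sum>e\<in>E. \<Sum>l\<in>{l \<in> ?F. keep_idx s l = j \<and> agree s (\<kappa> e) l}. \<psi> (\<kappa> e) * cnj (\<psi> l))"
    unfolding img[symmetric] by (rule sum.reindex[OF inj, unfolded o_def])
  also have "\<dots> = (\<Sum>e\<in>E. if c then \<psi> (\<kappa> e) * cnj (\<psi> (\<mu> e)) else 0)"
    by (intro sum.cong refl) (simp add: partner)
  finally show ?thesis by simp
qed

lemma red_state_swap: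
  fixes \<psi> :: "('x::finite, 'y::finite) qstate"
  shows "red_state dB dA (\<psi> \<circ> swap_idx) (s3, s4, s1, s2) (swap_idx i) (swap_idx j) = red_state dA dB \<psi> (s1, s2, s3, s4) i j"
proof -
  let ?F = "full_idx dA dB :: ('x \<times> nat \<times> 'y \<times> nat) set"
  have F: "full_idx dB dA = swap_idx ` ?F"
    by (auto simp: full_idx_def swap_idx_def image_iff)
  have key: "keep_idx (s3, s4, s1, s2) (swap_idx k) = swap_idx i \<longleftrightarrow> keep_idx (s1, s2, s3, s4) k = i"
    for k i :: "'x \<times> nat \<times> 'y \<times> nat"
    by (auto simp: keep_idx_def swap_idx_def split: prod.splits)
  have agr: "agree (s3, s4, s1, s2) (swap_idx k) (swap_idx l) \<longleftrightarrow> agree (s1, s2, s3, s4) k l"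
    for k l :: "'x \<times> nat \<times> 'y \<times> nat"
    by (auto simp: agree_def swap_idx_def split: prod.splits)
  show ?thesis
    unfolding red_state_def F sum.reindex[OF inj_swap_idx] o_def key agr swap_idx_simps(2) ..
qed

text \<open>Exchanging the parties reduces the entropies that involve A' to those that involve B',
  so explicit computations are made only for A' traced out.\<close>

lemma qS_swap:
  fixes \<psi> :: "('x::finite, 'y::finite) qstate"
  shows "qS dA dB \<psi> (s1, s2, s3, s4) = qS dB dA (\<psi> \<circ> swap_idx) (s3, s4, s1, s2)"
proof -
  let ?R = "red_idx dA dB (s1, s2, s3, s4) :: ('x \<times> nat \<times> 'y \<times> nat) set"
  have "keep_idx (s3, s4, s1, s2) (swap_idx k) = swap_idx (keep_idx (s1, s2, s3, s4) k)" for k :: "'x \<times> nat \<times> 'y \<times> nat"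
    by (auto simp: keep_idx_def swap_idx_def split: prod.splits)
  moreover have "full_idx dB dA = swap_idx ` (full_idx dA dB :: ('x \<times> nat \<times> 'y \<times> nat) set)"
    by (auto simp: full_idx_def swap_idx_def image_iff)
  ultimately have R: "red_idx dB dA (s3, s4, s1, s2) = swap_idx ` ?R"
    by (simp add: red_idx_def image_image)
  have bij: "bij_betw swap_idx ?R (red_idx dB dA (s3, s4, s1, s2))"
    unfolding R by (intro bij_betw_imageI inj_swap_idx) simp
  have fin: "finite ?R" by (simp add: red_idx_def finite_full_idx)
  show ?thesis
    unfolding qS_def vN_entropy_reindex[OF fin bij hermitian_red_state] red_state_swap ..
qed

lemma vN_entropy_diag:
  assumes fin: "finite I"
  shows "vN_entropy I (\<lambda>i j. if i = j then of_real (d i) else 0) = (\<Sum>i\<in>I. ent (d i))"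
proof -
  let ?M = "\<lambda>i j. if i = j then complex_of_real (d i) else 0"
  have herm: "hermitian_on I ?M" for I by (rule hermitian_onI) simp
  have "vN_entropy I ?M = (\<Sum>c\<in>id ` I. vN_entropy {i\<in>I. id i = c} ?M)"
    by (rule vN_entropy_blocks[OF fin herm]) simp
  also have "\<dots> = (\<Sum>c\<in>I. vN_entropy {c} ?M)"
    by (intro sum.cong arg_cong2[where f=vN_entropy]) auto
  finally show ?thesis by (simp add: vN_entropy_singleton[OF herm])
qed

text \<open>If a work space had dimension 0, \<open>full_idx\<close> would be empty and the reduced
  index sets would no longer be in bijection with the alphabets of the surviving registers.\<close>

locale dims =
  fixes dA dB :: nat
  assumes dims: "1 \<le> dA" "1 \<le> dB"
begin

abbreviation "IA \<equiv> {..<dA}"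
abbreviation "IB \<equiv> {..<dB}"

lemma ex_dims: "\<exists>a. a < dA" "\<exists>b. b < dB"
  using dims by (auto simp: Suc_le_eq)

lemma qS_X:
  fixes \<psi> :: "('x::finite, 'y::finite) qstate"
  shows "qS dA dB \<psi> (Meas, Trace, Trace, Trace) = (\<Sum>x\<in>UNIV. ent (\<Sum>y\<in>UNIV. outcome_prob dA dB \<psi> x y))"
proof -
  let ?s = "(Meas, Trace, Trace, Trace)"
  let ?g = "\<lambda>x::'x. (x, 0::nat, undefined::'y, 0::nat)"
  have bij: "bij_betw ?g UNIV (red_idx dA dB ?s)"
    using ex_dims by (auto simp: bij_betw_def inj_on_def red_idx_def keep_idx_def full_idx_def image_iff Bex_def)
  have red: "red_state dA dB \<psi> ?s (?g x) (?g x') = (if x = x' then of_real (\<Sum>y\<in>UNIV. outcome_prob dA dB \<psi> x y) else 0)" for x x'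
  proof -
    have "red_state dA dB \<psi> ?s (?g x) (?g x') = (if x = x' then \<Sum>e\<in>UNIV \<times> IA \<times> IB.
        \<psi> ((\<lambda>(y, a, b). (x, a, y, b)) e) * cnj (\<psi> ((\<lambda>(y, a, b). (x', a, y, b)) e)) else 0)"
      by (rule red_state_collapse) (auto simp: inj_on_def keep_idx_def full_idx_def agree_def image_iff)
    also have "\<dots> = (if x = x' then of_real (\<Sum>y\<in>UNIV. outcome_prob dA dB \<psi> x y) else 0)"
      unfolding outcome_prob_def of_real_sum complex_norm_square
      by (simp add: sum.cartesian_product case_prod_unfold)
    finally show ?thesis .
  qed
  show ?thesis
    unfolding qS_def vN_entropy_reindex[OF finite bij hermitian_red_state] red
    by (rule vN_entropy_diag) simp
qed

lemma qS_BB: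
  fixes \<psi> :: "('x::finite, 'y::finite) qstate"
  shows "qS dA dB \<psi> (Trace, Trace, Keep, Keep) = S_BB UNIV IA UNIV IB (amp \<psi>)"
proof -
  let ?s = "(Trace, Trace, Keep, Keep)"
  let ?g = "\<lambda>p::'y \<times> nat. (undefined::'x, 0::nat, fst p, snd p)"
  have bij: "bij_betw ?g (UNIV \<times> IB) (red_idx dA dB ?s)"
    using ex_dims by (auto simp: bij_betw_def inj_on_def red_idx_def keep_idx_def full_idx_def image_iff Bex_def)
  have red: "red_state dA dB \<psi> ?s (?g p) (?g q) = (\<Sum>x\<in>UNIV. state_BB IA (amp \<psi>) x p q)"
    if "p \<in> UNIV \<times> IB" "q \<in> UNIV \<times> IB" for p q
  proof -
    have "red_state dA dB \<psi> ?s (?g p) (?g q) = (if True then \<Sum>e\<in>UNIV \<times> IA.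
        \<psi> ((\<lambda>(x, a). (x, a, fst p, snd p)) e) * cnj (\<psi> ((\<lambda>(x, a). (x, a, fst q, snd q)) e)) else 0)"
      by (rule red_state_collapse) (use that in \<open>auto simp: inj_on_def keep_idx_def full_idx_def agree_def image_iff\<close>)
    then show ?thesis
      by (simp add: state_BB_def amp_def sum.cartesian_product case_prod_unfold)
  qed
  have fin: "finite ((UNIV :: 'y set) \<times> IB)" by simp
  show ?thesis
    unfolding qS_def vN_entropy_reindex[OF fin bij hermitian_red_state] S_BB_def
    by (rule vN_entropy_cong[OF fin]) (rule red)
qed

lemma qS_YB:
  fixes \<psi> :: "('x::finite, 'y::finite) qstate"
  shows "qS dA dB \<psi> (Trace, Trace, Meas, Keep) = S_YB UNIV IA UNIV IB (amp \<psi>)"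
proof -
  let ?s = "(Trace, Trace, Meas, Keep)"
  let ?g = "\<lambda>p::'y \<times> nat. (undefined::'x, 0::nat, fst p, snd p)"
  have bij: "bij_betw ?g (UNIV \<times> IB) (red_idx dA dB ?s)"
    using ex_dims by (auto simp: bij_betw_def inj_on_def red_idx_def keep_idx_def full_idx_def image_iff Bex_def)
  have red: "red_state dA dB \<psi> ?s (?g p) (?g q) = pinch fst (\<lambda>p q. \<Sum>x\<in>UNIV. state_BB IA (amp \<psi>) x p q) p q"
    if "p \<in> UNIV \<times> IB" "q \<in> UNIV \<times> IB" for p q
  proof -
    have "red_state dA dB \<psi> ?s (?g p) (?g q) = (if fst p = fst q then \<Sum>e\<in>UNIV \<times> IA.
        \<psi> ((\<lambda>(x, a). (x, a, fst p, snd p)) e) * cnj (\<psi> ((\<lambda>(x, a). (x, a, fst q, snd q)) e)) else 0)"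
      by (rule red_state_collapse) (use that in \<open>auto simp: inj_on_def keep_idx_def full_idx_def agree_def image_iff\<close>)
    then show ?thesis
      by (cases p; cases q) (simp add: pinch_def state_BB_def amp_def sum.cartesian_product case_prod_unfold)
  qed
  have fin: "finite ((UNIV :: 'y set) \<times> IB)" by simp
  have "qS dA dB \<psi> ?s = vN_entropy (UNIV \<times> IB) (pinch fst (\<lambda>p q. \<Sum>x\<in>UNIV. state_BB IA (amp \<psi>) x p q))"
    unfolding qS_def vN_entropy_reindex[OF fin bij hermitian_red_state]
    by (rule vN_entropy_cong[OF fin]) (rule red)
  also have "\<dots> = S_YB UNIV IA UNIV IB (amp \<psi>)"
    unfolding S_YB_def by (rule vN_entropy_product_blocks[OF _ _ herm_sum_BB]) auto
  finally show ?thesis .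
qed

text \<open>One computation covers B kept and B measured. \<open>N x\<close> is the unnormalised
  state given X = x, pinched in the second case.\<close>

lemma qS_X_quantum:
  fixes \<psi> :: "('x::finite, 'y::finite) qstate"
  assumes s3: "s3 \<noteq> Trace"
    and N: "\<And>x p q. N x p q = (if s3 = Meas \<and> fst p \<noteq> fst q then 0 else state_BB IA (amp \<psi>) x p q)"
  shows "qS dA dB \<psi> (Meas, Trace, s3, Keep) = (\<Sum>x\<in>UNIV. vN_entropy (UNIV \<times> IB) (N x))"
proof -
  let ?s = "(Meas, Trace, s3, Keep)"
  let ?J = "(UNIV :: 'x set) \<times> ((UNIV :: 'y set) \<times> IB)"
  let ?g = "\<lambda>p::'x \<times> 'y \<times> nat. (fst p, 0::nat, fst (snd p), snd (snd p))"
  let ?M = "\<lambda>i j. if s3 = Meas \<and> fst (snd i) \<noteq> fst (snd j) then 0 else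
     (\<Sum>a\<in>IA. amp \<psi> (fst i) a (fst (snd i)) (snd (snd i)) * cnj (amp \<psi> (fst j) a (fst (snd j)) (snd (snd j))))"
  have bij: "bij_betw ?g ?J (red_idx dA dB ?s)"
    using ex_dims s3 by (auto simp: bij_betw_def inj_on_def red_idx_def keep_idx_def full_idx_def image_iff Bex_def)
  have red: "red_state dA dB \<psi> ?s (?g i) (?g j) = pinch fst ?M i j" if "i \<in> ?J" "j \<in> ?J" for i j
  proof -
    have "red_state dA dB \<psi> ?s (?g i) (?g j) = (if fst i = fst j \<and> (s3 = Meas \<longrightarrow> fst (snd i) = fst (snd j)) then \<Sum>a\<in>IA.
        \<psi> ((\<lambda>a. (fst i, a, fst (snd i), snd (snd i))) a) * cnj (\<psi> ((\<lambda>a. (fst j, a, fst (snd j), snd (snd j))) a)) else 0)"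
    proof (rule red_state_collapse)
      show "(\<lambda>a. (fst i, a, fst (snd i), snd (snd i))) ` IA = {m \<in> full_idx dA dB. keep_idx ?s m = ?g i}"
        using that s3 by (cases s3) (auto simp: keep_idx_def full_idx_def image_iff)
      show "{l \<in> full_idx dA dB. keep_idx ?s l = ?g j \<and> agree ?s (fst i, a, fst (snd i), snd (snd i)) l} =
          (if fst i = fst j \<and> (s3 = Meas \<longrightarrow> fst (snd i) = fst (snd j)) then {(fst j, a, fst (snd j), snd (snd j))} else {})"
        if "a \<in> IA" for a
        using \<open>i \<in> ?J\<close> \<open>j \<in> ?J\<close> that s3 by (cases s3) (auto simp: keep_idx_def full_idx_def agree_def)
    qed (simp add: inj_on_def)
    then show ?thesis by (auto simp: pinch_def amp_def)
  qed
  have fin: "finite ?J" and finYB: "finite ((UNIV :: 'y set) \<times> IB)" by simp_all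
  have hM: "hermitian_on ?J ?M" by (rule hermitian_onI) (auto simp: mult.commute)
  have "qS dA dB \<psi> ?s = vN_entropy ?J (pinch fst ?M)"
    unfolding qS_def vN_entropy_reindex[OF fin bij hermitian_red_state]
    by (rule vN_entropy_cong[OF fin]) (rule red)
  also have "\<dots> = (\<Sum>x\<in>UNIV. vN_entropy (UNIV \<times> IB) (\<lambda>p q. ?M (x, p) (x, q)))"
    by (rule vN_entropy_product_blocks[OF finite finYB hM])
  also have "\<dots> = (\<Sum>x\<in>UNIV. vN_entropy (UNIV \<times> IB) (N x))"
    by (intro sum.cong refl vN_entropy_cong[OF finYB]) (simp add: N state_BB_def)
  finally show ?thesis .
qed

lemma qS_XBB:
  fixes \<psi> :: "('x::finite, 'y::finite) qstate"
  shows "qS dA dB \<psi> (Meas, Trace, Keep, Keep) = S_XBB UNIV IA UNIV IB (amp \<psi>)"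
  unfolding S_XBB_def by (rule qS_X_quantum) auto

lemma qS_XYB:
  fixes \<psi> :: "('x::finite, 'y::finite) qstate"
  shows "qS dA dB \<psi> (Meas, Trace, Meas, Keep) = S_XYB UNIV IA UNIV IB (amp \<psi>)"
proof -
  have "qS dA dB \<psi> (Meas, Trace, Meas, Keep) = (\<Sum>x\<in>UNIV. vN_entropy (UNIV \<times> IB) (pinch fst (state_BB IA (amp \<psi>) x)))"
    by (rule qS_X_quantum) (auto simp: pinch_def)
  also have "\<dots> = S_XYB UNIV IA UNIV IB (amp \<psi>)"
    unfolding S_XYB_def
    by (intro sum.cong refl vN_entropy_product_blocks psd_on_hermitian[OF psd_state_BB]) auto
  finally show ?thesis .
qed

end

lemma amp_swap: "amp (\<psi> \<circ> swap_idx) = swap_amp (amp \<psi>)"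
  by (simp add: fun_eq_iff amp_def swap_amp_def)

lemma outcome_prob_swap: "outcome_prob dB dA (\<psi> \<circ> swap_idx) y x = outcome_prob dA dB \<psi> x y"
  unfolding outcome_prob_def by (subst sum.swap) simp

section \<open>Embedding conditions as vanishing conditional information\<close>

definition mutual_info :: "('x::finite \<Rightarrow> 'y::finite \<Rightarrow> real) \<Rightarrow> real" where
  "mutual_info r = (\<Sum>x\<in>UNIV. ent (\<Sum>y\<in>UNIV. r x y)) + (\<Sum>y\<in>UNIV. ent (\<Sum>x\<in>UNIV. r x y)) - (\<Sum>x\<in>UNIV. \<Sum>y\<in>UNIV. ent (r x y))"

lemma mutual_info_swap: "mutual_info (\<lambda>y x. r x y) = mutual_info r"
proof -
  have "(\<Sum>y\<in>UNIV. \<Sum>x\<in>UNIV. ent (r x y)) = (\<Sum>x\<in>UNIV. \<Sum>y\<in>UNIV. ent (r x y))" by (rule sum.swap)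
  then show ?thesis by (simp add: mutual_info_def)
qed

lemma shannon_MI_eq: "shannon_MI P = mutual_info (\<lambda>x y. pmf P (x, y))"
proof -
  have H: "shannon_H p = (\<Sum>a\<in>UNIV. ent (pmf p a))" for p :: "'c::finite pmf"
    by (simp add: shannon_H_def ent_def sum_negf)
  have "pmf (map_pmf fst P) x = (\<Sum>y\<in>UNIV. pmf P (x, y))" for x
  proof -
    have "pmf (map_pmf fst P) x = (\<Sum>p\<in>fst -` {x}. pmf P p)"
      by (simp add: pmf_map measure_measure_pmf_finite)
    also have "fst -` {x} = Pair x ` UNIV" by auto
    finally show ?thesis by (simp add: sum.reindex inj_on_def)
  qed
  moreover have "pmf (map_pmf snd P) y = (\<Sum>x\<in>UNIV. pmf P (x, y))" for y
  proof -
    have "pmf (map_pmf snd P) y = (\<Sum>p\<in>snd -` {y}. pmf P p)"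
      by (simp add: pmf_map measure_measure_pmf_finite)
    also have "snd -` {y} = (\<lambda>x. (x, y)) ` UNIV" by auto
    finally show ?thesis by (simp add: sum.reindex inj_on_def)
  qed
  moreover have "(\<Sum>p\<in>UNIV. ent (pmf P p)) = (\<Sum>x\<in>UNIV. \<Sum>y\<in>UNIV. ent (pmf P (x, y)))"
    by (simp add: sum.cartesian_product UNIV_Times_UNIV[symmetric] del: UNIV_Times_UNIV)
  ultimately show ?thesis by (simp add: shannon_MI_def mutual_info_def H)
qed

text \<open>The chain rule S(X;YB') = I(X;Y) + S(X;B'|Y): after the traces of the conditional states
  of B' are identified with joint probabilities, the remaining terms are the defect.\<close>

lemma S_X_YB'_eq:
  fixes \<psi> :: "('x::finite, 'y::finite) qstate"
  assumes "1 \<le> dA" "1 \<le> dB"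
  shows "S_X_YB' dA dB \<psi> = mutual_info (outcome_prob dA dB \<psi>) + markov_defect UNIV {..<dA} UNIV {..<dB} (amp \<psi>)"
proof -
  interpret dims dA dB by (standard; fact)
  have out: "Re (\<Sum>b\<in>IB. state_BB IA (amp \<psi>) x (y, b) (y, b)) = outcome_prob dA dB \<psi> x y" for x y
  proof -
    have "(\<Sum>b\<in>IB. state_BB IA (amp \<psi>) x (y, b) (y, b)) = of_real (outcome_prob dA dB \<psi> x y)"
      unfolding outcome_prob_def of_real_sum complex_norm_square state_BB_def amp_def fst_conv snd_conv by (rule sum.swap)
    then show ?thesis by simp
  qed
  have sum_out: "Re (\<Sum>b\<in>IB. \<Sum>x\<in>UNIV. state_BB IA (amp \<psi>) x (y, b) (y, b)) = (\<Sum>x\<in>UNIV. outcome_prob dA dB \<psi> x y)" for y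
    by (subst sum.swap) (simp only: Re_sum[of _ UNIV] out)
  have "markov_defect UNIV IA UNIV IB (amp \<psi>) = S_YB UNIV IA UNIV IB (amp \<psi>) - (\<Sum>y\<in>UNIV. ent (\<Sum>x\<in>UNIV. outcome_prob dA dB \<psi> x y))
      - (\<Sum>y\<in>UNIV. \<Sum>x\<in>UNIV. vN_entropy IB (\<lambda>b c. state_BB IA (amp \<psi>) x (y, b) (y, c))) + (\<Sum>y\<in>UNIV. \<Sum>x\<in>UNIV. ent (outcome_prob dA dB \<psi> x y))"
    unfolding markov_defect_def norm_entropy_def out sum_out S_YB_def by (simp only: sum_subtractf)
  also have "(\<Sum>y\<in>UNIV. \<Sum>x\<in>UNIV. vN_entropy IB (\<lambda>b c. state_BB IA (amp \<psi>) x (y, b) (y, c))) = S_XYB UNIV IA UNIV IB (amp \<psi>)"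
    unfolding S_XYB_def by (rule sum.swap)
  also have "(\<Sum>y\<in>UNIV. \<Sum>x\<in>UNIV. ent (outcome_prob dA dB \<psi> x y)) = (\<Sum>x\<in>UNIV. \<Sum>y\<in>UNIV. ent (outcome_prob dA dB \<psi> x y))"
    by (rule sum.swap)
  finally show ?thesis
    by (simp add: S_X_YB'_def qMI_def qS_X qS_YB qS_XYB mutual_info_def)
qed

text \<open>The entropy of X is common to both informations, and the four remaining entropies form
  \<open>leak\<close>.\<close>

lemma S_X_BB'_eq:
  fixes \<psi> :: "('x::finite, 'y::finite) qstate"
  assumes "1 \<le> dA" "1 \<le> dB"
  shows "S_X_BB' dA dB \<psi> = S_X_YB' dA dB \<psi> + leak UNIV {..<dA} UNIV {..<dB} (amp \<psi>)"
proof -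
  interpret dims dA dB by (standard; fact)
  show ?thesis
    by (simp add: S_X_BB'_def S_X_YB'_def qMI_def qS_X qS_YB qS_XYB qS_BB qS_XBB leak_def)
qed

lemma S_XA'_Y_swap: "S_XA'_Y dA dB \<psi> = S_X_YB' dB dA (\<psi> \<circ> swap_idx)"
  unfolding S_XA'_Y_def S_X_YB'_def qMI_def qS_swap[of dA dB \<psi>] by simp

lemma S_AA'_Y_swap: "S_AA'_Y dA dB \<psi> = S_X_BB' dB dA (\<psi> \<circ> swap_idx)"
  unfolding S_AA'_Y_def S_X_BB'_def qMI_def qS_swap[of dA dB \<psi>] by simp

lemma sum_full_idx:
  fixes \<psi> :: "('x::finite, 'y::finite) qstate"
  shows "(\<Sum>k\<in>full_idx dA dB. (cmod (\<psi> k))\<^sup>2) = (\<Sum>x\<in>UNIV. \<Sum>y\<in>UNIV. outcome_prob dA dB \<psi> x y)"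
proof -
  have "(\<Sum>k\<in>full_idx dA dB. (cmod (\<psi> k))\<^sup>2) = (\<Sum>x\<in>UNIV. \<Sum>a<dA. \<Sum>y\<in>UNIV. \<Sum>b<dB. (cmod (\<psi> (x, a, y, b)))\<^sup>2)"
    by (simp add: full_idx_def sum.cartesian_product case_prod_unfold)
  also have "\<dots> = (\<Sum>x\<in>UNIV. \<Sum>y\<in>UNIV. outcome_prob dA dB \<psi> x y)"
    unfolding outcome_prob_def by (rule sum.cong[OF refl], rule sum.swap)
  finally show ?thesis .
qed

text \<open>By the chain rule each embedding equation says that one defect vanishes, the second
  after the parties are exchanged. The result is inherited by slices and stable under scaling and
  relabelling.\<close>

theorem is_embedding_iff:
  "is_embedding P dA dB \<psi> \<longleftrightarrow> 1 \<le> dA \<and> 1 \<le> dB \<and> (\<forall>x y. outcome_prob dA dB \<psi> x y = pmf P (x, y)) \<and>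
     markov_defect UNIV {..<dA} UNIV {..<dB} (amp \<psi>) = 0 \<and>
     markov_defect UNIV {..<dB} UNIV {..<dA} (swap_amp (amp \<psi>)) = 0"
proof -
  have "(\<Sum>k\<in>full_idx dA dB. (cmod (\<psi> k))\<^sup>2) = 1" if "\<And>x y. outcome_prob dA dB \<psi> x y = pmf P (x, y)"
  proof -
    have "(\<Sum>x\<in>UNIV. \<Sum>y\<in>UNIV. pmf P (x, y)) = (\<Sum>p\<in>UNIV. pmf P p)"
      by (simp add: sum.cartesian_product UNIV_Times_UNIV[symmetric] del: UNIV_Times_UNIV)
    also have "\<dots> = 1" by (rule sum_pmf_eq_1) auto
    finally show ?thesis by (simp add: sum_full_idx that)
  qed
  moreover have "S_X_YB' dA dB \<psi> = shannon_MI P \<longleftrightarrow> markov_defect UNIV {..<dA} UNIV {..<dB} (amp \<psi>) = 0"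
    "S_XA'_Y dA dB \<psi> = shannon_MI P \<longleftrightarrow> markov_defect UNIV {..<dB} UNIV {..<dA} (swap_amp (amp \<psi>)) = 0"
    if d: "1 \<le> dA" "1 \<le> dB" and out: "\<And>x y. outcome_prob dA dB \<psi> x y = pmf P (x, y)"
  proof -
    show "S_X_YB' dA dB \<psi> = shannon_MI P \<longleftrightarrow> markov_defect UNIV {..<dA} UNIV {..<dB} (amp \<psi>) = 0"
      by (simp add: S_X_YB'_eq[OF d] shannon_MI_eq out[abs_def])
    have "outcome_prob dB dA (\<psi> \<circ> swap_idx) = (\<lambda>y x. pmf P (x, y))"
      by (simp add: fun_eq_iff outcome_prob_swap out)
    then show "S_XA'_Y dA dB \<psi> = shannon_MI P \<longleftrightarrow> markov_defect UNIV {..<dB} UNIV {..<dA} (swap_amp (amp \<psi>)) = 0"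
      by (simp add: S_XA'_Y_swap S_X_YB'_eq[OF d(2,1)] shannon_MI_eq amp_swap
          mutual_info_swap[of "\<lambda>x y. pmf P (x, y)"])
  qed
  ultimately show ?thesis unfolding is_embedding_def is_pure_state_def by blast
qed

text \<open>The embedding equations replace the Shannon information in both entries of the maximum
  by S(X;YB') and S(XA';Y). The entries then are \<open>leak\<close> for the two orders of the
  parties.\<close>

theorem leakage_state_embedding:
  assumes "is_embedding P dA dB \<psi>"
  shows "leakage_state P dA dB \<psi> = leak UNIV {..<dA} UNIV {..<dB} (amp \<psi>)"
proof -
  have d: "1 \<le> dA" "1 \<le> dB" using assms by (auto simp: is_embedding_iff)
  have "S_X_BB' dA dB \<psi> - shannon_MI P = leak UNIV {..<dA} UNIV {..<dB} (amp \<psi>)"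
    using assms by (simp add: S_X_BB'_eq[OF d] is_embedding_def)
  moreover have "S_AA'_Y dA dB \<psi> - shannon_MI P = leak UNIV {..<dB} UNIV {..<dA} (swap_amp (amp \<psi>))"
    using assms by (simp add: S_AA'_Y_swap S_X_BB'_eq[OF d(2,1)] amp_swap S_XA'_Y_swap is_embedding_def)
  moreover have "leak UNIV {..<dB} UNIV {..<dA} (swap_amp (amp \<psi>)) = leak UNIV {..<dA} UNIV {..<dB} (amp \<psi>)"
    by (rule leak_swap) auto
  ultimately show ?thesis by (simp add: leakage_state_def)
qed

section \<open>Embeddings and leakage\<close>

lemma markov_defect_singleton: "markov_defect X A Y {b} k = 0"
proof -
  have 1: "norm_entropy {b} M = 0" if "psd_on {b} M" for M
    using vN_entropy_singleton[OF psd_on_hermitian[OF that]] by (simp add: norm_entropy_def)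
  show ?thesis
    unfolding markov_defect_def by (simp add: 1[OF psd_state_B] 1[OF psd_on_sum[OF psd_state_B]])
qed

text \<open>Needed because an infimum over the empty set would carry no information.\<close>

lemma embedding_exists: "\<exists>dA dB \<psi>. is_embedding P dA dB \<psi>"
proof -
  \<comment> \<open>Square roots of the probabilities with trivial work spaces: on a one-dimensional
    B' or A' the defects vanish.\<close>
  define \<psi> where "\<psi> = (\<lambda>(x, a::nat, y, b::nat). complex_of_real (sqrt (pmf P (x, y))))"
  have "is_embedding P 1 1 \<psi>"
    by (simp add: is_embedding_iff markov_defect_singleton outcome_prob_def \<psi>_def lessThan_Suc)
  then show ?thesis by blast
qed

lemma leakage_state_nonneg: "is_embedding P dA dB \<psi> \<Longrightarrow> 0 \<le> leakage_state P dA dB \<psi>"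
  by (simp add: leakage_state_embedding leak_nonneg)

lemma leakage_nonneg: "0 \<le> leakage P"
  unfolding leakage_def by (rule cInf_greatest) (use embedding_exists[of P] leakage_state_nonneg in auto)

lemma leakage_le:
  assumes "is_embedding P dA dB \<psi>"
  shows "leakage P \<le> leak UNIV {..<dA} UNIV {..<dB} (amp \<psi>)"
proof -
  have "leakage P \<le> leakage_state P dA dB \<psi>"
    unfolding leakage_def
    by (rule cInf_lower) (use assms leakage_state_nonneg in \<open>auto intro!: bdd_belowI[of _ 0]\<close>)
  then show ?thesis using leakage_state_embedding[OF assms] by simp
qed

section \<open>Slices and relabellings as embeddings\<close>

definition unamp :: "('x, nat, 'y, nat) amplitude \<Rightarrow> ('x, 'y) qstate" where
  "unamp k = (\<lambda>(x, a, y, b). k x a y b)"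

lemma amp_unamp: "amp (unamp k) = k"
  by (simp add: fun_eq_iff amp_def unamp_def)

lemma outcome_prob_unamp: "outcome_prob dA dB (unamp k) x y = (\<Sum>a<dA. \<Sum>b<dB. (cmod (k x a y b))\<^sup>2)"
  by (simp add: outcome_prob_def unamp_def)

text \<open>Positive probability makes the conditioning event meet the support, as the evaluation of
  \<open>cond_pmf\<close> requires; within the event only one outcome maps to (a, b).\<close>

lemma pmf_cond0:
  fixes Q :: "(('x0::finite \<times> 'x1::finite) \<times> ('y0::finite \<times> 'y1::finite)) pmf"
  assumes pos: "pmf (marg1 Q) (x, y) > 0"
  shows "pmf (cond0 Q x y) (a, b) = pmf Q ((a, x), (b, y)) / pmf (marg1 Q) (x, y)"
proof -
  let ?S = "{((a, x'), (b, y')). x' = x \<and> y' = y} :: (('x0 \<times> 'x1) \<times> ('y0 \<times> 'y1)) set"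
  let ?f = "\<lambda>((a, _), (b, _)). (a, b) :: 'x0 \<times> 'y0"
  have "(\<lambda>((a, x), (b, y)). (x, y)) -` {(x, y)} = ?S" by auto
  then have marg: "measure (measure_pmf Q) ?S = pmf (marg1 Q) (x, y)"
    by (simp add: marg1_def pmf_map)
  have ne: "set_pmf Q \<inter> ?S \<noteq> {}"
  proof
    assume "set_pmf Q \<inter> ?S = {}"
    then have "measure (measure_pmf Q) ?S = 0" by (simp add: measure_pmf_zero_iff)
    with marg pos show False by simp
  qed
  have "pmf (cond0 Q x y) (a, b) = (\<Sum>z\<in>?f -` {(a, b)}. pmf (cond_pmf Q ?S) z)"
    unfolding cond0_def pmf_map by (rule measure_measure_pmf_finite) (rule finite)
  also have "\<dots> = (\<Sum>z\<in>{((a, x), (b, y))}. pmf (cond_pmf Q ?S) z)"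
  proof (rule sum.mono_neutral_right)
    show "\<forall>z\<in>?f -` {(a, b)} - {((a, x), (b, y))}. pmf (cond_pmf Q ?S) z = 0"
    proof
      fix z assume "z \<in> ?f -` {(a, b)} - {((a, x), (b, y))}"
      then have "z \<notin> ?S" by (cases z) auto
      then show "pmf (cond_pmf Q ?S) z = 0" unfolding pmf_cond[OF ne] by (rule if_not_P)
    qed
  qed auto
  also have "\<dots> = pmf (cond_pmf Q ?S) ((a, x), (b, y))" by simp
  also have "\<dots> = pmf Q ((a, x), (b, y)) / pmf (marg1 Q) (x, y)"
    unfolding pmf_cond[OF ne] marg by simp
  finally show ?thesis .
qed

text \<open>The slice has total weight equal to the probability of (x, y), so its amplitude is
  divided by the square root. The defects vanish by \<open>markov_defect_slice\<close>, used once
  for each order of the parties.\<close>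

lemma embedding_slice:
  fixes Q :: "(('x0::finite \<times> 'x1::finite) \<times> ('y0::finite \<times> 'y1::finite)) pmf"
  assumes emb: "is_embedding Q dA dB \<psi>" and pos: "pmf (marg1 Q) (x, y) > 0"
  defines "k \<equiv> scale_amp (of_real (1 / sqrt (pmf (marg1 Q) (x, y)))) (slice x y (amp \<psi>))"
  shows "is_embedding (cond0 Q x y) dA dB (unamp k)"
    and "leak UNIV {..<dA} UNIV {..<dB} (slice x y (amp \<psi>)) = pmf (marg1 Q) (x, y) * leak UNIV {..<dA} UNIV {..<dB} k"
proof -
  let ?p = "pmf (marg1 Q) (x, y)" and ?c = "complex_of_real (1 / sqrt (pmf (marg1 Q) (x, y)))"
  have c0: "?c \<noteq> 0" and c2: "(cmod ?c)\<^sup>2 = 1 / ?p"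
    using pos by (simp_all only: norm_of_real) (simp_all add: power_divide)
  have e: "1 \<le> dA" "1 \<le> dB" "\<And>x y. outcome_prob dA dB \<psi> x y = pmf Q (x, y)"
      "markov_defect UNIV {..<dA} UNIV {..<dB} (amp \<psi>) = 0"
      "markov_defect UNIV {..<dB} UNIV {..<dA} (swap_amp (amp \<psi>)) = 0"
    using emb by (auto simp: is_embedding_iff)
  have "outcome_prob dA dB (unamp k) a b = pmf (cond0 Q x y) (a, b)" for a b
  proof -
    have "outcome_prob dA dB (unamp k) a b = (\<Sum>i<dA. \<Sum>j<dB. (cmod ?c)\<^sup>2 * (cmod (\<psi> ((a, x), i, (b, y), j)))\<^sup>2)"
      unfolding outcome_prob_unamp k_def scale_amp_def slice_def amp_def norm_mult power_mult_distrib ..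
    also have "\<dots> = 1 / ?p * outcome_prob dA dB \<psi> (a, x) (b, y)"
      unfolding c2 outcome_prob_def sum_distrib_left ..
    finally show ?thesis by (simp add: e(3) pmf_cond0[OF pos])
  qed
  moreover have "markov_defect UNIV {..<dA} UNIV {..<dB} (slice x y (amp \<psi>)) = 0"
    by (rule markov_defect_slice[of UNIV UNIV UNIV UNIV]) (use e in auto)
  then have "markov_defect UNIV {..<dA} UNIV {..<dB} k = 0"
    unfolding k_def using c0 by (subst markov_defect_scale) auto
  moreover have "markov_defect UNIV {..<dB} UNIV {..<dA} (slice y x (swap_amp (amp \<psi>))) = 0"
    by (rule markov_defect_slice[of UNIV UNIV UNIV UNIV]) (use e in auto)
  then have "markov_defect UNIV {..<dB} UNIV {..<dA} (swap_amp k) = 0"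
    unfolding k_def swap_scale swap_slice using c0 by (subst markov_defect_scale) auto
  ultimately show "is_embedding (cond0 Q x y) dA dB (unamp k)"
    using e by (simp add: is_embedding_iff amp_unamp)
  have "leak UNIV {..<dA} UNIV {..<dB} k = 1 / ?p * leak UNIV {..<dA} UNIV {..<dB} (slice x y (amp \<psi>))"
    unfolding k_def c2[symmetric] by (rule leak_scale) (use c0 in auto)
  then show "leak UNIV {..<dA} UNIV {..<dB} (slice x y (amp \<psi>)) = ?p * leak UNIV {..<dA} UNIV {..<dB} k"
    using pos by simp
qed

lemma embedding_relabel:
  fixes Q :: "('x::finite \<times> 'y::finite) pmf" and P :: "('u::finite \<times> 'v::finite) pmf"
  assumes emb: "is_embedding Q dA dB \<psi>" and rel: "relabel_eq Q P"
  shows "\<exists>\<phi>. is_embedding P dA dB \<phi> \<and> leak UNIV {..<dA} UNIV {..<dB} (amp \<phi>) = leak UNIV {..<dA} UNIV {..<dB} (amp \<psi>)"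
proof -
  let ?X = "fst ` set_pmf Q" and ?Y = "snd ` set_pmf Q"
  obtain f g where f: "inj_on f ?X" and g: "inj_on g ?Y" and P: "map_pmf (map_prod f g) Q = P"
    using rel by (auto simp: relabel_eq_def)
  let ?k = "relabel_amp f g ?X ?Y (amp \<psi>)"
  have e: "1 \<le> dA" "1 \<le> dB" "\<And>x y. outcome_prob dA dB \<psi> x y = pmf Q (x, y)"
      "markov_defect UNIV {..<dA} UNIV {..<dB} (amp \<psi>) = 0"
      "markov_defect UNIV {..<dB} UNIV {..<dA} (swap_amp (amp \<psi>)) = 0"
    using emb by (auto simp: is_embedding_iff)
  \<comment> \<open>A symbol outside the support has outcome probability 0, a sum of squares, so
    every amplitude within the work spaces vanishes.\<close>
  have 0: "amp \<psi> x a y b = 0" if "a \<in> {..<dA}" "b \<in> {..<dB}" "x \<notin> ?X \<or> y \<notin> ?Y" for x a y b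
  proof -
    have "(x, y) \<notin> set_pmf Q" using that(3) by force
    then have "(\<Sum>a<dA. \<Sum>b<dB. (cmod (\<psi> (x, a, y, b)))\<^sup>2) = 0"
      using e(3)[of x y] by (simp add: outcome_prob_def set_pmf_iff)
    then have "(\<Sum>b<dB. (cmod (\<psi> (x, a, y, b)))\<^sup>2) = 0"
      using that(1) by (subst (asm) sum_nonneg_eq_0_iff) (auto intro: sum_nonneg)
    then show ?thesis
      using that(2) by (subst (asm) sum_nonneg_eq_0_iff) (auto simp: amp_def)
  qed
  have zs: "swap_amp (amp \<psi>) y b x a = 0" if "b \<in> {..<dB}" "a \<in> {..<dA}" "y \<notin> ?Y \<or> x \<notin> ?X" for x a y b
    using 0[of a b x y] that by (auto simp: swap_amp_def)
  have inj: "inj_on (map_prod f g) (?X \<times> ?Y)" by (rule map_prod_inj_on[OF f g])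
  have sub: "set_pmf Q \<subseteq> ?X \<times> ?Y" by force
  \<comment> \<open>Injectivity on the product of the two marginal supports is used: a pair of
    probability 0 inside the product cannot be mapped onto a pair in the support of
    \<open>P\<close>.\<close>
  have pP: "pmf P (map_prod f g z) = pmf Q z" if "z \<in> ?X \<times> ?Y" for z
  proof (cases "z \<in> set_pmf Q")
    case True
    then show ?thesis unfolding P[symmetric] by (rule pmf_map_inj[OF inj_on_subset[OF inj sub]])
  next
    case False
    then have "map_prod f g z \<notin> set_pmf P"
      unfolding P[symmetric] set_map_pmf inj_on_image_mem_iff[OF inj that sub] .
    then show ?thesis using False by (simp add: set_pmf_iff)
  qed
  have "outcome_prob dA dB (unamp ?k) u v = pmf P (u, v)" for u v
  proof (cases "u \<in> f ` ?X \<and> v \<in> g ` ?Y")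
    case True
    then obtain x y where xy: "x \<in> ?X" "y \<in> ?Y" "u = f x" "v = g y" by blast
    have "outcome_prob dA dB (unamp ?k) u v = outcome_prob dA dB \<psi> x y"
      unfolding outcome_prob_unamp xy(3,4) relabel_amp_image[OF f g xy(1,2)] by (simp add: outcome_prob_def amp_def)
    also have "\<dots> = pmf P (u, v)" using pP[of "(x, y)"] xy by (simp add: e(3))
    finally show ?thesis .
  next
    case False
    then have "(u, v) \<notin> set_pmf P" unfolding P[symmetric] by force
    moreover have "outcome_prob dA dB (unamp ?k) u v = 0"
      unfolding outcome_prob_unamp using False by (auto simp: relabel_amp_def)
    ultimately show ?thesis by (simp add: set_pmf_iff)
  qed
  moreover have "markov_defect UNIV {..<dA} UNIV {..<dB} ?k = 0"
    unfolding e(4)[symmetric] by (rule relabel_amp_invariant(2)[OF finite_lessThan f g]) (rule 0)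
  moreover have "markov_defect UNIV {..<dB} UNIV {..<dA} (swap_amp ?k) = 0"
    unfolding swap_relabel e(5)[symmetric] by (rule relabel_amp_invariant(2)[OF finite_lessThan g f]) (rule zs)
  ultimately have "is_embedding P dA dB (unamp ?k)"
    using e by (simp add: is_embedding_iff amp_unamp)
  moreover have "leak UNIV {..<dA} UNIV {..<dB} ?k = leak UNIV {..<dA} UNIV {..<dB} (amp \<psi>)"
    by (rule relabel_amp_invariant(1)[OF finite_lessThan f g]) (rule 0)
  ultimately show ?thesis using amp_unamp by metis
qed

text \<open>As \<open>leakage\<close> is an infimum, it suffices to bound a single embedding of
  \<open>P'\<close>. Each slice whose conditional distribution is a relabelling of \<open>P\<close>
  yields an embedding of \<open>P\<close>, weighted by its probability.\<close>

theorem theorem5: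
  fixes P :: "('x::finite \<times> 'y::finite) pmf"
    and P' :: "(('x0::finite \<times> 'x1::finite) \<times> ('y0::finite \<times> 'y1::finite)) pmf"
    and \<delta> :: real
  assumes "(\<Sum>(x, y) \<in> {(x, y). pmf (marg1 P') (x, y) > 0 \<and> relabel_eq (cond0 P' x y) P}.
              pmf (marg1 P') (x, y)) \<ge> 1 - \<delta>"
  shows "leakage P' \<ge> (1 - \<delta>) * leakage P"
proof -
  let ?G = "{(x, y). pmf (marg1 P') (x, y) > 0 \<and> relabel_eq (cond0 P' x y) P}"
  have "(1 - \<delta>) * leakage P \<le> l" if "l \<in> {leakage_state P' dA dB \<psi> | dA dB \<psi>. is_embedding P' dA dB \<psi>}" for l
  proof -
    from that obtain dA dB \<psi> where emb: "is_embedding P' dA dB \<psi>" and l: "l = leakage_state P' dA dB \<psi>" by blast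
    let ?L = "leak UNIV {..<dA} UNIV {..<dB}"
    have good: "pmf (marg1 P') z * leakage P \<le> ?L (slice (fst z) (snd z) (amp \<psi>))" if "z \<in> ?G" for z
    proof -
      obtain x y where z: "z = (x, y)" by (cases z)
      with that have pos: "pmf (marg1 P') (x, y) > 0" and rel: "relabel_eq (cond0 P' x y) P" by auto
      obtain \<phi> where "is_embedding P dA dB \<phi>" "?L (amp \<phi>) = ?L (scale_amp (of_real (1 / sqrt (pmf (marg1 P') (x, y)))) (slice x y (amp \<psi>)))"
        using embedding_relabel[OF embedding_slice(1)[OF emb pos] rel] unfolding amp_unamp by blast
      then have "leakage P \<le> ?L (scale_amp (of_real (1 / sqrt (pmf (marg1 P') (x, y)))) (slice x y (amp \<psi>)))"
        using leakage_le by metis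
      then show ?thesis using embedding_slice(2)[OF emb pos] pos by (simp add: z)
    qed
    \<comment> \<open>Multiplication by \<open>leakage P\<close> preserves the hypothesis because
      the leakage is nonnegative.\<close>
    have "(1 - \<delta>) * leakage P \<le> (\<Sum>z\<in>?G. pmf (marg1 P') z) * leakage P"
      using assms leakage_nonneg by (intro mult_right_mono) (simp_all add: case_prod_unfold)
    also have "\<dots> \<le> (\<Sum>z\<in>?G. ?L (slice (fst z) (snd z) (amp \<psi>)))"
      unfolding sum_distrib_right by (rule sum_mono[OF good])
    \<comment> \<open>The slices outside \<open>?G\<close> only add nonnegative terms.\<close>
    also have "\<dots> \<le> (\<Sum>z\<in>UNIV. ?L (slice (fst z) (snd z) (amp \<psi>)))"
      by (rule sum_mono2) (auto intro: leak_nonneg)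
    also have "\<dots> = (\<Sum>x\<in>UNIV. \<Sum>y\<in>UNIV. ?L (slice x y (amp \<psi>)))"
      by (simp add: sum.cartesian_product case_prod_unfold UNIV_Times_UNIV[symmetric] del: UNIV_Times_UNIV)
    also have "\<dots> \<le> leak (UNIV \<times> UNIV) {..<dA} (UNIV \<times> UNIV) {..<dB} (amp \<psi>)"
      by (rule leak_slices) auto
    finally show ?thesis by (simp add: l leakage_state_embedding[OF emb])
  qed
  then show ?thesis
    unfolding leakage_def[of P'] by (intro cInf_greatest) (use embedding_exists[of P'] in blast)
qed

end
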